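(* Let $S=\{(x,y):0<y<\pi\}$. If $F\in H^1(S)$ then $T_0F$ and $T_1F$ belong to $\tilde H^{1/2}(\mathbb{R})$ and $T_0F-T_1F\in L^2(\mathbb{R})$, with $$\|T_0F\|_{\tilde H^{1/2}(\mathbb{R})}^2+\|T_1F\|_{\tilde H^{1/2}(\mathbb{R})}^2+\|T_0F-T_1F\|_{L^2(\mathbb{R})}^2\le c\,\|F\|_{H^1(S)}^2 ,$$ where $c$ is independent of $F$. Conversely, given $f_0,f_1\in\tilde H^{1/2}(\mathbb{R})$ with $f_0-f_1\in L^2(\mathbb{R})$, there exists $F\in H^1(S)$ with $T_0F=f_0$, $T_1F=f_1$ and $$\|F\|_{H^1(S)}^2\le c\left(\|f_0\|_{\tilde H^{1/2}(\mathbb{R})}^2+\|f_1\|_{\tilde H^{1/2}(\mathbb{R})}^2+\|f_0-f_1\|_{L^2(\mathbb{R})}^2\right).$$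
   Context: $H^1(S)$ denotes the homogeneous Sobolev space of functions on $S$ with distributional gradient in $L^2(S)$ (modulo constants), with $\|F\|_{H^1(S)}^2=\int_S|\nabla F|^2\,dx\,dy$. For $F\in H^1(S)$, $T_0F(x)=F(x,0)$ and $T_1F(x)=F(x,\pi)$ denote the traces of $F$ on the two boundary lines, regarded as functions on $\mathbb{R}$. $\tilde H^{1/2}(\mathbb{R})$ is the space of locally $L^2$ functions $f$ on $\mathbb{R}$ (modulo constants) with $\|f\|_{\tilde H^{1/2}(\mathbb{R})}^2=\iint_{|x-y|\le1}\frac{|f(x)-f(y)|^2}{|x-y|^2}\,dx\,dy<\infty$. *)

theory Defs
  imports "HOL-Analysis.Analysis"
begin

definition strip :: "(real \<times> real) set" where
  "strip = {p. 0 < snd p \<and> snd p < pi}"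

definition partial :: "(real \<times> real) \<Rightarrow> ((real \<times> real) \<Rightarrow> real) \<Rightarrow> (real \<times> real) \<Rightarrow> real" where
  "partial i \<phi> p = deriv (\<lambda>t. \<phi> (p + t *\<^sub>R i)) 0"

text \<open>C-infinity functions on the plane: all iterated partial derivatives exist and are continuous.\<close>
definition smooth_fun :: "((real \<times> real) \<Rightarrow> real) \<Rightarrow> bool" where
  "smooth_fun \<phi> \<longleftrightarrow> (\<exists>\<Phi>. \<phi> \<in> \<Phi> \<and>
     (\<forall>\<psi>\<in>\<Phi>. continuous_on UNIV \<psi> \<and>
        (\<forall>i\<in>Basis. \<exists>\<psi>'\<in>\<Phi>. \<forall>p. ((\<lambda>t. \<psi> (p + t *\<^sub>R i)) has_real_derivative \<psi>' p) (at 0))))"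

definition test_fun :: "(real \<times> real) set \<Rightarrow> ((real \<times> real) \<Rightarrow> real) \<Rightarrow> bool" where
  "test_fun U \<phi> \<longleftrightarrow> smooth_fun \<phi> \<and> (\<exists>K. compact K \<and> K \<subseteq> U \<and> (\<forall>p. p \<notin> K \<longrightarrow> \<phi> p = 0))"

definition locally_integrable_on :: "((real \<times> real) \<Rightarrow> real) \<Rightarrow> (real \<times> real) set \<Rightarrow> bool" where
  "locally_integrable_on F U \<longleftrightarrow>
     (\<forall>K. compact K \<and> K \<subseteq> U \<longrightarrow> set_integrable lborel K F)"

definition weak_gradient :: "((real \<times> real) \<Rightarrow> real) \<Rightarrow> ((real \<times> real) \<Rightarrow> real \<times> real) \<Rightarrow> (real \<times> real) set \<Rightarrow> bool" where
  "weak_gradient F G U \<longleftrightarrow> set_borel_measurable lborel U F \<and> locally_integrable_on F U \<and>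
     set_borel_measurable lborel U G \<and>
     (\<forall>\<phi> i. test_fun U \<phi> \<and> i \<in> Basis \<longrightarrow>
        (LINT p:U|lborel. F p * partial i \<phi> p) = - (LINT p:U|lborel. (G p \<bullet> i) * \<phi> p))"

definition H1_norm_sq :: "((real \<times> real) \<Rightarrow> real \<times> real) \<Rightarrow> ennreal" where
  "H1_norm_sq G = (\<integral>\<^sup>+ p. ennreal ((norm (G p))\<^sup>2) * indicator strip p \<partial>lborel)"

definition in_H1 :: "((real \<times> real) \<Rightarrow> real) \<Rightarrow> ((real \<times> real) \<Rightarrow> real \<times> real) \<Rightarrow> bool" where
  "in_H1 F G \<longleftrightarrow> weak_gradient F G strip \<and> H1_norm_sq G < \<infinity>"

text \<open>Traces: f is the trace of F on the line y = 0 (resp. y = pi), in the sense that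
  the horizontal slices of F converge to f in L^2_loc as one approaches the boundary line
  (in mean over a shrinking layer, so the notion is invariant under a.e. modification of F).\<close>
definition is_trace0 :: "((real \<times> real) \<Rightarrow> real) \<Rightarrow> (real \<Rightarrow> real) \<Rightarrow> bool" where
  "is_trace0 F f \<longleftrightarrow> f \<in> borel_measurable lborel \<and>
     (\<forall>a b. ((\<lambda>h. ennreal (1 / h) *
        (\<integral>\<^sup>+ p. ennreal ((F p - f (fst p))\<^sup>2) * indicator ({a..b} \<times> {0<..<h}) p \<partial>lborel))
        \<longlongrightarrow> 0) (at_right 0))"

definition is_trace1 :: "((real \<times> real) \<Rightarrow> real) \<Rightarrow> (real \<Rightarrow> real) \<Rightarrow> bool" where
  "is_trace1 F f \<longleftrightarrow> f \<in> borel_measurable lborel \<and>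
     (\<forall>a b. ((\<lambda>h. ennreal (1 / h) *
        (\<integral>\<^sup>+ p. ennreal ((F p - f (fst p))\<^sup>2) * indicator ({a..b} \<times> {pi - h<..<pi}) p \<partial>lborel))
        \<longlongrightarrow> 0) (at_right 0))"

definition Ht_norm_sq :: "(real \<Rightarrow> real) \<Rightarrow> ennreal" where
  "Ht_norm_sq f = (\<integral>\<^sup>+ x. \<integral>\<^sup>+ y. ennreal ((f x - f y)\<^sup>2 / (x - y)\<^sup>2) * indicator {..1} \<bar>x - y\<bar> \<partial>lborel \<partial>lborel)"

definition L2_norm_sq :: "(real \<Rightarrow> real) \<Rightarrow> ennreal" where
  "L2_norm_sq f = (\<integral>\<^sup>+ x. ennreal ((f x)\<^sup>2) \<partial>lborel)"

definition in_Ht :: "(real \<Rightarrow> real) \<Rightarrow> bool" where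
  "in_Ht f \<longleftrightarrow> f \<in> borel_measurable lborel \<and>
     (\<forall>a b. (\<integral>\<^sup>+ x. ennreal ((f x)\<^sup>2) * indicator {a..b} x \<partial>lborel) < \<infinity>) \<and>
     Ht_norm_sq f < \<infinity>"

definition in_L2 :: "(real \<Rightarrow> real) \<Rightarrow> bool" where
  "in_L2 f \<longleftrightarrow> f \<in> borel_measurable lborel \<and> L2_norm_sq f < \<infinity>"

end

theory Submission
  imports Defs
begin

text \<open>
  Testing the weak gradient against products \<open>\<alpha>(x) \<beta>(y)\<close> and applying the du Bois-Reymond lemma
  shows that, after a modification on a null set, \<open>F\<close> is absolutely continuous on almost every
  vertical and horizontal segment of the strip. Hence \<open>F(x, y) = f\<^sub>0(x) + \<integral>\<^sub>0\<^sup>y \<partial>\<^sub>2F(x, s) ds\<close>, which yields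
  the traces and, by Cauchy-Schwarz, the bound on \<open>f\<^sub>0 - f\<^sub>1\<close>. An increment \<open>f(x + t) - f(x)\<close> of a trace
  is estimated along the detour which leaves the edge at \<open>x\<close>, moves by \<open>t\<close> along the line at distance
  \<open>t\<close> from the edge and returns at \<open>x + t\<close>; Hardy's inequality controls the two vertical pieces.

  Conversely, with \<open>l = y / \<pi>\<close>, the extension interpolates linearly, with weights \<open>1 - l\<close> and \<open>l\<close>,
  between the averages of \<open>f\<^sub>0\<close> at scale \<open>l\<close> and of \<open>f\<^sub>1\<close> at scale \<open>1 - l\<close>. All derivatives of such an
  average are averages of \<open>f(x + s l) - f(x)\<close>, divided by \<open>l\<close>, against bounded kernels of mean zero.
\<close>

section \<open>Smooth product test functions\<close>

text \<open>Both directions end at the same criterion for traces: if \<open>(F - f)\<^sup>2\<close>,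
  divided by the square of the distance to the edge, is integrable over the strip, then
  \<open>f\<close> is the trace, since in a layer of width \<open>h\<close> the weight is at least
  \<open>1 / h\<^sup>2\<close>. For a given \<open>F\<close> the integrability comes from Hardy's
  inequality; for the extension it is read off the formula.

  The norm of \<open>f\<^sub>0 - f\<^sub>1\<close> enters the converse because the two interpolation
  weights add up to 1. Their derivatives in y are opposite, so the boundary values themselves
  survive only through \<open>(f\<^sub>1 - f\<^sub>0) / \<pi>\<close>; every other term of the
  gradient is built from increments of a single function.

  Two obstacles shape the first direction. A square integrable derivative is integrable on almost
  every vertical segment, but need not be on a whole horizontal line, so horizontal lines are
  treated in bounded windows. And a trace is fixed only up to a null set while the estimate is
  claimed for every trace, so traces must be shown unique and all pointwise bounds are kept in
  almost-everywhere form.\<close>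

definition exp_inv :: "nat \<Rightarrow> real \<Rightarrow> real" where
  "exp_inv k x = (if 0 < x then (1 / x) ^ k * exp (- (1 / x)) else 0)"

text \<open>
  Closure under antiderivatives makes the primitive of a compactly supported function of mean zero
  an admissible test function again.
\<close>

inductive_set smooth1 :: "(real \<Rightarrow> real) set" where
  exp_inv: "(\<lambda>x. exp_inv k (c * x + d)) \<in> smooth1"
| const: "(\<lambda>x. c) \<in> smooth1"
| add: "f \<in> smooth1 \<Longrightarrow> g \<in> smooth1 \<Longrightarrow> (\<lambda>x. f x + g x) \<in> smooth1"
| mult: "f \<in> smooth1 \<Longrightarrow> g \<in> smooth1 \<Longrightarrow> (\<lambda>x. f x * g x) \<in> smooth1"
| antideriv: "g \<in> smooth1 \<Longrightarrow> (\<And>x. (f has_real_derivative g x) (at x)) \<Longrightarrow> f \<in> smooth1"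

lemma exp_inv_tendsto_0: "((\<lambda>x::real. (1 / x) ^ k * exp (- (1 / x))) \<longlongrightarrow> 0) (at_right 0)"
proof -
  have "((\<lambda>x::real. (inverse x) ^ k / exp (inverse x)) \<longlongrightarrow> 0) (at_right 0)"
    by (rule filterlim_compose[OF tendsto_power_div_exp_0 filterlim_inverse_at_top_right])
  then show ?thesis by (simp add: exp_minus divide_inverse)
qed

text \<open>Differentiating exp(-1/x) produces powers of 1/x; carrying the factor
  \<open>(1 / x) ^ k\<close> along closes the family under differentiation up to linear
  combinations. At 0 the right difference quotient is the same expression with exponent
  \<open>k + 1\<close>, and the exponential beats every power.\<close>

lemma exp_inv_deriv:
  "(exp_inv k has_real_derivative (exp_inv (k + 2) x - real k * exp_inv (k + 1) x)) (at x)"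
proof (cases x "0::real" rule: linorder_cases)
  case less
  have "((\<lambda>x. 0) has_real_derivative 0) (at x)" by simp
  moreover have "eventually (\<lambda>y. exp_inv k y = 0) (nhds x)"
    using eventually_nhds_in_open[of "{..<0}" x] less by (auto simp: exp_inv_def elim!: eventually_mono)
  ultimately show ?thesis using less
    by (subst DERIV_cong_ev[OF refl _ refl, where g="\<lambda>x. 0"]) (auto simp: exp_inv_def)
next
  case equal
  have "((\<lambda>h. (exp_inv k (0 + h) - exp_inv k 0) / h) \<longlongrightarrow> 0) (at 0)"
  proof (subst filterlim_at_split, intro conjI)
    show "((\<lambda>h. (exp_inv k (0 + h) - exp_inv k 0) / h) \<longlongrightarrow> 0) (at_left 0)"
      by (rule tendsto_eventually)
        (auto simp: eventually_at_filter exp_inv_def)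
    show "((\<lambda>h. (exp_inv k (0 + h) - exp_inv k 0) / h) \<longlongrightarrow> 0) (at_right 0)"
      by (rule Lim_transform_eventually[OF exp_inv_tendsto_0[of "Suc k"]])
        (auto simp: eventually_at_filter exp_inv_def)
  qed
  then show ?thesis using equal by (simp add: DERIV_def) (simp add: exp_inv_def)
next
  case greater
  have "((\<lambda>x. (1 / x) ^ k * exp (- (1 / x))) has_real_derivative 
     (exp_inv (k + 2) x - real k * exp_inv (k + 1) x)) (at x)"
  proof -
    have i: "((\<lambda>x. 1 / x) has_real_derivative - (1 / x\<^sup>2)) (at x)"
      using greater by (auto intro!: derivative_eq_intros simp: power2_eq_square)
    have e: "((\<lambda>x. exp (- (1 / x))) has_real_derivative exp (- (1 / x)) * (1 / x\<^sup>2)) (at x)"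
      using greater by (auto intro!: derivative_eq_intros simp: power2_eq_square)
    show ?thesis
      using DERIV_mult[OF DERIV_power[OF i, of k] e] greater
      by - (rule DERIV_cong, assumption, cases k; simp add: exp_inv_def field_simps power2_eq_square)
  qed
  moreover have "eventually (\<lambda>y. exp_inv k y = (1 / y) ^ k * exp (- (1 / y))) (nhds x)"
    using eventually_nhds_in_open[of "{0<..}" x] greater by (auto simp: exp_inv_def elim!: eventually_mono)
  ultimately show ?thesis
    by (subst DERIV_cong_ev[OF refl _ refl]) auto
qed

lemma smooth1_cmult: "f \<in> smooth1 \<Longrightarrow> (\<lambda>x. c * f x) \<in> smooth1"
  by (rule smooth1.mult[OF smooth1.const])

lemma smooth1_diff: "f \<in> smooth1 \<Longrightarrow> g \<in> smooth1 \<Longrightarrow> (\<lambda>x. f x - g x) \<in> smooth1"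
  using smooth1.add[OF _ smooth1_cmult[of g "-1"]] by simp

text \<open>Iterated, this gives derivatives of all orders inside \<open>smooth1\<close>. A
  primitive needs no argument: the function it was built from is its derivative.\<close>

lemma smooth1_deriv:
  "f \<in> smooth1 \<Longrightarrow> \<exists>f'\<in>smooth1. \<forall>x. (f has_real_derivative f' x) (at x)"
proof (induction rule: smooth1.induct)
  case (exp_inv k c d)
  have "((\<lambda>x. exp_inv k (c * x + d)) has_real_derivative
      c * (exp_inv (k + 2) (c * x + d) + (- real k) * exp_inv (k + 1) (c * x + d))) (at x)" for x
  proof -
    have "((\<lambda>x. c * x + d) has_real_derivative c) (at x)" by (auto intro!: derivative_eq_intros)
    from DERIV_chain2[OF exp_inv_deriv this] show ?thesis
      by (rule DERIV_cong) (simp add: algebra_simps)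
  qed
  moreover have "(\<lambda>x. c * (exp_inv (k + 2) (c * x + d) + (- real k) * exp_inv (k + 1) (c * x + d))) \<in> smooth1"
    by (rule smooth1_cmult, rule smooth1.add, rule smooth1.exp_inv, rule smooth1_cmult, rule smooth1.exp_inv)
  ultimately show ?case by (intro bexI allI) 
next
  case (const c)
  then show ?case by (intro bexI[where x="\<lambda>x. 0"]) (auto intro: smooth1.const)
next
  case (add f g)
  then obtain f' g' where "f'\<in>smooth1" "g'\<in>smooth1" 
    "\<And>x. (f has_real_derivative f' x) (at x)" "\<And>x. (g has_real_derivative g' x) (at x)" by blast
  then show ?case 
    by (intro bexI[where x="\<lambda>x. f' x + g' x"]) (auto intro!: smooth1.add derivative_eq_intros)
next
  case (mult f g)
  then obtain f' g' where "f'\<in>smooth1" "g'\<in>smooth1" 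
    "\<And>x. (f has_real_derivative f' x) (at x)" "\<And>x. (g has_real_derivative g' x) (at x)" by blast
  with mult.hyps show ?case 
    by (intro bexI[where x="\<lambda>x. f x * g' x + f' x * g x"]) 
      (auto intro!: smooth1.add smooth1.mult DERIV_mult' )
next
  case (antideriv g f)
  then show ?case by blast
qed

lemma smooth1_continuous: "f \<in> smooth1 \<Longrightarrow> continuous_on S f"
  using smooth1_deriv by (meson DERIV_continuous_on UNIV_I continuous_on_subset subset_UNIV)

lemma smooth1_borel [measurable (raw)]: "f \<in> smooth1 \<Longrightarrow> f \<in> borel_measurable borel"
  by (rule borel_measurable_continuous_onI) (rule smooth1_continuous)

lemma Basis_plane: "i \<in> (Basis :: (real \<times> real) set) \<longleftrightarrow> i = (1, 0) \<or> i = (0, 1)"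
  by (auto simp: Basis_prod_def)

text \<open>A partial derivative of a tensor product differentiates one factor only, so the set of
  all products with factors in \<open>smooth1\<close> is a closed family of the kind that
  \<open>smooth_fun\<close> asks for.\<close>

lemma smooth_fun_product:
  assumes "\<alpha> \<in> smooth1" "\<beta> \<in> smooth1"
  shows "smooth_fun (\<lambda>p. \<alpha> (fst p) * \<beta> (snd p))"
  unfolding smooth_fun_def
proof (intro exI[of _ "{\<lambda>p. \<alpha> (fst p) * \<beta> (snd p) |\<alpha> \<beta>. \<alpha> \<in> smooth1 \<and> \<beta> \<in> smooth1}"] conjI ballI)
  show "(\<lambda>p. \<alpha> (fst p) * \<beta> (snd p)) \<in> {\<lambda>p. \<alpha> (fst p) * \<beta> (snd p) |\<alpha> \<beta>. \<alpha> \<in> smooth1 \<and> \<beta> \<in> smooth1}"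
    using assms by blast
next
  fix \<psi> :: "real \<times> real \<Rightarrow> real"
  assume "\<psi> \<in> {\<lambda>p. \<alpha> (fst p) * \<beta> (snd p) |\<alpha> \<beta>. \<alpha> \<in> smooth1 \<and> \<beta> \<in> smooth1}"
  then obtain a b where ab: "a \<in> smooth1" "b \<in> smooth1" and \<psi>: "\<psi> = (\<lambda>p. a (fst p) * b (snd p))" by blast
  have *: "continuous_on UNIV (\<lambda>p::real\<times>real. a (fst p))" "continuous_on UNIV (\<lambda>p::real\<times>real. b (snd p))"
    by (rule continuous_on_compose2[OF smooth1_continuous[OF ab(1), of UNIV]];
        auto intro: continuous_on_fst continuous_on_id)
      (rule continuous_on_compose2[OF smooth1_continuous[OF ab(2), of UNIV]];
        auto intro: continuous_on_snd continuous_on_id)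
  show "continuous_on UNIV \<psi>" unfolding \<psi> by (intro continuous_intros *)
  fix i :: "real \<times> real" assume "i \<in> Basis"
  then consider "i = (1, 0)" | "i = (0, 1)" by (auto simp: Basis_plane)
  then show "\<exists>\<psi>'\<in>{\<lambda>p. \<alpha> (fst p) * \<beta> (snd p) |\<alpha> \<beta>. \<alpha> \<in> smooth1 \<and> \<beta> \<in> smooth1}.
            \<forall>p. ((\<lambda>t. \<psi> (p + t *\<^sub>R i)) has_real_derivative \<psi>' p) (at 0)"
  proof cases
    case 1
    obtain a' where a': "a' \<in> smooth1" "\<And>x. (a has_real_derivative a' x) (at x)" using smooth1_deriv[OF ab(1)] by blast
    have "((\<lambda>t. \<psi> (p + t *\<^sub>R i)) has_real_derivative a' (fst p) * b (snd p)) (at 0)" for p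
      unfolding \<psi> 1 using a'(2)[of "fst p"] DERIV_shift[of a "a' (fst p)" "0" "fst p"]
      by (auto intro!: derivative_eq_intros simp: add.commute)
    then show ?thesis using a'(1) ab(2) by (intro bexI[where x="\<lambda>p. a' (fst p) * b (snd p)"]) auto
  next
    case 2
    obtain b' where b': "b' \<in> smooth1" "\<And>x. (b has_real_derivative b' x) (at x)" using smooth1_deriv[OF ab(2)] by blast
    have "((\<lambda>t. \<psi> (p + t *\<^sub>R i)) has_real_derivative a (fst p) * b' (snd p)) (at 0)" for p
      unfolding \<psi> 2 using b'(2)[of "snd p"] DERIV_shift[of b "b' (snd p)" "0" "snd p"]
      by (auto intro!: derivative_eq_intros simp: add.commute)
    then show ?thesis using b'(1) ab(1) by (intro bexI[where x="\<lambda>p. a (fst p) * b' (snd p)"]) auto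
  qed
qed

lemma partial_product:
  assumes "\<And>x. (\<alpha> has_real_derivative \<alpha>' x) (at x)" "\<And>x. (\<beta> has_real_derivative \<beta>' x) (at x)"
  shows "partial (1, 0) (\<lambda>p. \<alpha> (fst p) * \<beta> (snd p)) p = \<alpha>' (fst p) * \<beta> (snd p)"
    and "partial (0, 1) (\<lambda>p. \<alpha> (fst p) * \<beta> (snd p)) p = \<alpha> (fst p) * \<beta>' (snd p)"
  unfolding partial_def
  using assms(1)[of "fst p"] DERIV_shift[of \<alpha> "\<alpha>' (fst p)" "0" "fst p"]
    assms(2)[of "snd p"] DERIV_shift[of \<beta> "\<beta>' (snd p)" "0" "snd p"]
  by (auto intro!: DERIV_imp_deriv derivative_eq_intros simp: add.commute)

lemma test_fun_product:
  assumes "\<alpha> \<in> smooth1" "\<beta> \<in> smooth1" "cbox (c, a) (d, b) \<subseteq> U"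
    and "\<And>x. x \<notin> {c..d} \<Longrightarrow> \<alpha> x = 0" "\<And>x. x \<notin> {a..b} \<Longrightarrow> \<beta> x = 0"
  shows "test_fun U (\<lambda>p. \<alpha> (fst p) * \<beta> (snd p))"
  unfolding test_fun_def
  using assms(3) smooth_fun_product[OF assms(1,2)]
  by (intro conjI exI[of _ "cbox (c, a) (d, b)"] compact_cbox allI impI)
    (auto simp: cbox_Pair_eq assms(4,5) mem_Times_iff)

text \<open>For growing \<open>n\<close> the flanks steepen while the support stays within
  \<open>{a..b}\<close>: at each interior point the values increase to 1. This is a smooth
  approximation of an indicator from below.\<close>

definition bump :: "real \<Rightarrow> real \<Rightarrow> real \<Rightarrow> real \<Rightarrow> real" where
  "bump n a b x = exp_inv 0 (n * (x - a)) * exp_inv 0 (n * (b - x))"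

lemma bump_smooth1: "bump n a b \<in> smooth1"
proof -
  have "(\<lambda>x. exp_inv 0 (n * x + (- n * a)) * exp_inv 0 ((- n) * x + n * b)) \<in> smooth1"
    by (intro smooth1.mult smooth1.exp_inv)
  moreover have "bump n a b = (\<lambda>x. exp_inv 0 (n * x + (- n * a)) * exp_inv 0 ((- n) * x + n * b))"
    by (auto simp: bump_def algebra_simps)
  ultimately show ?thesis by simp
qed

lemma exp_inv_0_bounds: "0 \<le> exp_inv 0 x" "exp_inv 0 x \<le> 1" "0 < x \<Longrightarrow> 0 < exp_inv 0 x"
  by (auto simp: exp_inv_def)

lemma bump_bounds: "0 \<le> bump n a b x" "bump n a b x \<le> 1"
  by (auto simp: bump_def exp_inv_0_bounds intro: mult_le_one)

lemma bump_outside: "0 \<le> n \<Longrightarrow> x \<notin> {a<..<b} \<Longrightarrow> bump n a b x = 0"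
  by (auto simp: bump_def exp_inv_def zero_less_mult_iff)

lemma bump_inside: "0 < n \<Longrightarrow> x \<in> {a<..<b} \<Longrightarrow> 0 < bump n a b x"
  by (auto simp: bump_def intro!: mult_pos_pos exp_inv_0_bounds)

lemma bump_tendsto: "(\<lambda>n. bump (real n) a b x) \<longlonglongrightarrow> indicator {a<..<b} x"
proof (cases "x \<in> {a<..<b}")
  case True
  have *: "(\<lambda>n. exp_inv 0 (real n * c)) \<longlonglongrightarrow> 1" if "c > 0" for c
  proof (rule Lim_transform_eventually)
    have "(\<lambda>n. exp (- ((1 / c) * (1 / real n)))) \<longlonglongrightarrow> exp (- ((1 / c) * 0))"
      by (intro tendsto_intros lim_1_over_n)
    then show "(\<lambda>n. exp (- ((1 / c) * (1 / real n)))) \<longlonglongrightarrow> 1" by simp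
    show "\<forall>\<^sub>F n in sequentially. exp (- (1 / c * (1 / real n))) = exp_inv 0 (real n * c)"
      by (rule eventually_mono[OF eventually_gt_at_top[of "0::nat"]])
        (use that in \<open>auto simp: exp_inv_def field_simps\<close>)
  qed
  show ?thesis using tendsto_mult[OF *[of "x - a"] *[of "b - x"]] True by (simp add: bump_def)
next
  case False
  then show ?thesis by (simp add: bump_outside)
qed

text \<open>Any primitive is constant on each side of \<open>{a..b}\<close>. Mean zero makes the two
  constants equal, so subtracting the value at \<open>a\<close> leaves a function that vanishes on
  both sides.\<close>

lemma smooth1_antiderivative:
  assumes \<eta>: "\<eta> \<in> smooth1" "\<And>x. x \<notin> {a..b} \<Longrightarrow> \<eta> x = 0" and ab: "a \<le> b"
    and int: "(\<eta> has_integral 0) {a..b}"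
  obtains \<beta> where "\<beta> \<in> smooth1" "\<And>x. (\<beta> has_real_derivative \<eta> x) (at x)"
    "\<And>x. x \<notin> {a..b} \<Longrightarrow> \<beta> x = 0"
proof -
  have "isCont \<eta> x" for x using smooth1_continuous[OF \<eta>(1), of UNIV] by (simp add: continuous_on_eq_continuous_at)
  then obtain B where B: "\<And>x. (B has_real_derivative \<eta> x) (at x)"
    using einterval_antiderivative[of "-\<infinity>" "\<infinity>" \<eta>]
    by (auto simp: has_real_derivative_iff_has_vector_derivative)
  define \<beta> where "\<beta> x = B x - B a" for x
  have d: "(\<beta> has_real_derivative \<eta> x) (at x)" for x
    unfolding \<beta>_def using B by (auto intro!: derivative_eq_intros)
  have "(\<eta> has_integral (B b - B a)) {a..b}"
    by (rule fundamental_theorem_of_calculus[OF ab])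
      (rule has_vector_derivative_at_within, rule B[unfolded has_real_derivative_iff_has_vector_derivative])
  from has_integral_unique[OF this int] have Bab: "B b = B a" by simp
  have z: "\<beta> x = 0" if x: "x \<notin> {a..b}" for x
  proof (cases "x < a")
    case True
    have "\<exists>z. x < z \<and> z < a \<and> \<beta> a - \<beta> x = (a - x) * \<eta> z"
      by (rule MVT2[OF True d])
    then show ?thesis using \<eta>(2) by (auto simp: \<beta>_def)
  next
    case False
    then have "x > b" using x by auto
    then have "\<exists>z. b < z \<and> z < x \<and> \<beta> x - \<beta> b = (x - b) * \<eta> z"
      by (rule MVT2[OF _ d])
    then show ?thesis using \<eta>(2) Bab by (auto simp: \<beta>_def)
  qed
  show ?thesis by (rule that[OF smooth1.antideriv[OF \<eta>(1) d] d z])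
qed

section \<open>Slices of the plane, and testing against products of bumps\<close>

lemma measurable_fst_borel [measurable (raw)]:
  fixes f :: "'a \<Rightarrow> real \<times> real"
  shows "f \<in> M \<rightarrow>\<^sub>M borel \<Longrightarrow> (\<lambda>x. fst (f x)) \<in> M \<rightarrow>\<^sub>M borel"
    and measurable_snd_borel [measurable (raw)]:
      "f \<in> M \<rightarrow>\<^sub>M borel \<Longrightarrow> (\<lambda>x. snd (f x)) \<in> M \<rightarrow>\<^sub>M borel"
  by (simp_all add: borel_prod[symmetric] measurable_pair)

lemma plane_integral_fst:
  fixes f :: "real \<times> real \<Rightarrow> real"
  assumes "integrable lborel f"
  shows "AE x in lborel. integrable lborel (\<lambda>y. f (x, y))"
    and "integrable lborel (\<lambda>x. \<integral>y. f (x, y) \<partial>lborel)"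
    and "(\<integral>x. \<integral>y. f (x, y) \<partial>lborel \<partial>lborel) = integral\<^sup>L lborel f"
  using lborel_pair.AE_integrable_fst'[of f] lborel_pair.integrable_fst'[of f] lborel_pair.integral_fst'[of f] assms
  by (auto simp: lborel_prod)

lemma plane_integral_swap:
  fixes f :: "real \<times> real \<Rightarrow> real"
  assumes "f \<in> borel_measurable borel"
  shows "(\<integral>p. f (snd p, fst p) \<partial>lborel) = integral\<^sup>L lborel f"
  using lborel_pair.integral_product_swap[of f] assms
  by (simp add: lborel_prod case_prod_beta')

lemma plane_integrable_swap:
  fixes f :: "real \<times> real \<Rightarrow> real"
  assumes "integrable lborel f"
  shows "integrable lborel (\<lambda>p. f (snd p, fst p))"
  using lborel_pair.integrable_product_swap[of f] assms
  by (simp add: lborel_prod case_prod_beta')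

lemma plane_nn_integral:
  fixes f :: "real \<times> real \<Rightarrow> ennreal"
  assumes "f \<in> borel_measurable borel"
  shows "(\<integral>\<^sup>+x. \<integral>\<^sup>+y. f (x, y) \<partial>lborel \<partial>lborel) = integral\<^sup>N lborel f"
    and "(\<integral>\<^sup>+y. \<integral>\<^sup>+x. f (x, y) \<partial>lborel \<partial>lborel) = integral\<^sup>N lborel f"
  using lborel.nn_integral_fst[of f lborel] lborel_pair.nn_integral_snd[of f] assms
  by (auto simp: lborel_prod)

lemma plane_AE:
  assumes "AE p in (lborel :: (real \<times> real) measure). Q p"
  shows "AE x in lborel. AE y in lborel. Q (x, y)" "AE y in lborel. AE x in lborel. Q (x, y)"
proof -
  have *: "AE p in (lborel :: real measure) \<Otimes>\<^sub>M (lborel :: real measure). Q p" using assms by (subst lborel_prod)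
  show "AE x in lborel. AE y in lborel. Q (x, y)" by (rule lborel_pair.AE_pair[OF *])
  have "AE p in distr (lborel \<Otimes>\<^sub>M lborel) (lborel \<Otimes>\<^sub>M lborel) (\<lambda>(x, y). (y, x :: real)). Q (p :: real \<times> real)"
    using * lborel_pair.distr_pair_swap by metis
  then have "AE p in (lborel :: real measure) \<Otimes>\<^sub>M (lborel :: real measure). Q (snd p, fst p)"
    by (auto dest!: AE_distrD[rotated] simp: case_prod_beta)
  from lborel_pair.AE_pair[OF this] show "AE y in lborel. AE x in lborel. Q (x, y)" by simp
qed

lemma plane_AE_I:
  assumes "{p. Q p} \<in> sets borel" "AE x in lborel. AE y in lborel. Q (x, y)"
  shows "AE p in (lborel :: (real \<times> real) measure). Q p"
proof -
  have "{p. Q p} \<in> sets (borel \<Otimes>\<^sub>M borel)" using assms(1) by (subst borel_prod)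
  then have "AE p in (lborel :: real measure) \<Otimes>\<^sub>M (lborel :: real measure). Q p"
    by (intro lborel_pair.AE_pair_measure) (use assms in \<open>auto simp: space_pair_measure\<close>)
  then show ?thesis by (subst (asm) lborel_prod)
qed

lemma plane_integrable_product:
  fixes f g :: "real \<Rightarrow> real"
  assumes f: "integrable lborel f" and g: "integrable lborel g"
  shows "integrable lborel (\<lambda>p. f (fst p) * g (snd p))"
proof -
  have [measurable]: "f \<in> borel_measurable borel" "g \<in> borel_measurable borel" using assms by auto
  have "integrable (lborel \<Otimes>\<^sub>M lborel) (\<lambda>p. f (fst p) * g (snd p))"
    by (rule lborel_pair.Fubini_integrable)
      (use assms in \<open>auto simp: abs_mult integrable_abs\<close>)
  then show ?thesis by (simp add: lborel_prod)
qed

text \<open>Products of bumps converge to indicators of open boxes, dominated by the indicator of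
  the closed box, so the integral of \<open>P\<close> over every box vanishes. Boxes generate the
  Borel sets, which forces \<open>P\<close> to vanish almost everywhere in a box, and countably many
  boxes exhaust \<open>S\<close>.\<close>

lemma bump_fundamental:
  fixes P :: "real \<times> real \<Rightarrow> real"
  assumes [measurable]: "P \<in> borel_measurable borel" and "open S"
    and loc: "\<And>u v. cbox u v \<subseteq> S \<Longrightarrow> set_integrable lborel (cbox u v) P"
    and zero: "\<And>c d a b n. cbox (c, a) (d, b) \<subseteq> S \<Longrightarrow>
      (\<integral>p. P p * (bump (real n) c d (fst p) * bump (real n) a b (snd p)) \<partial>lborel) = 0"
  shows "AE p in lborel. p \<in> S \<longrightarrow> P p = 0"
proof -
  have [measurable]: "bump n a b \<in> borel_measurable borel" for n a b
    by (rule smooth1_borel[OF bump_smooth1])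
  have box0: "(\<integral>p. indicator (box u v) p * P p \<partial>lborel) = 0" if "cbox u v \<subseteq> S" for u v
  proof -
    obtain c a d b where uv: "u = (c, a)" "v = (d, b)" by (cases u, cases v) auto
    have "(\<lambda>n. \<integral>p. P p * (bump (real n) c d (fst p) * bump (real n) a b (snd p)) \<partial>lborel)
        \<longlonglongrightarrow> (\<integral>p. indicator (box u v) p * P p \<partial>lborel)"
    proof (rule integral_dominated_convergence[where w="\<lambda>p. indicator (cbox u v) p * \<bar>P p\<bar>"])
      show "integrable lborel (\<lambda>p. indicator (cbox u v) p * \<bar>P p\<bar>)"
        using integrable_abs[OF loc[OF that, unfolded set_integrable_def]] by (simp add: abs_mult)
      show "AE p in lborel. (\<lambda>n. P p * (bump (real n) c d (fst p) * bump (real n) a b (snd p)))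
          \<longlonglongrightarrow> indicator (box u v) p * P p"
      proof (intro AE_I2)
        fix p :: "real \<times> real"
        have "(\<lambda>n. P p * (bump (real n) c d (fst p) * bump (real n) a b (snd p)))
          \<longlonglongrightarrow> P p * (indicator {c<..<d} (fst p) * indicator {a<..<b} (snd p))"
          by (intro tendsto_intros bump_tendsto)
        also have "P p * (indicator {c<..<d} (fst p) * indicator {a<..<b} (snd p)) = indicator (box u v) p * P p"
          by (cases p) (auto simp: uv box_def Basis_prod_def indicator_def)
        finally show "(\<lambda>n. P p * (bump (real n) c d (fst p) * bump (real n) a b (snd p)))
          \<longlonglongrightarrow> indicator (box u v) p * P p" .
      qed
      show "AE p in lborel. norm (P p * (bump (real n) c d (fst p) * bump (real n) a b (snd p)))
         \<le> indicator (cbox u v) p * \<bar>P p\<bar>" for n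
      proof (intro AE_I2)
        fix p :: "real \<times> real"
        show "norm (P p * (bump (real n) c d (fst p) * bump (real n) a b (snd p))) \<le> indicator (cbox u v) p * \<bar>P p\<bar>"
        proof (cases "p \<in> cbox u v")
          case True
          then show ?thesis 
            by (auto simp: abs_mult bump_bounds intro!: mult_left_le mult_le_one)
        next
          case False
          then have "fst p \<notin> {c<..<d} \<or> snd p \<notin> {a<..<b}" by (cases p) (auto simp: uv cbox_Pair_eq)
          then show ?thesis using bump_outside[of "real n"] by auto
        qed
      qed
    qed measurable
    then show ?thesis using zero[of c a d b] that LIMSEQ_unique[OF tendsto_const] by (simp add: uv LIMSEQ_const_iff)
  qed
  \<comment> \<open>Cutting \<open>P\<close> down to one box gives a function integrable on the
    whole plane, so its integral over any Borel set makes sense. Since boxes intersect in boxes, a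
    Dynkin argument extends the vanishing from boxes to all Borel sets.\<close>
  have boxAE: "AE p in lborel. p \<in> box u v \<longrightarrow> P p = 0" if uv: "cbox u v \<subseteq> S" for u v
  proof -
    define f where "f p = indicator (box u v) p * P p" for p
    have f: "integrable lborel f"
      using loc[OF uv] set_integrable_subset[of lborel "cbox u v" P "box u v"] box_subset_cbox[of u v]
      by (auto simp: f_def[abs_def] set_integrable_def)
    have fs: "set_integrable lborel A f" if "A \<in> sets borel" for A
      using f that unfolding set_integrable_def by (intro integrable_mult_indicator) auto
    have boxf: "(LINT p:box a b|lborel. f p) = 0" for a b
    proof -
      obtain a' b' where *: "box a b \<inter> box u v = box a' b'" "cbox a b \<inter> cbox u v = cbox a' b'"
        by (rule that[OF box_Int_box Int_interval])
      have "(LINT p:box a b|lborel. f p) = (\<integral>p. indicator (box a b \<inter> box u v) p * P p \<partial>lborel)"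
        by (auto simp: set_lebesgue_integral_def f_def indicator_inter_arith mult.assoc)
      then show ?thesis using box0[of a' b'] uv * by auto
    qed
    have U: "(LINT p:UNIV|lborel. f p) = 0" using box0[OF uv] by (simp add: set_lebesgue_integral_def f_def)
    have stable: "Int_stable (range (\<lambda>(a::real\<times>real, b). box a b))"
      by (auto simp: Int_stable_def box_Int_box)
    have *: "(LINT p:A|lborel. f p) = 0" if "A \<in> sigma_sets UNIV (range (\<lambda>(a, b). box a b))" for A
      using stable _ that
    proof (induct rule: sigma_sets_induct_disjoint)
      show "range (\<lambda>(a::real\<times>real, b). box a b) \<subseteq> Pow UNIV" by simp
      show "(LINT p:A|lborel. f p) = 0" if "A \<in> range (\<lambda>(a, b). box a b)" for A
        using that boxf by auto
      show "(LINT p:{}|lborel. f p) = 0" by (simp add: set_lebesgue_integral_def)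
    next
      fix A :: "(real \<times> real) set" assume A: "A \<in> sigma_sets UNIV (range (\<lambda>(a, b). box a b))" "(LINT p:A|lborel. f p) = 0"
      then have "A \<in> sets borel" by (simp add: borel_eq_box)
      then have "(LINT p:UNIV - A|lborel. f p) + (LINT p:A|lborel. f p) = (LINT p:(UNIV - A) \<union> A|lborel. f p)"
        by (intro set_integral_Un[symmetric] fs) auto
      then show "(LINT p:UNIV - A|lborel. f p) = 0" using U A by simp
    next
      fix A :: "nat \<Rightarrow> (real \<times> real) set"
      assume A: "disjoint_family A" "range A \<subseteq> sigma_sets UNIV (range (\<lambda>(a, b). box a b))"
        "\<And>i. (LINT p:A i|lborel. f p) = 0"
      then have s: "A i \<in> sets borel" for i by (auto simp: borel_eq_box)
      then show "(LINT p:\<Union> (range A)|lborel. f p) = 0"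
        using lebesgue_integral_countable_add[of A lborel f] A fs[of "\<Union>(range A)"]
        by (auto simp: disjoint_family_on_def)
    qed
    have "AE p in lborel. f p = 0"
      using * by (intro density_unique_real[OF f]) (auto simp: borel_eq_box set_lebesgue_integral_def)
    then show ?thesis by eventually_elim (auto simp: f_def)
  qed
  \<comment> \<open>The countable cover of \<open>S\<close> used below consists of closed boxes;
    their boundaries are null sets.\<close>
  have cboxAE: "AE p in lborel. p \<in> cbox u v \<longrightarrow> P p = 0" if "cbox u v \<subseteq> S" for u v
  proof -
    have "cbox u v - box u v \<in> null_sets lborel"
      using negligible_frontier_interval[of u v] 
      by (simp add: negligible_iff_null_sets null_sets_completion_iff)
    then have "AE p in lborel. p \<notin> cbox u v - box u v" by (rule AE_not_in)
    with boxAE[OF that] show ?thesis by eventually_elim auto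
  qed
  obtain D where D: "countable D" "D \<subseteq> Pow S" "\<And>X. X \<in> D \<Longrightarrow> \<exists>a b. X = cbox a b" "\<Union>D = S"
    by (rule open_countable_Union_open_cbox[OF \<open>open S\<close>]) (assumption | rule that; assumption)+
  have "AE p in lborel. \<forall>X\<in>D. p \<in> X \<longrightarrow> P p = 0"
    unfolding AE_ball_countable[OF D(1)]
  proof
    fix X assume "X \<in> D"
    then obtain a b where "X = cbox a b" "X \<subseteq> S" using D(2,3) by blast
    then show "AE p in lborel. p \<in> X \<longrightarrow> P p = 0" using cboxAE by simp
  qed
  then show ?thesis by eventually_elim (use D(4) in auto)
qed

section \<open>The du Bois-Reymond lemma and absolute continuity on lines\<close>

lemma bump_integrable: "0 \<le> n \<Longrightarrow> integrable lborel (bump n a b)"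
proof (rule Bochner_Integration.integrable_bound)
  show "integrable lborel (indicator {a..b} :: real \<Rightarrow> real)"
    by (intro integrable_real_indicator) (auto simp: emeasure_lborel_Icc_eq)
  assume "0 \<le> n"
  then show "AE x in lborel. norm (bump n a b x) \<le> norm (indicator {a..b} x :: real)"
    using bump_outside[of n _ a b] by (intro AE_I2) (auto simp: indicator_def bump_bounds)
qed (use smooth1_borel[OF bump_smooth1] in simp)

lemma bump_integral_pos:
  assumes "0 < n" "a < b"
  shows "0 < (\<integral>x. bump n a b x \<partial>lborel)"
proof -
  have "(\<integral>x. bump n a b x \<partial>lborel) \<noteq> 0"
  proof
    assume "(\<integral>x. bump n a b x \<partial>lborel) = 0"
    then have "AE x in lborel. bump n a b x = 0"
      using bump_integrable[of n a b] assms bump_bounds(1)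
      by (subst (asm) integral_nonneg_eq_0_iff_AE) auto
    then have "AE x in lborel. x \<notin> {a<..<b}"
      by eventually_elim (use bump_inside[OF assms(1), of _ a b] in force)
    then have "{a<..<b} \<in> null_sets lborel" by (subst (asm) AE_iff_null_sets[symmetric]) auto
    then show False using assms by (auto simp: null_sets_def)
  qed
  moreover have "0 \<le> (\<integral>x. bump n a b x \<partial>lborel)" by (intro Bochner_Integration.integral_nonneg bump_bounds)
  ultimately show ?thesis by simp
qed

lemma integrable_mult_supported:
  fixes M :: "real \<times> real \<Rightarrow> real"
  assumes M: "set_integrable lborel (cbox (c, a) (d, b)) M"
    and [measurable]: "\<alpha> \<in> borel_measurable borel" "\<eta> \<in> borel_measurable borel" "M \<in> borel_measurable borel"
    and "\<And>x. \<bar>\<alpha> x\<bar> \<le> A" "\<And>x. \<bar>\<eta> x\<bar> \<le> B"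
    and "\<And>x. x \<notin> {c..d} \<Longrightarrow> \<alpha> x = 0" "\<And>x. x \<notin> {a..b} \<Longrightarrow> \<eta> x = 0"
  shows "integrable lborel (\<lambda>p. M p * (\<alpha> (fst p) * \<eta> (snd p)))"
proof (rule Bochner_Integration.integrable_bound)
  show "integrable lborel (\<lambda>p. (A * B) * (indicator (cbox (c, a) (d, b)) p *\<^sub>R M p))"
    using M by (simp add: set_integrable_def)
  have A: "0 \<le> A" "0 \<le> B" using assms(5)[of 0] assms(6)[of 0] by linarith+
  show "AE p in lborel. norm (M p * (\<alpha> (fst p) * \<eta> (snd p)))
      \<le> norm ((A * B) * (indicator (cbox (c, a) (d, b)) p *\<^sub>R M p))"
  proof (rule AE_I2)
    fix p :: "real \<times> real"
    show "norm (M p * (\<alpha> (fst p) * \<eta> (snd p))) \<le> norm ((A * B) * (indicator (cbox (c, a) (d, b)) p *\<^sub>R M p))"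
    proof (cases "p \<in> cbox (c, a) (d, b)")
      case True
      have "\<bar>\<alpha> (fst p) * \<eta> (snd p)\<bar> \<le> A * B"
        using assms(5)[of "fst p"] assms(6)[of "snd p"] A by (auto simp: abs_mult intro: mult_mono)
      from mult_left_mono[OF this abs_ge_zero[of "M p"]] show ?thesis
        using True A by (simp add: abs_mult mult.commute)
    next
      case False
      then have "\<alpha> (fst p) = 0 \<or> \<eta> (snd p) = 0"
        using assms(7)[of "fst p"] assms(8)[of "snd p"] by (cases p) (auto simp: cbox_Pair_eq)
      then show ?thesis by auto
    qed
  qed
qed simp

lemma cbox_Pair_subset_iff:
  fixes a b c d :: real
  shows "cbox (c, a) (d, b) \<subseteq> J \<times> I \<longleftrightarrow> {c..d} = {} \<or> {a..b} = {} \<or> {c..d} \<subseteq> J \<and> {a..b} \<subseteq> I"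
  unfolding cbox_Pair_eq times_subset_iff by auto

text \<open>On an interval, a function with zero weak derivative is constant, and the constant is
  its integral against any bump of mass one. Here the first variable is a parameter, so the constant
  becomes \<open>h (fst p)\<close>. Only products are available as test functions; by
  \<open>bump_fundamental\<close> they suffice.\<close>

lemma du_Bois_Reymond_product:
  fixes M :: "real \<times> real \<Rightarrow> real"
  assumes M[measurable]: "M \<in> borel_measurable borel" and J: "open J" and ab: "a < b"
    and loc: "\<And>u v. cbox u v \<subseteq> J \<times> {a<..<b} \<Longrightarrow> set_integrable lborel (cbox u v) M"
    and weak: "\<And>\<alpha> \<beta> \<beta>' c d a' b'. \<lbrakk>\<alpha> \<in> smooth1; \<beta> \<in> smooth1; \<beta>' \<in> smooth1;
      \<And>x. (\<beta> has_real_derivative \<beta>' x) (at x); c \<le> d; a' \<le> b'; cbox (c, a') (d, b') \<subseteq> J \<times> {a<..<b};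
      \<And>x. x \<notin> {c..d} \<Longrightarrow> \<alpha> x = 0; \<And>x. x \<notin> {a'..b'} \<Longrightarrow> \<beta> x = 0\<rbrakk>
      \<Longrightarrow> (\<integral>p. M p * (\<alpha> (fst p) * \<beta>' (snd p)) \<partial>lborel) = 0"
  shows "\<exists>h\<in>borel_measurable borel. AE p in lborel. p \<in> J \<times> {a<..<b} \<longrightarrow> M p = h (fst p)"
proof -
  \<comment> \<open>The middle third of the interval keeps the support of the normalised bump at
    positive distance from both ends.\<close>
  define a1 b1 where "a1 = (2 * a + b) / 3" and "b1 = (a + 2 * b) / 3"
  have a1: "a < a1" "a1 < b1" "b1 < b" using ab by (auto simp: a1_def b1_def field_simps)
  have bm[measurable]: "bump n a b \<in> borel_measurable borel" for n a b
    by (rule smooth1_borel[OF bump_smooth1])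
  define I0 where "I0 = (\<integral>x. bump 1 a1 b1 x \<partial>lborel)"
  have I0: "0 < I0" unfolding I0_def using a1 by (intro bump_integral_pos) auto
  define \<eta>0 where "\<eta>0 x = bump 1 a1 b1 x * (1 / I0)" for x
  have \<eta>0s: "\<eta>0 \<in> smooth1" unfolding \<eta>0_def by (intro smooth1.mult bump_smooth1 smooth1.const)
  then have [measurable]: "\<eta>0 \<in> borel_measurable borel" by (rule smooth1_borel)
  have \<eta>0i: "integrable lborel \<eta>0" "(\<integral>x. \<eta>0 x \<partial>lborel) = 1"
    using bump_integrable[of 1 a1 b1] I0 unfolding \<eta>0_def by (auto simp: I0_def[symmetric])
  have \<eta>0b: "\<bar>\<eta>0 x\<bar> \<le> 1 / I0" for x
    using I0 bump_bounds[of 1 a1 b1 x] by (auto simp: \<eta>0_def abs_mult divide_right_mono)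
  have \<eta>0z: "\<eta>0 x = 0" if "x \<notin> {a1..b1}" for x
    using that bump_outside[of 1 x a1 b1] by (auto simp: \<eta>0_def)
  \<comment> \<open>The only possible candidate: if \<open>M\<close> depends on its first variable
    alone, integrating against the unit mass \<open>\<eta>0\<close> returns it.\<close>
  define h where "h s = (\<integral>t. M (s, t) * \<eta>0 t \<partial>lborel)" for s
  have hm[measurable]: "h \<in> borel_measurable borel"
  proof -
    have "(\<lambda>s. \<integral>t. M (s, t) * \<eta>0 t \<partial>lborel) \<in> borel_measurable lborel" by measurable
    then show ?thesis by (simp add: h_def[abs_def])
  qed
  have M\<eta>: "integrable lborel (\<lambda>p. M p * (\<alpha> (fst p) * \<eta>0 (snd p)))"
     "integrable lborel (\<lambda>s. \<alpha> s * h s)"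
     "(\<integral>p. M p * (\<alpha> (fst p) * \<eta>0 (snd p)) \<partial>lborel) = (\<integral>s. \<alpha> s * h s \<partial>lborel)"
    if [measurable]: "\<alpha> \<in> borel_measurable borel" and \<alpha>: "{c..d} \<subseteq> J" "\<And>x. \<bar>\<alpha> x\<bar> \<le> 1" "\<And>x. x \<notin> {c..d} \<Longrightarrow> \<alpha> x = 0" for \<alpha> c d
  proof -
    have "set_integrable lborel (cbox (c, a1) (d, b1)) M"
      using \<alpha>(1) a1 by (intro loc) (auto simp: cbox_Pair_subset_iff)
    then show *: "integrable lborel (\<lambda>p. M p * (\<alpha> (fst p) * \<eta>0 (snd p)))"
      by (rule integrable_mult_supported[OF _ _ _ _ \<alpha>(2) \<eta>0b]) (use \<alpha> \<eta>0z in auto)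
    have e: "(\<integral>y. M (x, y) * (\<alpha> x * \<eta>0 y) \<partial>lborel) = \<alpha> x * h x" for x
    proof -
      have "(\<integral>y. M (x, y) * (\<alpha> x * \<eta>0 y) \<partial>lborel) = (\<integral>y. \<alpha> x * (M (x, y) * \<eta>0 y) \<partial>lborel)"
        by (intro Bochner_Integration.integral_cong) auto
      then show ?thesis by (simp add: h_def)
    qed
    show "integrable lborel (\<lambda>s. \<alpha> s * h s)" using plane_integral_fst(2)[OF *] by (simp add: e)
    show "(\<integral>p. M p * (\<alpha> (fst p) * \<eta>0 (snd p)) \<partial>lborel) = (\<integral>s. \<alpha> s * h s \<partial>lborel)"
      using plane_integral_fst(3)[OF *] by (simp add: e)
  qed
  define P where "P p = M p - h (fst p)" for p
  have "AE p in lborel. p \<in> J \<times> {a<..<b} \<longrightarrow> P p = 0"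
  proof (rule bump_fundamental)
    show "P \<in> borel_measurable borel" unfolding P_def by measurable
    show "open (J \<times> {a<..<b})" using J by (intro open_Times) auto
  next
    fix u v assume uv: "cbox u v \<subseteq> J \<times> {a<..<b}"
    obtain c a' d b' where uv': "u = (c, a')" "v = (d, b')" by (cases u, cases v) auto
    show "set_integrable lborel (cbox u v) P"
    proof (cases "{c..d} = {} \<or> {a'..b'} = {}")
      case True
      then have "cbox u v = {}" by (auto simp: uv' cbox_Pair_eq)
      then show ?thesis by (simp add: set_integrable_def)
    next
      case False
      then have "{c..d} \<subseteq> J" using uv by (auto simp: uv' cbox_Pair_subset_iff)
      then have "integrable lborel (\<lambda>s. indicator {c..d} s * h s)"
        by (intro M\<eta>(2)[where c=c and d=d]) (auto simp: indicator_def)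
      then have "integrable lborel (\<lambda>p. (indicator {c..d} (fst p) * h (fst p)) * indicator {a'..b'} (snd p))"
        by (rule plane_integrable_product, intro integrable_real_indicator) (auto simp: emeasure_lborel_Icc_eq)
      moreover have "integrable lborel (\<lambda>p. indicator (cbox u v) p * M p)"
        using loc[OF uv] by (simp add: set_integrable_def)
      ultimately have "integrable lborel (\<lambda>p. indicator (cbox u v) p * M p -
          (indicator {c..d} (fst p) * h (fst p)) * indicator {a'..b'} (snd p))" by simp
      moreover have "indicator (cbox u v) p * M p -
          (indicator {c..d} (fst p) * h (fst p)) * indicator {a'..b'} (snd p) = indicator (cbox u v) p *\<^sub>R P p" for p
        by (cases p) (auto simp: uv' cbox_Pair_eq P_def indicator_def)
      ultimately show ?thesis by (simp add: set_integrable_def)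
    qed
  next
    fix c d a' b' :: real and n :: nat
    assume sub: "cbox (c, a') (d, b') \<subseteq> J \<times> {a<..<b}"
    define \<alpha> \<eta> where "\<alpha> = bump (real n) c d" and "\<eta> = bump (real n) a' b'"
    have [measurable]: "\<alpha> \<in> borel_measurable borel" "\<eta> \<in> borel_measurable borel" by (simp_all add: \<alpha>_def \<eta>_def)
    show "(\<integral>p. P p * (\<alpha> (fst p) * \<eta> (snd p)) \<partial>lborel) = 0"
    proof (cases "c < d \<and> a' < b'")
      case False
      then have "\<alpha> (fst p) = 0 \<or> \<eta> (snd p) = 0" for p 
        using bump_outside[of "real n"] by (auto simp: \<alpha>_def \<eta>_def)
      then have "P p * (\<alpha> (fst p) * \<eta> (snd p)) = 0" for p by (simp only: mult_eq_0_iff) blast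
      then show ?thesis by (simp only: Bochner_Integration.integral_zero)
    next
      case True
      then have cJ: "{c..d} \<subseteq> J" "{a'..b'} \<subseteq> {a<..<b}" using sub by (auto simp: cbox_Pair_subset_iff)
      define k where "k = (\<integral>x. \<eta> x \<partial>lborel)"
      have \<eta>i: "integrable lborel \<eta>" by (simp add: \<eta>_def bump_integrable)
      have \<alpha>b: "\<bar>\<alpha> x\<bar> \<le> 1" and \<eta>b: "\<bar>\<eta> x\<bar> \<le> 1" for x using bump_bounds by (auto simp: \<alpha>_def \<eta>_def)
      have \<alpha>z: "x \<notin> {c..d} \<Longrightarrow> \<alpha> x = 0" and \<eta>z: "x \<notin> {a'..b'} \<Longrightarrow> \<eta> x = 0" for x
        using bump_outside[of "real n"] by (auto simp: \<alpha>_def \<eta>_def)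
      \<comment> \<open>Having mean zero, \<open>\<zeta>\<close> is the derivative of a test function, so that \<open>M\<close> annihilates \<open>\<alpha> \<otimes> \<zeta>\<close>.\<close>
      define \<zeta> where "\<zeta> t = \<eta> t - k * \<eta>0 t" for t
      define A B where "A = min a' a1" and "B = max b' b1"
      have "a < a'" "b' < b" using cJ(2)[THEN subsetD, of a'] cJ(2)[THEN subsetD, of b'] True by simp_all
      then have "a < A" "B < b" "A \<le> B" using a1 by (simp_all add: A_def B_def)
      then have AB: "A \<le> B" "{A..B} \<subseteq> {a<..<b}" by auto
      have \<zeta>s: "\<zeta> \<in> smooth1" unfolding \<zeta>_def \<eta>_def by (intro smooth1_diff smooth1_cmult bump_smooth1 \<eta>0s)
      have \<zeta>z: "\<zeta> x = 0" if "x \<notin> {A..B}" for x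
      proof -
        have "x \<notin> {a'..b'}" "x \<notin> {a1..b1}" using that by (auto simp: A_def B_def)
        then show ?thesis using \<eta>z \<eta>0z by (simp add: \<zeta>_def)
      qed
      have \<zeta>i: "integrable lborel \<zeta>" "(\<integral>x. \<zeta> x \<partial>lborel) = 0"
        using \<eta>i \<eta>0i by (simp_all add: \<zeta>_def[abs_def] k_def)
      have "(\<zeta> has_integral 0) UNIV" using has_integral_integral_lborel[OF \<zeta>i(1)] \<zeta>i(2) by simp
      moreover have "(\<lambda>x. if x \<in> {A..B} then \<zeta> x else 0) = \<zeta>" using \<zeta>z by auto
      ultimately have hi: "(\<zeta> has_integral 0) {A..B}" using has_integral_restrict_UNIV[of "{A..B}" \<zeta> 0] by simp
      obtain \<beta> where \<beta>: "\<beta> \<in> smooth1" "\<And>x. (\<beta> has_real_derivative \<zeta> x) (at x)"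
          "\<And>x. x \<notin> {A..B} \<Longrightarrow> \<beta> x = 0"
        by (rule smooth1_antiderivative[OF \<zeta>s \<zeta>z AB(1) hi]) (assumption | rule that; assumption)+
      have "cbox (c, A) (d, B) \<subseteq> J \<times> {a<..<b}" unfolding cbox_Pair_subset_iff using AB(2) cJ(1) by blast
      then have z0: "(\<integral>p. M p * (\<alpha> (fst p) * \<zeta> (snd p)) \<partial>lborel) = 0"
        using True AB by (intro weak[OF _ \<beta>(1) \<zeta>s \<beta>(2) _ _ _ \<alpha>z \<beta>(3)]) (simp_all add: \<alpha>_def bump_smooth1)
      have i1: "integrable lborel (\<lambda>p. M p * (\<alpha> (fst p) * \<eta> (snd p)))"
        by (rule integrable_mult_supported[OF loc[OF sub] _ _ _ \<alpha>b \<eta>b]) (use \<alpha>z \<eta>z in auto)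
      have i2: "integrable lborel (\<lambda>p. M p * (\<alpha> (fst p) * \<eta>0 (snd p)))"
        "integrable lborel (\<lambda>s. \<alpha> s * h s)"
        "(\<integral>p. M p * (\<alpha> (fst p) * \<eta>0 (snd p)) \<partial>lborel) = (\<integral>s. \<alpha> s * h s \<partial>lborel)"
        by (rule M\<eta>[OF \<open>\<alpha> \<in> borel_measurable borel\<close> cJ(1) \<alpha>b \<alpha>z], assumption)+
      have "(\<integral>p. M p * (\<alpha> (fst p) * \<zeta> (snd p)) \<partial>lborel) =
          (\<integral>p. M p * (\<alpha> (fst p) * \<eta> (snd p)) - k * (M p * (\<alpha> (fst p) * \<eta>0 (snd p))) \<partial>lborel)"
        by (intro Bochner_Integration.integral_cong refl) (simp add: \<zeta>_def algebra_simps)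
      also have "\<dots> = (\<integral>p. M p * (\<alpha> (fst p) * \<eta> (snd p)) \<partial>lborel) - k * (\<integral>s. \<alpha> s * h s \<partial>lborel)"
        using i2(3) by (subst Bochner_Integration.integral_diff[OF i1 integrable_mult_right[OF i2(1)]]) simp
      finally have e1: "(\<integral>p. M p * (\<alpha> (fst p) * \<eta> (snd p)) \<partial>lborel) = k * (\<integral>s. \<alpha> s * h s \<partial>lborel)"
        using z0 by simp
      have i3: "integrable lborel (\<lambda>p. (\<alpha> (fst p) * h (fst p)) * \<eta> (snd p))"
        using i2(2) \<eta>i by (intro plane_integrable_product) auto
      have e2: "(\<integral>p. (\<alpha> (fst p) * h (fst p)) * \<eta> (snd p) \<partial>lborel) = k * (\<integral>s. \<alpha> s * h s \<partial>lborel)"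
        using plane_integral_fst(3)[OF i3] by (simp add: k_def mult.commute)
      have "(\<integral>p. P p * (\<alpha> (fst p) * \<eta> (snd p)) \<partial>lborel) =
          (\<integral>p. M p * (\<alpha> (fst p) * \<eta> (snd p)) - (\<alpha> (fst p) * h (fst p)) * \<eta> (snd p) \<partial>lborel)"
        by (intro Bochner_Integration.integral_cong refl) (simp add: P_def algebra_simps)
      also have "\<dots> = 0" using e1 e2 by (subst Bochner_Integration.integral_diff[OF i1 i3]) simp
      finally show ?thesis .
    qed
  qed
  then show ?thesis by (intro bexI[OF _ hm]) (simp add: P_def)
qed

section \<open>Integration by parts and indefinite integrals on lines\<close>

lemma AE_fst:
  assumes "AE x in (lborel :: real measure). Q x"
  shows "AE p in (lborel :: (real \<times> real) measure). Q (fst p)"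
proof -
  obtain N where N: "N \<in> sets lborel" "emeasure lborel N = 0" "{x. \<not> Q x} \<subseteq> N"
    using AE_E[OF assms] by auto
  have "AE x in (lborel :: real measure). x \<notin> N" using N by (intro AE_not_in) auto
  then have 1: "AE x in lborel. AE y in (lborel :: real measure). fst (x, y) \<notin> N" by eventually_elim simp
  have [measurable]: "N \<in> sets borel" using N(1) by simp
  have "AE p in (lborel :: (real \<times> real) measure). fst p \<notin> N"
    by (rule plane_AE_I[OF _ 1]) measurable
  then show ?thesis by eventually_elim (use N(3) in blast)
qed

lemma smooth1_bounded_support:
  assumes f: "f \<in> smooth1" "\<And>x. x \<notin> {a..b} \<Longrightarrow> f x = 0"
  shows "\<exists>B\<ge>0. \<forall>x. \<bar>f x\<bar> \<le> B" "integrable lborel f"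
proof -
  have "compact (f ` {a..b})" by (intro compact_continuous_image smooth1_continuous f) simp
  then have "\<exists>B. \<forall>x\<in>{a..b}. \<bar>f x\<bar> \<le> B"
    by (auto dest!: compact_imp_bounded simp: bounded_iff)
  then obtain B where B: "\<And>x. x \<in> {a..b} \<Longrightarrow> \<bar>f x\<bar> \<le> B" by blast
  have B': "\<bar>f x\<bar> \<le> max B 0" for x using B[of x] f(2)[of x] by fastforce
  then show "\<exists>B\<ge>0. \<forall>x. \<bar>f x\<bar> \<le> B" by (intro exI[of _ "max B 0"]) auto
  show "integrable lborel f"
  proof (rule Bochner_Integration.integrable_bound)
    show "integrable lborel (\<lambda>x. max B 0 * indicator {a..b} x :: real)"
      by (intro integrable_mult_right integrable_real_indicator) (auto simp: emeasure_lborel_Icc_eq)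
    show "AE x in lborel. norm (f x) \<le> norm (max B 0 * indicator {a..b} x)"
      using B' f(2) by (intro AE_I2) (auto simp: indicator_def)
  qed (use smooth1_borel[OF f(1)] in simp)
qed

lemma deriv_supported:
  assumes "\<And>x. (\<beta> has_real_derivative \<beta>' x) (at x)" "\<And>x. x \<notin> {a..b} \<Longrightarrow> \<beta> x = 0" "x \<notin> {a..b}"
  shows "\<beta>' x = (0::real)"
proof -
  have "open (- {a..b})" by (intro open_Compl) auto
  have "((\<lambda>x. 0) has_real_derivative 0) (at x)" by simp
  then have "(\<beta> has_real_derivative 0) (at x)"
    by (rule has_field_derivative_transform_within_open[OF _ \<open>open (- {a..b})\<close>]) (use assms in auto)
  with assms(1) show ?thesis by (rule DERIV_unique)
qed

text \<open>An indefinite integral of a merely integrable \<open>g\<close> is differentiated weakly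
  by Fubini on the region r \<le> t: for fixed \<open>r\<close> the inner integral of
  \<open>\<beta>'\<close> over t \<ge> r is \<open>- \<beta> r\<close>, because
  \<open>\<beta>\<close> vanishes far to the right.\<close>

lemma integral_parts_indefinite:
  fixes g \<beta> \<beta>' :: "real \<Rightarrow> real"
  assumes g: "integrable lborel g" and \<beta>: "\<beta>' \<in> smooth1" "\<And>x. (\<beta> has_real_derivative \<beta>' x) (at x)"
     "\<And>x. x \<notin> {a..b} \<Longrightarrow> \<beta> x = 0"
  shows "(\<integral>t. (\<integral>r. (if r \<le> t then g r else 0) \<partial>lborel) * \<beta>' t \<partial>lborel) = - (\<integral>r. g r * \<beta> r \<partial>lborel)"
proof -
  have [measurable]: "g \<in> borel_measurable borel" "\<beta>' \<in> borel_measurable borel"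
    using g smooth1_borel[OF \<beta>(1)] by auto
  have \<beta>'z: "\<beta>' x = 0" if "x \<notin> {a..b}" for x using deriv_supported[OF \<beta>(2,3) that] by simp
  have inner: "(\<integral>t. (if r \<le> t then g r * \<beta>' t else 0) \<partial>lborel) = - (g r * \<beta> r)" for r
  proof -
    \<comment> \<open>Beyond both \<open>r\<close> and the support, so that
      \<open>\<beta> T = 0\<close> and the half-line may be cut off at \<open>T\<close>.\<close>
    define T where "T = max b r + 1"
    have "(\<integral>t. \<beta>' t * indicator {r..T} t \<partial>lborel) = \<beta> T - \<beta> r"
      using smooth1_continuous[OF \<beta>(1), of UNIV] \<beta>(2)
      by (intro integral_FTC_Icc_real) (auto simp: T_def continuous_on_eq_continuous_at)
    moreover have "\<beta> T = 0" by (rule \<beta>(3)) (auto simp: T_def)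
    moreover have "(if r \<le> t then g r * \<beta>' t else 0) = g r * (\<beta>' t * indicator {r..T} t)" for t
    proof -
      have "\<beta>' t = 0" if "T < t" by (rule \<beta>'z) (use that in \<open>auto simp: T_def\<close>)
      then show ?thesis by (auto simp: indicator_def not_le)
    qed
    ultimately show ?thesis by simp
  qed
  have int: "integrable (lborel \<Otimes>\<^sub>M lborel) (\<lambda>(r, t). if r \<le> t then g r * \<beta>' t else 0)"
  proof (rule Bochner_Integration.integrable_bound)
    show "integrable (lborel \<Otimes>\<^sub>M lborel) (\<lambda>p. g (fst p) * \<beta>' (snd p))"
      using plane_integrable_product[OF g smooth1_bounded_support(2)[OF \<beta>(1) \<beta>'z]] by (simp add: lborel_prod)
    show "AE x in lborel \<Otimes>\<^sub>M lborel. norm (case x of (r, t) \<Rightarrow> if r \<le> t then g r * \<beta>' t else 0)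
             \<le> norm (g (fst x) * \<beta>' (snd x))" by (intro AE_I2) auto
  qed measurable
  have "(\<integral>t. (\<integral>r. (if r \<le> t then g r else 0) \<partial>lborel) * \<beta>' t \<partial>lborel) =
     (\<integral>t. (\<integral>r. (if r \<le> t then g r * \<beta>' t else 0) \<partial>lborel) \<partial>lborel)"
    by (intro Bochner_Integration.integral_cong refl)
      (subst Bochner_Integration.integral_mult_left_zero[symmetric], intro Bochner_Integration.integral_cong refl, simp)
  also have "\<dots> = (\<integral>r. (\<integral>t. (if r \<le> t then g r * \<beta>' t else 0) \<partial>lborel) \<partial>lborel)"
    by (rule lborel_pair.Fubini_integral[OF int])
  also have "\<dots> = - (\<integral>r. g r * \<beta> r \<partial>lborel)" by (simp add: inner)
  finally show ?thesis .
qed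

text \<open>Subtracting the indefinite integral of \<open>g\<close> from \<open>F\<close> leaves a
  function whose weak derivative in the second variable is zero, to which
  \<open>du_Bois_Reymond_product\<close> applies. The first variable ranges over an arbitrary open
  \<open>J\<close>, so that the same lemma serves vertical lines and, with the coordinates swapped,
  horizontal ones.\<close>

lemma absolutely_continuous_on_lines:
  fixes F g :: "real \<times> real \<Rightarrow> real"
  assumes F[measurable]: "F \<in> borel_measurable borel" and g[measurable]: "g \<in> borel_measurable borel"
    and J: "open J" and ab: "a < b"
    and loc: "\<And>u v. cbox u v \<subseteq> J \<times> {a<..<b} \<Longrightarrow> set_integrable lborel (cbox u v) F"
    and g0: "\<And>p. p \<notin> J \<times> {a<..<b} \<Longrightarrow> g p = 0"
    and g2: "integrable lborel (\<lambda>p. (g p)\<^sup>2)"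
    and weak: "\<And>\<alpha> \<beta> \<beta>' c d a' b'. \<lbrakk>\<alpha> \<in> smooth1; \<beta> \<in> smooth1; \<beta>' \<in> smooth1;
      \<And>x. (\<beta> has_real_derivative \<beta>' x) (at x); c \<le> d; a' \<le> b'; cbox (c, a') (d, b') \<subseteq> J \<times> {a<..<b};
      \<And>x. x \<notin> {c..d} \<Longrightarrow> \<alpha> x = 0; \<And>x. x \<notin> {a'..b'} \<Longrightarrow> \<beta> x = 0\<rbrakk>
      \<Longrightarrow> (\<integral>p. F p * (\<alpha> (fst p) * \<beta>' (snd p)) \<partial>lborel) = - (\<integral>p. g p * (\<alpha> (fst p) * \<beta> (snd p)) \<partial>lborel)"
  shows "(AE s in lborel. integrable lborel (\<lambda>r. g (s, r))) \<and>
    (\<exists>h\<in>borel_measurable borel. AE p in lborel. p \<in> J \<times> {a<..<b} \<longrightarrow>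
       F p = h (fst p) + (\<integral>r. (if r \<le> snd p then g (fst p, r) else 0) \<partial>lborel))"
proof -
  have gi: "integrable lborel (\<lambda>p. g p * (\<alpha> (fst p) * w (snd p)))"
    if [measurable]: "\<alpha> \<in> borel_measurable borel" "w \<in> borel_measurable borel"
      and b: "\<And>x. \<bar>\<alpha> x\<bar> \<le> A" "\<And>x. \<bar>w x\<bar> \<le> B" "\<And>x. x \<notin> {c..d} \<Longrightarrow> \<alpha> x = 0" for \<alpha> w A B c d
  proof (rule Bochner_Integration.integrable_bound)
    have AB: "0 \<le> A" "0 \<le> B" using b(1)[of 0] b(2)[of 0] by linarith+
    have "integrable lborel (\<lambda>p. indicator {c..d} (fst p) * indicator {a..b} (snd p) :: real)"
      by (rule plane_integrable_product; intro integrable_real_indicator) (auto simp: emeasure_lborel_Icc_eq)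
    then show "integrable lborel (\<lambda>p. A * B * ((g p)\<^sup>2 + indicator {c..d} (fst p) * indicator {a..b} (snd p)))"
      using g2 by simp
    show "AE p in lborel. norm (g p * (\<alpha> (fst p) * w (snd p)))
         \<le> norm (A * B * ((g p)\<^sup>2 + indicator {c..d} (fst p) * indicator {a..b} (snd p)))"
    proof (rule AE_I2)
      fix p :: "real \<times> real"
      show "norm (g p * (\<alpha> (fst p) * w (snd p))) \<le> norm (A * B * ((g p)\<^sup>2 + indicator {c..d} (fst p) * indicator {a..b} (snd p)))"
      proof (cases "fst p \<in> {c..d} \<and> snd p \<in> {a..b}")
        case True
        have "\<bar>\<alpha> (fst p) * w (snd p)\<bar> \<le> A * B"
          using b AB by (auto simp: abs_mult intro!: mult_mono)
        \<comment> \<open>Square integrability yields integrability on sets of finite measure; this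
          is where the boundedness of the interval \<open>{a<..<b}\<close> is used.\<close>
        moreover have "\<bar>g p\<bar> \<le> (g p)\<^sup>2 + 1"
          using sum_squares_bound[of "\<bar>g p\<bar>" 1] by (simp add: power2_eq_square)
        ultimately have "\<bar>g p\<bar> * \<bar>\<alpha> (fst p) * w (snd p)\<bar> \<le> ((g p)\<^sup>2 + 1) * (A * B)"
          by (intro mult_mono) auto
        then show ?thesis using True AB by (simp add: abs_mult mult.commute)
      next
        case False
        then have "g p = 0 \<or> \<alpha> (fst p) = 0" using g0[of p] b(3)[of "fst p"] by (cases p) auto
        then show ?thesis by auto
      qed
    qed
  qed measurable
  \<comment> \<open>\<open>g\<close> is integrable over slabs of bounded width in the first
    variable, not necessarily over the plane; countably many slabs give almost every line.\<close>
  have "AE s in lborel. \<forall>n::nat. integrable lborel (\<lambda>r. g (s, r) * (indicator {- real n..real n} s * 1))"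
  proof (subst AE_all_countable, intro allI)
    fix n :: nat
    have "integrable lborel (\<lambda>p. g p * (indicator {- real n..real n} (fst p) * 1))"
      by (rule gi[where A=1 and B=1 and c="- real n" and d="real n"]) (auto simp: indicator_def)
    from plane_integral_fst(1)[OF this]
    show "AE s in lborel. integrable lborel (\<lambda>r. g (s, r) * (indicator {- real n..real n} s * 1))" by simp
  qed
  then have gs: "AE s in lborel. integrable lborel (\<lambda>r. g (s, r))"
  proof eventually_elim
    case (elim s)
    obtain n where "\<bar>s\<bar> \<le> real n" using real_arch_simple by blast
    then show ?case using elim[rule_format, of n] by (simp add: indicator_def abs_le_iff)
  qed
  define u where "u p = (\<integral>r. (if r \<le> snd p then g (fst p, r) else 0) \<partial>lborel)" for p
  \<comment> \<open>A bound for \<open>u\<close> on the whole line over \<open>s\<close>,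
    independent of the second coordinate. Its local integrability gives that of
    \<open>u\<close>.\<close>
  define v where "v s = (\<integral>r. \<bar>g (s, r)\<bar> \<partial>lborel)" for s
  have um[measurable]: "u \<in> borel_measurable borel"
  proof -
    have "(\<lambda>p::real\<times>real. (\<integral>r. (if r \<le> snd p then g (fst p, r) else 0) \<partial>lborel)) \<in> borel_measurable borel" 
      by measurable
    then show ?thesis by (simp add: u_def[abs_def])
  qed
  have uv: "AE p in lborel. \<bar>u p\<bar> \<le> v (fst p)"
    using AE_fst[OF gs]
  proof eventually_elim
    case (elim p)
    have "\<bar>u p\<bar> \<le> (\<integral>r. \<bar>if r \<le> snd p then g (fst p, r) else 0\<bar> \<partial>lborel)"
      unfolding u_def by (rule integral_abs_bound)
    also have "\<dots> \<le> v (fst p)" unfolding v_def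
    proof (rule integral_mono)
      show "integrable lborel (\<lambda>r. \<bar>g (fst p, r)\<bar>)" using elim by simp
      then show "integrable lborel (\<lambda>r. \<bar>if r \<le> snd p then g (fst p, r) else 0\<bar>)"
        by (rule Bochner_Integration.integrable_bound) auto
    qed auto
    finally show ?case .
  qed
  have vm[measurable]: "v \<in> borel_measurable borel"
  proof -
    have "(\<lambda>s. (\<integral>r. \<bar>g (s, r)\<bar> \<partial>lborel)) \<in> borel_measurable borel" by measurable
    then show ?thesis by (simp add: v_def[abs_def])
  qed
  have vi: "integrable lborel (\<lambda>s. indicator {c..d} s * v s)" for c d
  proof -
    have "integrable lborel (\<lambda>p. g p * (indicator {c..d} (fst p) * 1))"
      by (rule gi[where A=1 and B=1 and c=c and d=d]) (auto simp: indicator_def)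
    then have "integrable lborel (\<lambda>p. \<bar>g p\<bar> * (indicator {c..d} (fst p)))"
      by (drule_tac integrable_abs) (simp add: abs_mult)
    from plane_integral_fst(2)[OF this] show ?thesis by (simp add: v_def mult.commute)
  qed
  have uloc: "set_integrable lborel (cbox (c, a') (d, b')) u" for c d a' b'
    unfolding set_integrable_def
  proof (rule Bochner_Integration.integrable_bound)
    show "integrable lborel (\<lambda>p. (indicator {c..d} (fst p) * v (fst p)) * indicator {a'..b'} (snd p) :: real)"
      by (rule plane_integrable_product[OF vi], intro integrable_real_indicator) (auto simp: emeasure_lborel_Icc_eq)
    show "AE p in lborel. norm (indicator (cbox (c, a') (d, b')) p *\<^sub>R u p)
         \<le> norm ((indicator {c..d} (fst p) * v (fst p)) * indicator {a'..b'} (snd p))"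
      using uv by eventually_elim (auto simp: indicator_def cbox_Pair_eq)
  qed measurable
  define M where "M p = F p - u p" for p
  have "\<exists>h\<in>borel_measurable borel. AE p in lborel. p \<in> J \<times> {a<..<b} \<longrightarrow> M p = h (fst p)"
  proof (rule du_Bois_Reymond_product[OF _ J ab])
    show "M \<in> borel_measurable borel" unfolding M_def by measurable
    show "set_integrable lborel (cbox x y) M" if "cbox x y \<subseteq> J \<times> {a<..<b}" for x y
      using set_integral_diff(1)[OF loc[OF that] uloc[of "fst x" "snd x" "fst y" "snd y", unfolded prod.collapse]]
      by (simp add: M_def[abs_def])
  next
    fix \<alpha> \<beta> \<beta>' c d a' b'
    assume \<alpha>: "\<alpha> \<in> smooth1" and \<beta>: "\<beta> \<in> smooth1" and \<beta>': "\<beta>' \<in> smooth1" 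
      and D: "\<And>x. (\<beta> has_real_derivative \<beta>' x) (at x)" and cd: "c \<le> d" "a' \<le> b'" 
      and sub: "cbox (c, a') (d, b') \<subseteq> J \<times> {a<..<b}"
      and \<alpha>z: "\<And>x. x \<notin> {c..d} \<Longrightarrow> \<alpha> x = 0" and \<beta>z: "\<And>x. x \<notin> {a'..b'} \<Longrightarrow> \<beta> x = 0"
    have [measurable]: "\<alpha> \<in> borel_measurable borel" "\<beta> \<in> borel_measurable borel" "\<beta>' \<in> borel_measurable borel"
      using \<alpha> \<beta> \<beta>' by (auto intro: smooth1_borel)
    have \<beta>'z: "\<beta>' x = 0" if "x \<notin> {a'..b'}" for x using deriv_supported[OF D \<beta>z that] by simp
    obtain A where A: "\<And>x. \<bar>\<alpha> x\<bar> \<le> A" using smooth1_bounded_support(1)[OF \<alpha> \<alpha>z] by blast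
    obtain B where B: "\<And>x. \<bar>\<beta> x\<bar> \<le> B" using smooth1_bounded_support(1)[OF \<beta> \<beta>z] by blast
    obtain B' where B': "\<And>x. \<bar>\<beta>' x\<bar> \<le> B'" using smooth1_bounded_support(1)[OF \<beta>' \<beta>'z] by blast
    have iF: "integrable lborel (\<lambda>p. F p * (\<alpha> (fst p) * \<beta>' (snd p)))"
      by (rule integrable_mult_supported[OF loc[OF sub] _ _ _ A B']) (use \<alpha>z \<beta>'z in auto)
    have iu: "integrable lborel (\<lambda>p. u p * (\<alpha> (fst p) * \<beta>' (snd p)))"
      by (rule integrable_mult_supported[OF uloc _ _ _ A B']) (use \<alpha>z \<beta>'z in auto)
    have ig: "integrable lborel (\<lambda>p. g p * (\<alpha> (fst p) * \<beta> (snd p)))"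
      by (rule gi[OF _ _ A B, where c=c and d=d]) (use \<alpha>z in auto)
    have "(\<integral>p. u p * (\<alpha> (fst p) * \<beta>' (snd p)) \<partial>lborel) = (\<integral>s. \<integral>t. u (s, t) * (\<alpha> s * \<beta>' t) \<partial>lborel \<partial>lborel)"
      using plane_integral_fst(3)[OF iu] by simp
    also have "\<dots> = (\<integral>s. - (\<integral>t. g (s, t) * (\<alpha> s * \<beta> t) \<partial>lborel) \<partial>lborel)"
    proof (rule integral_cong_AE)
      show "AE s in lborel. (\<integral>t. u (s, t) * (\<alpha> s * \<beta>' t) \<partial>lborel) = - (\<integral>t. g (s, t) * (\<alpha> s * \<beta> t) \<partial>lborel)"
        using gs
      proof eventually_elim
        case (elim s)
        have "(\<integral>t. u (s, t) * (\<alpha> s * \<beta>' t) \<partial>lborel) = (\<integral>t. \<alpha> s * (u (s, t) * \<beta>' t) \<partial>lborel)"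
          by (intro Bochner_Integration.integral_cong refl) (simp add: ac_simps)
        also have "\<dots> = \<alpha> s * (\<integral>t. u (s, t) * \<beta>' t \<partial>lborel)" by simp
        also have "\<dots> = \<alpha> s * (- (\<integral>t. g (s, t) * \<beta> t \<partial>lborel))"
          unfolding u_def fst_conv snd_conv
          by (subst integral_parts_indefinite[where a=a' and b=b', OF elim \<beta>' D]) (simp_all add: \<beta>z)
        also have "\<dots> = - (\<integral>t. \<alpha> s * (g (s, t) * \<beta> t) \<partial>lborel)" by simp
        also have "(\<integral>t. \<alpha> s * (g (s, t) * \<beta> t) \<partial>lborel) = (\<integral>t. g (s, t) * (\<alpha> s * \<beta> t) \<partial>lborel)"
          by (intro Bochner_Integration.integral_cong refl) (simp add: ac_simps)
        finally show ?case .
      qed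
    qed measurable
    also have "\<dots> = - (\<integral>p. g p * (\<alpha> (fst p) * \<beta> (snd p)) \<partial>lborel)"
      using plane_integral_fst(3)[OF ig] by simp
    finally have eu: "(\<integral>p. u p * (\<alpha> (fst p) * \<beta>' (snd p)) \<partial>lborel) = - (\<integral>p. g p * (\<alpha> (fst p) * \<beta> (snd p)) \<partial>lborel)" .
    have "(\<integral>p. M p * (\<alpha> (fst p) * \<beta>' (snd p)) \<partial>lborel) =
        (\<integral>p. F p * (\<alpha> (fst p) * \<beta>' (snd p)) - u p * (\<alpha> (fst p) * \<beta>' (snd p)) \<partial>lborel)"
      by (intro Bochner_Integration.integral_cong refl) (simp add: M_def algebra_simps)
    also have "\<dots> = 0"
      using eu weak[OF \<alpha> \<beta> \<beta>' D cd sub \<alpha>z \<beta>z] by (subst Bochner_Integration.integral_diff[OF iF iu]) simp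
    finally show "(\<integral>p. M p * (\<alpha> (fst p) * \<beta>' (snd p)) \<partial>lborel) = 0" .
  qed
  then obtain h where "h \<in> borel_measurable borel" and h: "AE p in lborel. p \<in> J \<times> {a<..<b} \<longrightarrow> M p = h (fst p)" by blast
  then have "\<exists>h\<in>borel_measurable borel. AE p in lborel. p \<in> J \<times> {a<..<b} \<longrightarrow>
           F p = h (fst p) + (\<integral>r. (if r \<le> snd p then g (fst p, r) else 0) \<partial>lborel)"
    by (intro bexI[of _ h]) (auto simp: M_def u_def elim!: eventually_mono)
  with gs show ?thesis by blast
qed

section \<open>Hardy's inequality and the seminorm of the trace space\<close>

lemma nn_integral_scale:
  fixes f :: "real \<Rightarrow> ennreal"
  assumes [measurable]: "f \<in> borel_measurable borel" and c: "0 < c"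
  shows "(\<integral>\<^sup>+x. f (c * x) \<partial>lborel) = ennreal (1 / c) * (\<integral>\<^sup>+x. f x \<partial>lborel)"
proof -
  have "(\<integral>\<^sup>+x. f x \<partial>lborel) = ennreal c * (\<integral>\<^sup>+x. f (c * x) \<partial>lborel)"
    using nn_integral_real_affine[of f c 0] c by simp
  then have "ennreal (1 / c) * (\<integral>\<^sup>+x. f x \<partial>lborel) = (ennreal (1 / c) * ennreal c) * (\<integral>\<^sup>+x. f (c * x) \<partial>lborel)"
    by (simp add: mult.assoc)
  also have "ennreal (1 / c) * ennreal c = 1" using c by (simp add: ennreal_mult[symmetric])
  finally show ?thesis by simp
qed

lemma nn_integral_shift:
  fixes f :: "real \<Rightarrow> ennreal"
  assumes [measurable]: "f \<in> borel_measurable borel"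
  shows "(\<integral>\<^sup>+x. f (x + t) \<partial>lborel) = (\<integral>\<^sup>+x. f x \<partial>lborel)"
  using nn_integral_real_affine[of f 1 t] by (simp add: add.commute)

lemma nn_integral_inverse_sqrt:
  "(\<integral>\<^sup>+\<sigma>. ennreal (\<sigma> powr (- 1 / 2)) * indicator {0<..<1} \<sigma> \<partial>lborel) \<le> 2"
proof -
  have "((\<lambda>x::real. x powr (- 1 / 2)) has_integral 2) {0..1}"
    using has_integral_powr_from_0[of "- 1 / 2" 1] by simp
  from nn_integral_has_integral_lebesgue'[OF _ this]
  have "(\<integral>\<^sup>+\<sigma>. ennreal (\<sigma> powr (- 1 / 2)) * indicator {0..1} \<sigma> \<partial>lborel) = ennreal 2" by simp
  moreover have "(\<integral>\<^sup>+\<sigma>. ennreal (\<sigma> powr (- 1 / 2)) * indicator {0<..<1} \<sigma> \<partial>lborel) \<le>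
     (\<integral>\<^sup>+\<sigma>. ennreal (\<sigma> powr (- 1 / 2)) * indicator {0..1} \<sigma> \<partial>lborel)"
    by (intro nn_integral_mono) (auto simp: indicator_def)
  ultimately show ?thesis by simp
qed

text \<open>Putting s = \<sigma> t turns the mean of \<open>u\<close> over (0, t) into an average of
  the dilates \<open>u (\<sigma> * t)\<close>, each of which has squared norm
  \<open>N / \<sigma>\<close>. The integral of \<sigma> to the power -1/2 over the unit interval is
  2; it appears once from Cauchy-Schwarz and once from the dilates, whence the constant 4.\<close>

lemma hardy_inequality:
  fixes u :: "real \<Rightarrow> ennreal"
  assumes [measurable]: "u \<in> borel_measurable borel"
  shows "(\<integral>\<^sup>+t. (\<integral>\<^sup>+s. u s * indicator {0<..<t} s \<partial>lborel)\<^sup>2 * ennreal (1 / t\<^sup>2) * indicator {0<..} t \<partial>lborel)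
    \<le> 4 * (\<integral>\<^sup>+s. (u s)\<^sup>2 \<partial>lborel)"
proof -
  define N where "N = (\<integral>\<^sup>+s. (u s)\<^sup>2 \<partial>lborel)"
  define I where "I = (\<integral>\<^sup>+\<sigma>. ennreal (\<sigma> powr (- 1 / 2)) * indicator {0<..<1} \<sigma> \<partial>lborel)"
  have pt: "(\<integral>\<^sup>+s. u s * indicator {0<..<t} s \<partial>lborel)\<^sup>2 * ennreal (1 / t\<^sup>2) * indicator {0<..} t
     \<le> 2 * (\<integral>\<^sup>+\<sigma>. (u (\<sigma> * t))\<^sup>2 * ennreal (\<sigma> powr (1 / 2)) * indicator {0<..<1} \<sigma> \<partial>lborel)" for t
  proof (cases "0 < t")
    case True
    have "(\<integral>\<^sup>+s. u s * indicator {0<..<t} s \<partial>lborel) = ennreal t * (\<integral>\<^sup>+\<sigma>. u (0 + t * \<sigma>) * indicator {0<..<t} (0 + t * \<sigma>) \<partial>lborel)"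
      using True by (subst nn_integral_real_affine[where c=t and t=0]) auto
    also have "(\<integral>\<^sup>+\<sigma>. u (0 + t * \<sigma>) * indicator {0<..<t} (0 + t * \<sigma>) \<partial>lborel)
      \<comment> \<open>the weight \<open>\<sigma>\<^sup>1\<^sup>/\<^sup>4\<close> makes both factors of Cauchy-Schwarz integrable near \<open>0\<close>\<close>
      = (\<integral>\<^sup>+\<sigma>. (u (\<sigma> * t) * ennreal (\<sigma> powr (1/4)) * indicator {0<..<1} \<sigma>) * (ennreal (\<sigma> powr (-1/4)) * indicator {0<..<1} \<sigma>) \<partial>lborel)"
    proof (intro nn_integral_cong)
      fix \<sigma> :: real
      have "ennreal (\<sigma> powr (1/4)) * ennreal (\<sigma> powr (-1/4)) = 1" if "0 < \<sigma>"
        using that by (simp add: ennreal_mult[symmetric] powr_add[symmetric])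
      then have "u (\<sigma> * t) * ennreal (\<sigma> powr (1/4)) * ennreal (\<sigma> powr (-1/4)) = u (\<sigma> * t)" if "0 < \<sigma>"
        using that by (simp only: mult.assoc mult_1_right)
      then show "u (0 + t * \<sigma>) * indicator {0<..<t} (0 + t * \<sigma>) =
        (u (\<sigma> * t) * ennreal (\<sigma> powr (1/4)) * indicator {0<..<1} \<sigma>) * (ennreal (\<sigma> powr (-1/4)) * indicator {0<..<1} \<sigma>)"
        using True by (auto simp: indicator_def zero_less_mult_iff mult.commute[of t])
    qed
    finally have "(\<integral>\<^sup>+s. u s * indicator {0<..<t} s \<partial>lborel)\<^sup>2 = (ennreal t)\<^sup>2 *
       (\<integral>\<^sup>+\<sigma>. (u (\<sigma> * t) * ennreal (\<sigma> powr (1/4)) * indicator {0<..<1} \<sigma>) * (ennreal (\<sigma> powr (-1/4)) * indicator {0<..<1} \<sigma>) \<partial>lborel)\<^sup>2"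
      by (simp add: power_mult_distrib)
    also have "\<dots> \<le> (ennreal t)\<^sup>2 * ((\<integral>\<^sup>+\<sigma>. (u (\<sigma> * t) * ennreal (\<sigma> powr (1/4)) * indicator {0<..<1} \<sigma>)\<^sup>2 \<partial>lborel) *
        (\<integral>\<^sup>+\<sigma>. (ennreal (\<sigma> powr (-1/4)) * indicator {0<..<1} \<sigma>)\<^sup>2 \<partial>lborel))"
      by (intro mult_left_mono Cauchy_Schwarz_nn_integral) auto
    also have "(\<integral>\<^sup>+\<sigma>. (ennreal (\<sigma> powr (-1/4)) * indicator {0<..<1} \<sigma>)\<^sup>2 \<partial>lborel) = I"
      unfolding I_def by (intro nn_integral_cong)
        (auto simp: indicator_def power_mult_distrib ennreal_power powr_power)
    also have "(\<integral>\<^sup>+\<sigma>. (u (\<sigma> * t) * ennreal (\<sigma> powr (1/4)) * indicator {0<..<1} \<sigma>)\<^sup>2 \<partial>lborel)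
       = (\<integral>\<^sup>+\<sigma>. (u (\<sigma> * t))\<^sup>2 * ennreal (\<sigma> powr (1 / 2)) * indicator {0<..<1} \<sigma> \<partial>lborel)" (is "_ = ?K")
      by (intro nn_integral_cong)
        (auto simp: indicator_def power_mult_distrib ennreal_power powr_power)
    finally have "(\<integral>\<^sup>+s. u s * indicator {0<..<t} s \<partial>lborel)\<^sup>2 \<le> (ennreal t)\<^sup>2 * (?K * I)" .
    also have "\<dots> \<le> (ennreal t)\<^sup>2 * (?K * 2)"
      unfolding I_def using nn_integral_inverse_sqrt by (intro mult_left_mono) auto
    finally have "(\<integral>\<^sup>+s. u s * indicator {0<..<t} s \<partial>lborel)\<^sup>2 * ennreal (1 / t\<^sup>2) \<le> (ennreal t)\<^sup>2 * (?K * 2) * ennreal (1 / t\<^sup>2)"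
      by (rule mult_right_mono) simp
    also have "\<dots> = ((ennreal t)\<^sup>2 * ennreal (1 / t\<^sup>2)) * (2 * ?K)" by (simp add: ac_simps)
    also have "(ennreal t)\<^sup>2 * ennreal (1 / t\<^sup>2) = 1"
      using True by (simp add: ennreal_power ennreal_mult[symmetric])
    finally show ?thesis using True by simp
  qed simp
  have "(\<integral>\<^sup>+t. (\<integral>\<^sup>+s. u s * indicator {0<..<t} s \<partial>lborel)\<^sup>2 * ennreal (1 / t\<^sup>2) * indicator {0<..} t \<partial>lborel)
    \<le> (\<integral>\<^sup>+t. 2 * (\<integral>\<^sup>+\<sigma>. (u (\<sigma> * t))\<^sup>2 * ennreal (\<sigma> powr (1 / 2)) * indicator {0<..<1} \<sigma> \<partial>lborel) \<partial>lborel)"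
    by (intro nn_integral_mono pt)
  also have "\<dots> = 2 * (\<integral>\<^sup>+t. (\<integral>\<^sup>+\<sigma>. (u (\<sigma> * t))\<^sup>2 * ennreal (\<sigma> powr (1 / 2)) * indicator {0<..<1} \<sigma> \<partial>lborel) \<partial>lborel)"
    by (rule nn_integral_cmult) measurable
  also have "(\<integral>\<^sup>+t. (\<integral>\<^sup>+\<sigma>. (u (\<sigma> * t))\<^sup>2 * ennreal (\<sigma> powr (1 / 2)) * indicator {0<..<1} \<sigma> \<partial>lborel) \<partial>lborel)
    = (\<integral>\<^sup>+\<sigma>. (\<integral>\<^sup>+t. (u (\<sigma> * t))\<^sup>2 * ennreal (\<sigma> powr (1 / 2)) * indicator {0<..<1} \<sigma> \<partial>lborel) \<partial>lborel)"
    by (rule lborel_pair.Fubini') measurable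
  also have "\<dots> = (\<integral>\<^sup>+\<sigma>. ennreal (\<sigma> powr (- 1 / 2)) * indicator {0<..<1} \<sigma> * N \<partial>lborel)"
  proof (intro nn_integral_cong)
    fix \<sigma> :: real
    show "(\<integral>\<^sup>+t. (u (\<sigma> * t))\<^sup>2 * ennreal (\<sigma> powr (1 / 2)) * indicator {0<..<1} \<sigma> \<partial>lborel) =
        ennreal (\<sigma> powr (- 1 / 2)) * indicator {0<..<1} \<sigma> * N"
    proof (cases "\<sigma> \<in> {0<..<1}")
      case True
      have "(\<integral>\<^sup>+t. (u (\<sigma> * t))\<^sup>2 * ennreal (\<sigma> powr (1 / 2)) * indicator {0<..<1} \<sigma> \<partial>lborel)
         = (\<integral>\<^sup>+t. (u (\<sigma> * t))\<^sup>2 \<partial>lborel) * ennreal (\<sigma> powr (1 / 2))"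
        using True by (simp add: nn_integral_multc)
      also have "\<dots> = (ennreal (1 / \<sigma>) * ennreal (\<sigma> powr (1 / 2))) * N"
        unfolding N_def using True by (subst nn_integral_scale[of "\<lambda>x. (u x)\<^sup>2"]) (auto simp: ac_simps)
      also have "ennreal (1 / \<sigma>) * ennreal (\<sigma> powr (1 / 2)) = ennreal (\<sigma> powr (- 1 / 2))"
      proof -
        have "\<sigma> powr (- 1 / 2) = \<sigma> powr (1 / 2 - 1)" by simp
        also have "\<dots> = 1 / \<sigma> * \<sigma> powr (1 / 2)"
          using True by (simp only: powr_diff powr_one_gt_zero_iff powr_one) (simp add: powr_one)
        finally have "\<sigma> powr (- 1 / 2) = 1 / \<sigma> * \<sigma> powr (1 / 2)" .
        moreover have "ennreal (1 / \<sigma>) * ennreal (\<sigma> powr (1 / 2)) = ennreal (1 / \<sigma> * \<sigma> powr (1 / 2))"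
          using True by (subst ennreal_mult) auto
        ultimately show ?thesis by (simp only:)
      qed
      finally show ?thesis using True by simp
    qed simp
  qed
  also have "\<dots> = I * N" unfolding I_def by (rule nn_integral_multc) measurable
  also have "2 * (I * N) \<le> 2 * (2 * N)"
    unfolding I_def using nn_integral_inverse_sqrt by (intro mult_left_mono mult_right_mono) auto
  finally show ?thesis by (simp add: N_def mult.assoc[symmetric])
qed

lemma ennreal_power2_sum3:
  fixes a b c :: ennreal
  shows "(a + b + c)\<^sup>2 \<le> 3 * (a\<^sup>2 + b\<^sup>2 + c\<^sup>2)"
proof (cases "a = \<infinity> \<or> b = \<infinity> \<or> c = \<infinity>")
  case True
  then show ?thesis by (auto simp: power2_eq_square ennreal_mult_top ennreal_top_mult)
next
  case False
  then obtain x y z where xyz: "a = ennreal x" "b = ennreal y" "c = ennreal z" "0 \<le> x" "0 \<le> y" "0 \<le> z"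
    by (metis ennreal_cases infinity_ennreal_def)
  have "(x + y + z)\<^sup>2 \<le> 3 * (x\<^sup>2 + y\<^sup>2 + z\<^sup>2)"
    using sum_squares_bound[of x y] sum_squares_bound[of x z] sum_squares_bound[of y z]
    by (simp add: power2_eq_square algebra_simps)
  then have "ennreal ((x + y + z)\<^sup>2) \<le> ennreal (3 * (x\<^sup>2 + y\<^sup>2 + z\<^sup>2))" by (rule ennreal_leI)
  also have "\<dots> = 3 * (a\<^sup>2 + b\<^sup>2 + c\<^sup>2)" using xyz by (subst ennreal_mult) (auto simp: ennreal_power)
  also have "ennreal ((x + y + z)\<^sup>2) = (a + b + c)\<^sup>2"
    using xyz by (simp add: ennreal_plus[symmetric] ennreal_power del: ennreal_plus)
  finally show ?thesis .
qed

definition diff_quot_sq :: "(real \<Rightarrow> real) \<Rightarrow> ennreal" where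
  "diff_quot_sq f = (\<integral>\<^sup>+t. (\<integral>\<^sup>+x. ennreal ((f (x + t) - f x)\<^sup>2 / t\<^sup>2) \<partial>lborel) * indicator {0<..<1} t \<partial>lborel)"

text \<open>With y = x + t the domain becomes |t| \<le> 1, and translating x by t exchanges t with
  -t. Positive displacements therefore carry half of the seminorm; the endpoint t = 1 is a null
  set.\<close>

lemma Ht_norm_sq_eq_diff_quot_sq:
  assumes f[measurable]: "f \<in> borel_measurable borel"
  shows "Ht_norm_sq f = 2 * diff_quot_sq f"
proof -
  define K where "K t = (\<integral>\<^sup>+x. ennreal ((f (x + t) - f x)\<^sup>2 / t\<^sup>2) \<partial>lborel) * indicator {..1} \<bar>t\<bar>" for t
  have [measurable]: "K \<in> borel_measurable borel"
  proof -
    have "(\<lambda>t. (\<integral>\<^sup>+x. ennreal ((f (x + t) - f x)\<^sup>2 / t\<^sup>2) \<partial>lborel) * indicator {..1} \<bar>t\<bar>) \<in> borel_measurable borel"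
      by measurable
    then show ?thesis by (simp add: K_def[abs_def])
  qed
  have "Ht_norm_sq f = (\<integral>\<^sup>+x. \<integral>\<^sup>+t. ennreal ((f (x + t) - f x)\<^sup>2 / t\<^sup>2) * indicator {..1} \<bar>t\<bar> \<partial>lborel \<partial>lborel)"
    unfolding Ht_norm_sq_def
  proof (rule nn_integral_cong)
    fix x :: real
    have "(\<integral>\<^sup>+y. ennreal ((f x - f y)\<^sup>2 / (x - y)\<^sup>2) * indicator {..1} \<bar>x - y\<bar> \<partial>lborel) =
      (\<integral>\<^sup>+y. ennreal ((f x - f (y + x))\<^sup>2 / (x - (y + x))\<^sup>2) * indicator {..1} \<bar>x - (y + x)\<bar> \<partial>lborel)"
      by (rule nn_integral_shift[symmetric]) measurable
    also have "\<dots> = (\<integral>\<^sup>+t. ennreal ((f (x + t) - f x)\<^sup>2 / t\<^sup>2) * indicator {..1} \<bar>t\<bar> \<partial>lborel)"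
      by (intro nn_integral_cong) (simp add: power2_commute add.commute)
    finally show "(\<integral>\<^sup>+y. ennreal ((f x - f y)\<^sup>2 / (x - y)\<^sup>2) * indicator {..1} \<bar>x - y\<bar> \<partial>lborel) =
       (\<integral>\<^sup>+t. ennreal ((f (x + t) - f x)\<^sup>2 / t\<^sup>2) * indicator {..1} \<bar>t\<bar> \<partial>lborel)" .
  qed
  also have "\<dots> = (\<integral>\<^sup>+t. \<integral>\<^sup>+x. ennreal ((f (x + t) - f x)\<^sup>2 / t\<^sup>2) * indicator {..1} \<bar>t\<bar> \<partial>lborel \<partial>lborel)"
    by (rule lborel_pair.Fubini') measurable
  also have "\<dots> = (\<integral>\<^sup>+t. K t \<partial>lborel)"
    unfolding K_def by (intro nn_integral_cong nn_integral_multc) measurable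
  \<comment> \<open>Nothing is lost at t = 0: the increment is zero there, so
    \<open>K 0 = 0\<close>.\<close>
  also have "\<dots> = (\<integral>\<^sup>+t. K t * indicator {0<..} t + K t * indicator {..<0} t \<partial>lborel)"
    by (intro nn_integral_cong) (auto simp: indicator_def K_def not_less)
  also have "\<dots> = (\<integral>\<^sup>+t. K t * indicator {0<..} t \<partial>lborel) + (\<integral>\<^sup>+t. K t * indicator {..<0} t \<partial>lborel)"
    by (rule nn_integral_add) measurable
  also have "(\<integral>\<^sup>+t. K t * indicator {..<0} t \<partial>lborel) = (\<integral>\<^sup>+t. K (- t) * indicator {..<0} (- t) \<partial>lborel)"
    using nn_integral_real_affine[of "\<lambda>t. K t * indicator {..<0} t" "-1" 0] by simp
  also have "\<dots> = (\<integral>\<^sup>+t. K t * indicator {0<..} t \<partial>lborel)"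
  proof (intro nn_integral_cong)
    fix t :: real
    have "(\<integral>\<^sup>+x. ennreal ((f (x + - t) - f x)\<^sup>2 / (- t)\<^sup>2) \<partial>lborel) =
       (\<integral>\<^sup>+x. ennreal ((f ((x + t) + - t) - f (x + t))\<^sup>2 / (- t)\<^sup>2) \<partial>lborel)"
      by (rule nn_integral_shift[symmetric]) measurable
    then have "K (- t) = K t" by (simp add: K_def power2_commute)
    then show "K (- t) * indicator {..<0} (- t) = K t * indicator {0<..} t" by (simp add: indicator_def)
  qed
  also have "(\<integral>\<^sup>+t. K t * indicator {0<..} t \<partial>lborel) = diff_quot_sq f"
    unfolding diff_quot_sq_def
  proof (rule nn_integral_cong_AE)
    show "AE t in lborel. K t * indicator {0<..} t =
       (\<integral>\<^sup>+x. ennreal ((f (x + t) - f x)\<^sup>2 / t\<^sup>2) \<partial>lborel) * indicator {0<..<1} t"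
      using AE_lborel_singleton[of 1] by eventually_elim (auto simp: K_def indicator_def)
  qed
  finally show ?thesis by (simp add: mult_2)
qed

lemma nn_integral_square_le_length:
  fixes u :: "real \<Rightarrow> ennreal"
  assumes [measurable]: "u \<in> borel_measurable borel" and "a \<le> b"
  shows "(\<integral>\<^sup>+s. u s * indicator {a<..<b} s \<partial>lborel)\<^sup>2 \<le> ennreal (b - a) * (\<integral>\<^sup>+s. (u s)\<^sup>2 * indicator {a<..<b} s \<partial>lborel)"
proof -
  have "(\<integral>\<^sup>+s. u s * indicator {a<..<b} s \<partial>lborel)\<^sup>2 =
     (\<integral>\<^sup>+s. (u s * indicator {a<..<b} s) * indicator {a<..<b} s \<partial>lborel)\<^sup>2"
    by (intro arg_cong[where f="\<lambda>x. x\<^sup>2"] nn_integral_cong) (auto simp: indicator_def)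
  also have "\<dots> \<le> (\<integral>\<^sup>+s. (u s * indicator {a<..<b} s)\<^sup>2 \<partial>lborel) * (\<integral>\<^sup>+s. (indicator {a<..<b} s)\<^sup>2 \<partial>(lborel :: real measure))"
    by (intro Cauchy_Schwarz_nn_integral) measurable
  also have "(\<integral>\<^sup>+s. (u s * indicator {a<..<b} s)\<^sup>2 \<partial>lborel) = (\<integral>\<^sup>+s. (u s)\<^sup>2 * indicator {a<..<b} s \<partial>lborel)"
    by (intro nn_integral_cong) (auto simp: indicator_def)
  also have "(\<integral>\<^sup>+s. (indicator {a<..<b} s)\<^sup>2 \<partial>(lborel :: real measure)) = (\<integral>\<^sup>+s. indicator {a<..<b} s \<partial>(lborel :: real measure))"
    by (intro nn_integral_cong) (auto simp: indicator_def)
  also have "\<dots> = ennreal (b - a)" using assms(2) by simp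
  finally show ?thesis by (simp add: mult.commute)
qed

text \<open>
  In the hypothesis the horizontal part of the detour runs at a height equal to the displacement
  \<open>t\<close>: averaging instead over all heights below \<open>t\<close> would lose a logarithm.
\<close>

lemma diff_quot_sq_le_gradient:
  fixes A B :: "real \<times> real \<Rightarrow> ennreal"
  assumes [measurable]: "h \<in> borel_measurable borel" "A \<in> borel_measurable borel" "B \<in> borel_measurable borel"
    and h: "AE t in lborel. 0 < t \<and> t < 1 \<longrightarrow> (AE x in lborel. ennreal \<bar>h (x + t) - h x\<bar> \<le>
      (\<integral>\<^sup>+r. A (r, t) * indicator {x<..<x+t} r \<partial>lborel) +
      (\<integral>\<^sup>+s. B (x + t, s) * indicator {0<..<t} s \<partial>lborel) + (\<integral>\<^sup>+s. B (x, s) * indicator {0<..<t} s \<partial>lborel))"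
  shows "diff_quot_sq h \<le> 3 * ((\<integral>\<^sup>+p. (A p)\<^sup>2 \<partial>lborel) + 8 * (\<integral>\<^sup>+p. (B p)\<^sup>2 \<partial>lborel))"
proof -
  define a where "a x t = (\<integral>\<^sup>+r. A (r, t) * indicator {x<..<x+t} r \<partial>lborel)" for x t
  define b where "b x t = (\<integral>\<^sup>+s. B (x, s) * indicator {0<..<t} s \<partial>lborel)" for x t
  define k where "k t = ennreal (1 / t\<^sup>2) * indicator {0<..<1} t" for t :: real
  have am[measurable]: "case_prod a \<in> borel_measurable (borel \<Otimes>\<^sub>M borel)"
  proof -
    \<comment> \<open>The interval depends on the point, so its indicator is written as a condition,
      from which joint measurability follows.\<close>
    have "(\<lambda>p. \<integral>\<^sup>+r. A (r, snd p) * (if fst p < r \<and> r < fst p + snd p then 1 else 0) \<partial>lborel) \<in> borel_measurable (borel \<Otimes>\<^sub>M borel)"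
      by measurable
    moreover have "case_prod a = (\<lambda>p. \<integral>\<^sup>+r. A (r, snd p) * (if fst p < r \<and> r < fst p + snd p then 1 else 0) \<partial>lborel)"
      by (auto simp: a_def fun_eq_iff indicator_def intro!: nn_integral_cong)
    ultimately show ?thesis by simp
  qed
  have bm[measurable]: "case_prod b \<in> borel_measurable (borel \<Otimes>\<^sub>M borel)"
  proof -
    have "(\<lambda>p. \<integral>\<^sup>+s. B (fst p, s) * (if 0 < s \<and> s < snd p then 1 else 0) \<partial>lborel) \<in> borel_measurable (borel \<Otimes>\<^sub>M borel)"
      by measurable
    moreover have "case_prod b = (\<lambda>p. \<integral>\<^sup>+s. B (fst p, s) * (if 0 < s \<and> s < snd p then 1 else 0) \<partial>lborel)"
      by (auto simp: b_def fun_eq_iff indicator_def intro!: nn_integral_cong)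
    ultimately show ?thesis by simp
  qed
  have [measurable]: "k \<in> borel_measurable borel" unfolding k_def by measurable
  have "diff_quot_sq h \<le> (\<integral>\<^sup>+t. 3 * ((\<integral>\<^sup>+x. (a x t)\<^sup>2 \<partial>lborel) * k t + (\<integral>\<^sup>+x. (b x t)\<^sup>2 \<partial>lborel) * k t + (\<integral>\<^sup>+x. (b x t)\<^sup>2 \<partial>lborel) * k t) \<partial>lborel)"
    unfolding diff_quot_sq_def
  proof (rule nn_integral_mono_AE)
    show "AE t in lborel. (\<integral>\<^sup>+x. ennreal ((h (x + t) - h x)\<^sup>2 / t\<^sup>2) \<partial>lborel) * indicator {0<..<1} t \<le>
      3 * ((\<integral>\<^sup>+x. (a x t)\<^sup>2 \<partial>lborel) * k t + (\<integral>\<^sup>+x. (b x t)\<^sup>2 \<partial>lborel) * k t + (\<integral>\<^sup>+x. (b x t)\<^sup>2 \<partial>lborel) * k t)"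
      using h
    proof eventually_elim
      case (elim t)
      show ?case
      proof (cases "0 < t \<and> t < 1")
        case True
        then have k: "k t = ennreal (1 / t\<^sup>2)" by (simp add: k_def)
        have "(\<integral>\<^sup>+x. ennreal ((h (x + t) - h x)\<^sup>2 / t\<^sup>2) \<partial>lborel) \<le>
            (\<integral>\<^sup>+x. 3 * ((a x t)\<^sup>2 + (b (x + t) t)\<^sup>2 + (b x t)\<^sup>2) * k t \<partial>lborel)"
        proof (rule nn_integral_mono_AE)
          have "AE x in lborel. ennreal \<bar>h (x + t) - h x\<bar> \<le> a x t + b (x + t) t + b x t"
            using elim True by (simp add: a_def b_def)
          then show "AE x in lborel. ennreal ((h (x + t) - h x)\<^sup>2 / t\<^sup>2) \<le> 3 * ((a x t)\<^sup>2 + (b (x + t) t)\<^sup>2 + (b x t)\<^sup>2) * k t"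
          proof eventually_elim
            case (elim x)
            have "ennreal ((h (x + t) - h x)\<^sup>2 / t\<^sup>2) = ennreal ((h (x + t) - h x)\<^sup>2 * (1 / t\<^sup>2))" by simp
            also have "\<dots> = ennreal ((h (x + t) - h x)\<^sup>2) * k t"
              unfolding k by (rule ennreal_mult) auto
            also have "\<dots> = (ennreal \<bar>h (x + t) - h x\<bar>)\<^sup>2 * k t"
              by (simp add: ennreal_power)
            also have "\<dots> \<le> (a x t + b (x + t) t + b x t)\<^sup>2 * k t"
              using elim by (intro mult_right_mono power_mono) auto
            also have "\<dots> \<le> 3 * ((a x t)\<^sup>2 + (b (x + t) t)\<^sup>2 + (b x t)\<^sup>2) * k t"
              by (intro mult_right_mono ennreal_power2_sum3) auto
            finally show ?case .
          qed
        qed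
        also have "\<dots> = 3 * ((\<integral>\<^sup>+x. (a x t)\<^sup>2 \<partial>lborel) + (\<integral>\<^sup>+x. (b (x + t) t)\<^sup>2 \<partial>lborel) + (\<integral>\<^sup>+x. (b x t)\<^sup>2 \<partial>lborel)) * k t"
          by (simp add: nn_integral_multc nn_integral_cmult nn_integral_add)
        also have "(\<integral>\<^sup>+x. (b (x + t) t)\<^sup>2 \<partial>lborel) = (\<integral>\<^sup>+x. (b x t)\<^sup>2 \<partial>lborel)"
          by (rule nn_integral_shift) measurable
        finally show ?thesis using True by (simp add: algebra_simps)
      qed simp
    qed
  qed
  also have "\<dots> = 3 * ((\<integral>\<^sup>+t. (\<integral>\<^sup>+x. (a x t)\<^sup>2 \<partial>lborel) * k t \<partial>lborel) +
      (\<integral>\<^sup>+t. (\<integral>\<^sup>+x. (b x t)\<^sup>2 \<partial>lborel) * k t \<partial>lborel) + (\<integral>\<^sup>+t. (\<integral>\<^sup>+x. (b x t)\<^sup>2 \<partial>lborel) * k t \<partial>lborel))"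
    by (simp add: nn_integral_cmult nn_integral_add)
  also have "\<dots> \<le> 3 * ((\<integral>\<^sup>+p. (A p)\<^sup>2 \<partial>lborel) + 4 * (\<integral>\<^sup>+p. (B p)\<^sup>2 \<partial>lborel) + 4 * (\<integral>\<^sup>+p. (B p)\<^sup>2 \<partial>lborel))"
  proof (intro mult_left_mono add_mono)
    \<comment> \<open>One factor \<open>t\<close> comes from Cauchy-Schwarz on a segment of length
      \<open>t\<close>, a second from integrating in x over the segments that contain a given point.
      Together they cancel the weight exactly, at each height separately.\<close>
    show "(\<integral>\<^sup>+t. (\<integral>\<^sup>+x. (a x t)\<^sup>2 \<partial>lborel) * k t \<partial>lborel) \<le> (\<integral>\<^sup>+p. (A p)\<^sup>2 \<partial>lborel)"
    proof -
      have "(\<integral>\<^sup>+x. (a x t)\<^sup>2 \<partial>lborel) * k t \<le> (\<integral>\<^sup>+r. (A (r, t))\<^sup>2 \<partial>lborel)" for t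
      proof (cases "0 < t \<and> t < 1")
        case True
        have "(\<integral>\<^sup>+x. (a x t)\<^sup>2 \<partial>lborel) \<le> (\<integral>\<^sup>+x. ennreal t * (\<integral>\<^sup>+r. (A (r, t))\<^sup>2 * indicator {x<..<x+t} r \<partial>lborel) \<partial>lborel)"
          unfolding a_def using nn_integral_square_le_length[of "\<lambda>r. A (r, t)" x "x + t" for x] True
          by (intro nn_integral_mono) simp
        also have "\<dots> = (\<integral>\<^sup>+x. ennreal t * (\<integral>\<^sup>+r. (A (r, t))\<^sup>2 * (if x < r \<and> r < x + t then 1 else 0) \<partial>lborel) \<partial>lborel)"
          by (intro nn_integral_cong arg_cong2[where f="(*)"] refl) (auto simp: indicator_def)
        also have "\<dots> = ennreal t * (\<integral>\<^sup>+x. (\<integral>\<^sup>+r. (A (r, t))\<^sup>2 * (if x < r \<and> r < x + t then 1 else 0) \<partial>lborel) \<partial>lborel)"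
          by (rule nn_integral_cmult) measurable
        also have "(\<integral>\<^sup>+x. (\<integral>\<^sup>+r. (A (r, t))\<^sup>2 * (if x < r \<and> r < x + t then 1 else 0) \<partial>lborel) \<partial>lborel) =
           (\<integral>\<^sup>+r. (\<integral>\<^sup>+x. (A (r, t))\<^sup>2 * (if x < r \<and> r < x + t then 1 else 0) \<partial>lborel) \<partial>lborel)"
          by (rule lborel_pair.Fubini') measurable
        also have "\<dots> = (\<integral>\<^sup>+r. (A (r, t))\<^sup>2 * ennreal t \<partial>lborel)"
        proof (rule nn_integral_cong)
          fix r
          have "(\<integral>\<^sup>+x. (A (r, t))\<^sup>2 * (if x < r \<and> r < x + t then 1 else 0) \<partial>lborel) = 
             (\<integral>\<^sup>+x. (A (r, t))\<^sup>2 * indicator {r-t<..<r} x \<partial>lborel)"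
            by (intro nn_integral_cong) (auto simp: indicator_def)
          also have "\<dots> = (A (r, t))\<^sup>2 * ennreal t" using True by (subst nn_integral_cmult) auto
          finally show "(\<integral>\<^sup>+x. (A (r, t))\<^sup>2 * (if x < r \<and> r < x + t then 1 else 0) \<partial>lborel) = (A (r, t))\<^sup>2 * ennreal t" .
        qed
        also have "\<dots> = (\<integral>\<^sup>+r. (A (r, t))\<^sup>2 \<partial>lborel) * ennreal t" by (rule nn_integral_multc) measurable
        finally have "(\<integral>\<^sup>+x. (a x t)\<^sup>2 \<partial>lborel) * k t \<le> ennreal t * ((\<integral>\<^sup>+r. (A (r, t))\<^sup>2 \<partial>lborel) * ennreal t) * k t"
          by (rule mult_right_mono) simp
        also have "\<dots> = (\<integral>\<^sup>+r. (A (r, t))\<^sup>2 \<partial>lborel) * (ennreal t * ennreal t * k t)" by (simp add: ac_simps)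
        also have "ennreal t * ennreal t * k t = 1"
          using True by (simp add: k_def ennreal_mult[symmetric] power2_eq_square)
        finally show ?thesis by simp
      qed (simp add: k_def)
      then have "(\<integral>\<^sup>+t. (\<integral>\<^sup>+x. (a x t)\<^sup>2 \<partial>lborel) * k t \<partial>lborel) \<le> (\<integral>\<^sup>+t. (\<integral>\<^sup>+r. (A (r, t))\<^sup>2 \<partial>lborel) \<partial>lborel)"
        by (intro nn_integral_mono)
      also have "\<dots> = (\<integral>\<^sup>+p. (A p)\<^sup>2 \<partial>lborel)" by (rule plane_nn_integral(2)) measurable
      finally show ?thesis .
    qed
    \<comment> \<open>For fixed x this is Hardy's inequality in t. The vertical piece at
      \<open>x + t\<close> costs the same by translation, hence 8 = 4 + 4.\<close>
    show "(\<integral>\<^sup>+t. (\<integral>\<^sup>+x. (b x t)\<^sup>2 \<partial>lborel) * k t \<partial>lborel) \<le> 4 * (\<integral>\<^sup>+p. (B p)\<^sup>2 \<partial>lborel)"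
    proof -
      have "(\<integral>\<^sup>+t. (\<integral>\<^sup>+x. (b x t)\<^sup>2 \<partial>lborel) * k t \<partial>lborel) = (\<integral>\<^sup>+t. (\<integral>\<^sup>+x. (b x t)\<^sup>2 * k t \<partial>lborel) \<partial>lborel)"
        by (intro nn_integral_cong nn_integral_multc[symmetric]) measurable
      also have "\<dots> = (\<integral>\<^sup>+x. (\<integral>\<^sup>+t. (b x t)\<^sup>2 * k t \<partial>lborel) \<partial>lborel)"
        by (rule lborel_pair.Fubini') measurable
      also have "\<dots> \<le> (\<integral>\<^sup>+x. 4 * (\<integral>\<^sup>+s. (B (x, s))\<^sup>2 \<partial>lborel) \<partial>lborel)"
      proof (rule nn_integral_mono)
        fix x
        have "(\<integral>\<^sup>+t. (b x t)\<^sup>2 * k t \<partial>lborel) \<le> (\<integral>\<^sup>+t. (b x t)\<^sup>2 * ennreal (1 / t\<^sup>2) * indicator {0<..} t \<partial>lborel)"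
          by (intro nn_integral_mono) (auto simp: k_def indicator_def)
        also have "\<dots> \<le> 4 * (\<integral>\<^sup>+s. (B (x, s))\<^sup>2 \<partial>lborel)"
          unfolding b_def by (rule hardy_inequality) measurable
        finally show "(\<integral>\<^sup>+t. (b x t)\<^sup>2 * k t \<partial>lborel) \<le> 4 * (\<integral>\<^sup>+s. (B (x, s))\<^sup>2 \<partial>lborel)" .
      qed
      also have "\<dots> = 4 * (\<integral>\<^sup>+x. (\<integral>\<^sup>+s. (B (x, s))\<^sup>2 \<partial>lborel) \<partial>lborel)" by (rule nn_integral_cmult) measurable
      also have "(\<integral>\<^sup>+x. (\<integral>\<^sup>+s. (B (x, s))\<^sup>2 \<partial>lborel) \<partial>lborel) = (\<integral>\<^sup>+p. (B p)\<^sup>2 \<partial>lborel)"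
        by (rule plane_nn_integral(1)) measurable
      finally show ?thesis .
    qed
    then show "(\<integral>\<^sup>+t. (\<integral>\<^sup>+x. (b x t)\<^sup>2 \<partial>lborel) * k t \<partial>lborel) \<le> 4 * (\<integral>\<^sup>+p. (B p)\<^sup>2 \<partial>lborel)" .
  qed auto
  also have "\<dots> = 3 * ((\<integral>\<^sup>+p. (A p)\<^sup>2 \<partial>lborel) + 8 * (\<integral>\<^sup>+p. (B p)\<^sup>2 \<partial>lborel))"
  proof -
    have "4 * X + 4 * X = 8 * X" for X :: ennreal by (simp add: distrib_right[symmetric])
    then show ?thesis by (simp add: add.assoc)
  qed
  finally show ?thesis .
qed

text \<open>For fixed s substitute \<tau> = s t. Replacing the denominator \<open>t\<close> by the
  true displacement costs s squared and the substitution returns 1 / s, so the total factor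
  \<open>s\<close> is at most 1; moreover \<tau> stays below 1. It remains to integrate over s in
  the unit interval.\<close>

lemma averaged_difference_quotients_le_diff_quot_sq:
  assumes [measurable]: "f \<in> borel_measurable borel"
  shows "(\<integral>\<^sup>+t. (\<integral>\<^sup>+x. (\<integral>\<^sup>+s. ennreal ((f (x + s * t) - f x)\<^sup>2 / t\<^sup>2) * indicator {0<..<1} s \<partial>lborel) \<partial>lborel) * indicator {0<..<1} t \<partial>lborel)
     \<le> diff_quot_sq f"
proof -
  define v where "v \<tau> = (\<integral>\<^sup>+x. ennreal ((f (x + \<tau>) - f x)\<^sup>2 / \<tau>\<^sup>2) \<partial>lborel)" for \<tau>
  have vm[measurable]: "v \<in> borel_measurable borel"
  proof -
    have "(\<lambda>\<tau>. (\<integral>\<^sup>+x. ennreal ((f (x + \<tau>) - f x)\<^sup>2 / \<tau>\<^sup>2) \<partial>lborel)) \<in> borel_measurable borel" by measurable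
    then show ?thesis by (simp add: v_def[abs_def])
  qed
  have "(\<integral>\<^sup>+t. (\<integral>\<^sup>+x. (\<integral>\<^sup>+s. ennreal ((f (x + s * t) - f x)\<^sup>2 / t\<^sup>2) * indicator {0<..<1} s \<partial>lborel) \<partial>lborel) * indicator {0<..<1} t \<partial>lborel)
     = (\<integral>\<^sup>+t. (\<integral>\<^sup>+s. (\<integral>\<^sup>+x. ennreal ((f (x + s * t) - f x)\<^sup>2 / t\<^sup>2) * indicator {0<..<1} s \<partial>lborel) \<partial>lborel) * indicator {0<..<1} t \<partial>lborel)"
    by (intro nn_integral_cong arg_cong2[where f="(*)"] refl lborel_pair.Fubini') measurable
  also have "\<dots> = (\<integral>\<^sup>+t. (\<integral>\<^sup>+s. (\<integral>\<^sup>+x. ennreal ((f (x + s * t) - f x)\<^sup>2 / t\<^sup>2) * indicator {0<..<1} s \<partial>lborel) * indicator {0<..<1} t \<partial>lborel) \<partial>lborel)"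
    by (intro nn_integral_cong nn_integral_multc[symmetric]) measurable
  also have "\<dots> = (\<integral>\<^sup>+s. (\<integral>\<^sup>+t. (\<integral>\<^sup>+x. ennreal ((f (x + s * t) - f x)\<^sup>2 / t\<^sup>2) * indicator {0<..<1} s \<partial>lborel) * indicator {0<..<1} t \<partial>lborel) \<partial>lborel)"
    by (rule lborel_pair.Fubini') measurable
  also have "\<dots> \<le> (\<integral>\<^sup>+s. diff_quot_sq f * indicator {0<..<1::real} s \<partial>lborel)"
  proof (rule nn_integral_mono)
    fix s :: real
    show "(\<integral>\<^sup>+t. (\<integral>\<^sup>+x. ennreal ((f (x + s * t) - f x)\<^sup>2 / t\<^sup>2) * indicator {0<..<1} s \<partial>lborel) * indicator {0<..<1} t \<partial>lborel) \<le> diff_quot_sq f * indicator {0<..<1} s"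
    proof (cases "0 < s \<and> s < 1")
      case True
      have "(\<integral>\<^sup>+t. (\<integral>\<^sup>+x. ennreal ((f (x + s * t) - f x)\<^sup>2 / t\<^sup>2) * indicator {0<..<1} s \<partial>lborel) * indicator {0<..<1} t \<partial>lborel)
        \<le> (\<integral>\<^sup>+t. ennreal (s\<^sup>2) * (v (s * t) * indicator {0<..<1} (s * t)) \<partial>lborel)"
      proof (rule nn_integral_mono)
        fix t :: real
        have "(\<integral>\<^sup>+x. ennreal ((f (x + s * t) - f x)\<^sup>2 / t\<^sup>2) \<partial>lborel) = (\<integral>\<^sup>+x. ennreal (s\<^sup>2) * ennreal ((f (x + s * t) - f x)\<^sup>2 / (s * t)\<^sup>2) \<partial>lborel)"
          using True by (intro nn_integral_cong) (auto simp: ennreal_mult[symmetric] power_mult_distrib)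
        also have "\<dots> = ennreal (s\<^sup>2) * v (s * t)" unfolding v_def by (rule nn_integral_cmult) measurable
        finally have e: "(\<integral>\<^sup>+x. ennreal ((f (x + s * t) - f x)\<^sup>2 / t\<^sup>2) \<partial>lborel) = ennreal (s\<^sup>2) * v (s * t)" .
        have "s * t < 1" if "0 < t" "t < 1" using mult_strict_mono[of s 1 t 1] True that by simp
        then show "(\<integral>\<^sup>+x. ennreal ((f (x + s * t) - f x)\<^sup>2 / t\<^sup>2) * indicator {0<..<1} s \<partial>lborel) * indicator {0<..<1} t
           \<le> ennreal (s\<^sup>2) * (v (s * t) * indicator {0<..<1} (s * t))"
          using True e by (auto simp: indicator_def)
      qed
      also have "\<dots> = ennreal (s\<^sup>2) * (\<integral>\<^sup>+t. (v (s * t) * indicator {0<..<1} (s * t)) \<partial>lborel)"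
        by (rule nn_integral_cmult) measurable
      also have "(\<integral>\<^sup>+t. (v (s * t) * indicator {0<..<1} (s * t)) \<partial>lborel) = ennreal (1 / s) * diff_quot_sq f"
        unfolding diff_quot_sq_def v_def[symmetric] using True
        by (subst nn_integral_scale[of "\<lambda>t. v t * indicator {0<..<1} t"]) auto
      also have "ennreal (s\<^sup>2) * (ennreal (1 / s) * diff_quot_sq f) = ennreal s * diff_quot_sq f"
        using True by (simp add: mult.assoc[symmetric] ennreal_mult[symmetric] power2_eq_square)
      also have "\<dots> \<le> 1 * diff_quot_sq f" using True by (intro mult_right_mono) auto
      finally show ?thesis using True by simp
    qed simp
  qed
  also have "\<dots> = diff_quot_sq f" by (subst nn_integral_cmult) auto
  finally show ?thesis .
qed

text \<open>A finite seminorm makes the inner integral finite at almost every point, hence at some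
  \<open>x\<close> in any given unit interval. There \<open>f\<close> differs from the constant
  \<open>f x\<close> by a square integrable function, and finitely many unit intervals cover
  \<open>{a..b}\<close>.\<close>

lemma Ht_finite_imp_L2_loc:
  assumes [measurable]: "f \<in> borel_measurable borel" and fin: "Ht_norm_sq f < \<infinity>"
  shows "(\<integral>\<^sup>+x. ennreal ((f x)\<^sup>2) * indicator {a..b} x \<partial>lborel) < \<infinity>"
proof -
  have "AE x in lborel. (\<integral>\<^sup>+y. ennreal ((f x - f y)\<^sup>2 / (x - y)\<^sup>2) * indicator {..1} \<bar>x - y\<bar> \<partial>lborel) \<noteq> \<infinity>"
    using fin unfolding Ht_norm_sq_def by (intro nn_integral_PInf_AE) auto
  then have ae: "AE x in lborel. x \<notin> {x. (\<integral>\<^sup>+y. ennreal ((f x - f y)\<^sup>2 / (x - y)\<^sup>2) * indicator {..1} \<bar>x - y\<bar> \<partial>lborel) = \<infinity>}"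
    by simp
  have loc: "(\<integral>\<^sup>+y. ennreal ((f y)\<^sup>2) * indicator {c..c+1} y \<partial>lborel) < \<infinity>" for c
  proof -
    have "\<exists>x\<in>{c..c+1}. (\<integral>\<^sup>+y. ennreal ((f x - f y)\<^sup>2 / (x - y)\<^sup>2) * indicator {..1} \<bar>x - y\<bar> \<partial>lborel) \<noteq> \<infinity>"
    proof (rule ccontr)
      assume *: "\<not> ?thesis"
      have "AE x in lborel. x \<notin> {c..c+1}" using ae by eventually_elim (use * in auto)
      then have "{c..c+1} \<in> null_sets lborel" by (subst (asm) AE_iff_null_sets[symmetric]) auto
      then show False by (auto simp: null_sets_def)
    qed
    then obtain x where x: "c \<le> x" "x \<le> c + 1" 
      "(\<integral>\<^sup>+y. ennreal ((f x - f y)\<^sup>2 / (x - y)\<^sup>2) * indicator {..1} \<bar>x - y\<bar> \<partial>lborel) \<noteq> \<infinity>" by auto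
    have "(\<integral>\<^sup>+y. ennreal ((f y)\<^sup>2) * indicator {c..c+1} y \<partial>lborel) \<le>
      (\<integral>\<^sup>+y. ennreal (2 * (f x)\<^sup>2) * indicator {c..c+1} y + 2 * (ennreal ((f x - f y)\<^sup>2 / (x - y)\<^sup>2) * indicator {..1} \<bar>x - y\<bar>) \<partial>lborel)"
    proof (rule nn_integral_mono)
      fix y
      show "ennreal ((f y)\<^sup>2) * indicator {c..c+1} y \<le> ennreal (2 * (f x)\<^sup>2) * indicator {c..c+1} y + 2 * (ennreal ((f x - f y)\<^sup>2 / (x - y)\<^sup>2) * indicator {..1} \<bar>x - y\<bar>)"
      proof (cases "y \<in> {c..c+1}")
        case True
        then have xy: "\<bar>x - y\<bar> \<le> 1" using x by auto
        \<comment> \<open>Distances are at most 1, so dividing only enlarges; for x = y both sides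
          are 0.\<close>
        have "(f x - f y)\<^sup>2 \<le> (f x - f y)\<^sup>2 / (x - y)\<^sup>2"
        proof (cases "x = y")
          case False
          then have "0 < (x - y)\<^sup>2" "(x - y)\<^sup>2 \<le> 1" using xy by (auto simp: abs_square_le_1)
          then show ?thesis by (simp add: pos_le_divide_eq mult_left_le)
        qed simp
        moreover have "(f y)\<^sup>2 \<le> 2 * (f x)\<^sup>2 + 2 * (f x - f y)\<^sup>2"
          using zero_le_power2[of "2 * f x - f y"] by (simp add: power2_eq_square algebra_simps)
        ultimately have "(f y)\<^sup>2 \<le> 2 * (f x)\<^sup>2 + 2 * ((f x - f y)\<^sup>2 / (x - y)\<^sup>2)" by linarith
        then have "ennreal ((f y)\<^sup>2) \<le> ennreal (2 * (f x)\<^sup>2 + 2 * ((f x - f y)\<^sup>2 / (x - y)\<^sup>2))" by (rule ennreal_leI)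
        also have "\<dots> = ennreal (2 * (f x)\<^sup>2) + ennreal (2 * ((f x - f y)\<^sup>2 / (x - y)\<^sup>2))" by (rule ennreal_plus) auto
        also have "ennreal (2 * ((f x - f y)\<^sup>2 / (x - y)\<^sup>2)) = 2 * ennreal ((f x - f y)\<^sup>2 / (x - y)\<^sup>2)"
          by (subst ennreal_mult) auto
        finally show ?thesis using True xy by (simp add: indicator_def)
      qed simp
    qed
    also have "\<dots> = ennreal (2 * (f x)\<^sup>2) + 2 * (\<integral>\<^sup>+y. ennreal ((f x - f y)\<^sup>2 / (x - y)\<^sup>2) * indicator {..1} \<bar>x - y\<bar> \<partial>lborel)"
      by (subst nn_integral_add) (auto simp: nn_integral_cmult)
    also have "\<dots> < \<infinity>" using x(3) by (auto simp: ennreal_mult_less_top less_top)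
    finally show ?thesis .
  qed
  have "(\<integral>\<^sup>+y. ennreal ((f y)\<^sup>2) * indicator {a..a + real n} y \<partial>lborel) < \<infinity>" for n :: nat
  proof (induction n)
    case 0
    have "(\<integral>\<^sup>+y. ennreal ((f y)\<^sup>2) * indicator {a..a} y \<partial>lborel) \<le> (\<integral>\<^sup>+y. ennreal ((f y)\<^sup>2) * indicator {a..a+1} y \<partial>lborel)"
      by (intro nn_integral_mono) (auto simp: indicator_def)
    with loc[of a] show ?case by (auto intro: le_less_trans)
  next
    case (Suc n)
    have "(\<integral>\<^sup>+y. ennreal ((f y)\<^sup>2) * indicator {a..a + real (Suc n)} y \<partial>lborel) \<le>
      (\<integral>\<^sup>+y. ennreal ((f y)\<^sup>2) * indicator {a..a + real n} y + ennreal ((f y)\<^sup>2) * indicator {a + real n..a + real n + 1} y \<partial>lborel)"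
      by (intro nn_integral_mono) (auto simp: indicator_def)
    also have "\<dots> = (\<integral>\<^sup>+y. ennreal ((f y)\<^sup>2) * indicator {a..a + real n} y \<partial>lborel) + (\<integral>\<^sup>+y. ennreal ((f y)\<^sup>2) * indicator {a + real n..a + real n + 1} y \<partial>lborel)"
      by (rule nn_integral_add) measurable
    also have "\<dots> < \<infinity>" using Suc loc[of "a + real n"] by simp
    finally show ?case .
  qed
  moreover obtain n where "b - a \<le> real n" using real_arch_simple by blast
  then have "(\<integral>\<^sup>+x. ennreal ((f x)\<^sup>2) * indicator {a..b} x \<partial>lborel) \<le> (\<integral>\<^sup>+y. ennreal ((f y)\<^sup>2) * indicator {a..a + real n} y \<partial>lborel)"
    by (intro nn_integral_mono) (auto simp: indicator_def)
  ultimately show ?thesis by (auto intro: le_less_trans)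
qed

section \<open>Traces on the two edges\<close>

lemma strip_eq: "strip = UNIV \<times> {0<..<pi}"
  by (auto simp: strip_def)

lemma open_strip: "open strip"
  unfolding strip_eq by (intro open_Times) auto

lemma strip_borel [measurable]: "strip \<in> sets borel"
  by (rule borel_open[OF open_strip])

lemma AE_affine:
  assumes "AE y in (lborel :: real measure). Q y" "c \<noteq> 0"
  shows "AE t in lborel. Q (e + c * t)"
proof -
  obtain N where N: "N \<in> sets lborel" "emeasure lborel N = 0" "{x. \<not> Q x} \<subseteq> N"
    using AE_E[OF assms(1)] by auto
  have "AE x in (lborel :: real measure). x \<notin> N" using N by (intro AE_not_in) auto
  moreover have [measurable]: "N \<in> sets borel" using N(1) by simp
  ultimately have "AE t in lborel. e + c * t \<notin> N"
    using assms(2) by (intro AE_borel_affine[where P="\<lambda>x. x \<notin> N"]) auto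
  then show ?thesis by eventually_elim (use N(3) in blast)
qed

lemma nn_integral_affine_unit:
  fixes f :: "real \<Rightarrow> ennreal"
  assumes "f \<in> borel_measurable borel" "\<bar>c\<bar> = 1"
  shows "(\<integral>\<^sup>+t. f (e + c * t) \<partial>lborel) = (\<integral>\<^sup>+t. f t \<partial>lborel)"
  using nn_integral_real_affine[OF assms(1), of c e] assms(2) by auto

lemma indefinite_integral_diff_le:
  fixes g :: "real \<Rightarrow> real"
  assumes g: "integrable lborel g" and ab: "a \<le> b"
  shows "ennreal \<bar>(\<integral>r. (if r \<le> b then g r else 0) \<partial>lborel) - (\<integral>r. (if r \<le> a then g r else 0) \<partial>lborel)\<bar>
     \<le> (\<integral>\<^sup>+r. ennreal \<bar>g r\<bar> * indicator {a<..<b} r \<partial>lborel)"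
proof -
  have [measurable]: "g \<in> borel_measurable borel" using g by simp
  have i: "integrable lborel (\<lambda>r. if r \<le> x then g r else 0)" for x
    by (rule Bochner_Integration.integrable_bound[OF g]) auto
  have "(\<integral>r. (if r \<le> b then g r else 0) \<partial>lborel) - (\<integral>r. (if r \<le> a then g r else 0) \<partial>lborel)
     = (\<integral>r. (if r \<le> b then g r else 0) - (if r \<le> a then g r else 0) \<partial>lborel)"
    by (rule Bochner_Integration.integral_diff[OF i i, symmetric])
  also have "ennreal \<bar>\<dots>\<bar> \<le> (\<integral>\<^sup>+r. ennreal \<bar>(if r \<le> b then g r else 0) - (if r \<le> a then g r else 0)\<bar> \<partial>lborel)"
    using integral_norm_bound_ennreal[OF Bochner_Integration.integrable_diff[OF i i]] by simp
  also have "\<dots> = (\<integral>\<^sup>+r. ennreal \<bar>g r\<bar> * indicator {a<..<b} r \<partial>lborel)"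
    using AE_lborel_singleton[of b] by (intro nn_integral_cong_AE, eventually_elim) (use ab in \<open>auto simp: indicator_def\<close>)
  finally show ?thesis .
qed

text \<open>
  A pair \<open>(c, e)\<close> encodes the edge \<open>y = e\<close> of the strip: the distance of \<open>(x, y)\<close> to it is \<open>c (y - e)\<close>.
\<close>

definition is_edge :: "real \<Rightarrow> real \<Rightarrow> bool" where
  "is_edge c e \<longleftrightarrow> c = 1 \<and> e = 0 \<or> c = - 1 \<and> e = pi"

definition trace_at :: "real \<Rightarrow> real \<Rightarrow> (real \<times> real \<Rightarrow> real) \<Rightarrow> (real \<Rightarrow> real) \<Rightarrow> bool" where
  "trace_at c e F f \<longleftrightarrow> f \<in> borel_measurable lborel \<and>
     (\<forall>a b. ((\<lambda>h. ennreal (1 / h) *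
        (\<integral>\<^sup>+ p. ennreal ((F p - f (fst p))\<^sup>2) * indicator ({a..b} \<times> {y. 0 < c * (y - e) \<and> c * (y - e) < h}) p \<partial>lborel))
        \<longlongrightarrow> 0) (at_right 0))"

lemma is_trace0_iff: "is_trace0 F f \<longleftrightarrow> trace_at 1 0 F f"
proof -
  have "{y. 0 < 1 * (y - 0) \<and> 1 * (y - 0) < h} = {0<..<h}" for h :: real by auto
  then show ?thesis unfolding is_trace0_def trace_at_def by (simp only:)
qed

lemma is_trace1_iff: "is_trace1 F f \<longleftrightarrow> trace_at (- 1) pi F f"
proof -
  have "{y. 0 < - 1 * (y - pi) \<and> - 1 * (y - pi) < h} = {pi - h<..<pi}" for h :: real by auto
  then show ?thesis unfolding is_trace1_def trace_at_def by (simp only:)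
qed

lemma edge_layer:
  assumes "is_edge c e" "h \<le> pi"
  shows "{y. 0 < c * (y - e) \<and> c * (y - e) < h} \<subseteq> {0<..<pi}"
    and "0 \<le> h \<Longrightarrow> emeasure lborel {y. 0 < c * (y - e) \<and> c * (y - e) < h} = ennreal h"
    and "{y. 0 < c * (y - e) \<and> c * (y - e) < h} \<in> sets borel"
proof -
  have "{y. 0 < c * (y - e) \<and> c * (y - e) < h} = (if c = 1 then {0<..<h} else {pi - h<..<pi})"
    using assms by (auto simp: is_edge_def)
  then show "{y. 0 < c * (y - e) \<and> c * (y - e) < h} \<subseteq> {0<..<pi}"
    and "0 \<le> h \<Longrightarrow> emeasure lborel {y. 0 < c * (y - e) \<and> c * (y - e) < h} = ennreal h"
    and "{y. 0 < c * (y - e) \<and> c * (y - e) < h} \<in> sets borel"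
    using assms(2) by auto
qed

text \<open>In the layer of width \<open>h\<close> the weight is at least 1 over h squared, so the
  mean over the layer is at most \<open>h\<close> times the weighted integral over the strip.
  \<open>F0\<close> is a Borel function representing \<open>F\<close> there, as \<open>F\<close>
  itself may be wild outside.\<close>

lemma trace_atI:
  assumes edge: "is_edge c e" and [measurable]: "f \<in> borel_measurable borel"
    and F0[measurable]: "F0 \<in> borel_measurable borel" "\<And>p. p \<in> strip \<Longrightarrow> F0 p = F p"
    and D: "(\<integral>\<^sup>+p. ennreal ((F p - f (fst p))\<^sup>2 / (c * (snd p - e))\<^sup>2) * indicator strip p \<partial>lborel) < \<infinity>" (is "?D < _")
  shows "trace_at c e F f"
  unfolding trace_at_def
proof (intro conjI allI)
  show "f \<in> borel_measurable lborel" by simp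
  fix a b :: real
  have "((\<lambda>h. ennreal h * ?D) \<longlongrightarrow> ennreal 0 * ?D) (at_right 0)"
    using D by (intro tendsto_mult_ennreal tendsto_ennrealI tendsto_ident_at tendsto_const) auto
  then have lim: "((\<lambda>h. ennreal h * ?D) \<longlongrightarrow> 0) (at_right 0)" by simp
  show "((\<lambda>h. ennreal (1 / h) *
        (\<integral>\<^sup>+ p. ennreal ((F p - f (fst p))\<^sup>2) * indicator ({a..b} \<times> {y. 0 < c * (y - e) \<and> c * (y - e) < h}) p \<partial>lborel))
        \<longlongrightarrow> 0) (at_right 0)"
  proof (rule tendsto_sandwich[OF _ _ tendsto_const lim])
    show "\<forall>\<^sub>F h in at_right 0. ennreal (1 / h) *
        (\<integral>\<^sup>+ p. ennreal ((F p - f (fst p))\<^sup>2) * indicator ({a..b} \<times> {y. 0 < c * (y - e) \<and> c * (y - e) < h}) p \<partial>lborel)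
        \<le> ennreal h * ?D"
      using eventually_at_right_less[of 0] eventually_at_right_real[OF pi_gt_zero]
    proof eventually_elim
      case (elim h)
      have "(\<integral>\<^sup>+ p. ennreal ((F p - f (fst p))\<^sup>2) * indicator ({a..b} \<times> {y. 0 < c * (y - e) \<and> c * (y - e) < h}) p \<partial>lborel)
         \<le> (\<integral>\<^sup>+p. ennreal (h\<^sup>2) * (ennreal ((F p - f (fst p))\<^sup>2 / (c * (snd p - e))\<^sup>2) * indicator strip p) \<partial>lborel)"
      proof (rule nn_integral_mono)
        fix p :: "real \<times> real"
        show "ennreal ((F p - f (fst p))\<^sup>2) * indicator ({a..b} \<times> {y. 0 < c * (y - e) \<and> c * (y - e) < h}) p
          \<le> ennreal (h\<^sup>2) * (ennreal ((F p - f (fst p))\<^sup>2 / (c * (snd p - e))\<^sup>2) * indicator strip p)"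
        proof (cases "p \<in> {a..b} \<times> {y. 0 < c * (y - e) \<and> c * (y - e) < h}")
          case True
          then have d: "0 < c * (snd p - e)" "c * (snd p - e) < h" by auto
          then have "(c * (snd p - e))\<^sup>2 \<le> h\<^sup>2" by (intro power_mono) auto
          then have "(F p - f (fst p))\<^sup>2 * (c * (snd p - e))\<^sup>2 \<le> (F p - f (fst p))\<^sup>2 * h\<^sup>2"
            by (rule mult_left_mono) simp
          then have "(F p - f (fst p))\<^sup>2 \<le> h\<^sup>2 * ((F p - f (fst p))\<^sup>2 / (c * (snd p - e))\<^sup>2)"
            using zero_less_power[OF d(1), of 2] by (simp add: pos_le_divide_eq mult.commute)
          then have "ennreal ((F p - f (fst p))\<^sup>2) \<le> ennreal (h\<^sup>2 * ((F p - f (fst p))\<^sup>2 / (c * (snd p - e))\<^sup>2))"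
            by (rule ennreal_leI)
          also have "\<dots> = ennreal (h\<^sup>2) * ennreal ((F p - f (fst p))\<^sup>2 / (c * (snd p - e))\<^sup>2)"
            by (rule ennreal_mult) auto
          finally have "ennreal ((F p - f (fst p))\<^sup>2) \<le> ennreal (h\<^sup>2) * ennreal ((F p - f (fst p))\<^sup>2 / (c * (snd p - e))\<^sup>2)" .
          moreover have "p \<in> strip" using True edge_layer(1)[OF edge, of h] elim by (auto simp: strip_eq)
          ultimately show ?thesis using True by simp
        qed simp
      qed
      also have "\<dots> = (\<integral>\<^sup>+p. ennreal (h\<^sup>2) * (ennreal ((F0 p - f (fst p))\<^sup>2 / (c * (snd p - e))\<^sup>2) * indicator strip p) \<partial>lborel)"
        by (intro nn_integral_cong) (auto simp: indicator_def F0(2))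
      also have "\<dots> = ennreal (h\<^sup>2) * (\<integral>\<^sup>+p. ennreal ((F0 p - f (fst p))\<^sup>2 / (c * (snd p - e))\<^sup>2) * indicator strip p \<partial>lborel)"
        by (rule nn_integral_cmult) measurable
      also have "(\<integral>\<^sup>+p. ennreal ((F0 p - f (fst p))\<^sup>2 / (c * (snd p - e))\<^sup>2) * indicator strip p \<partial>lborel) = ?D"
        by (intro nn_integral_cong) (auto simp: indicator_def F0(2))
      finally have "ennreal (1 / h) * (\<integral>\<^sup>+ p. ennreal ((F p - f (fst p))\<^sup>2) * indicator ({a..b} \<times> {y. 0 < c * (y - e) \<and> c * (y - e) < h}) p \<partial>lborel)
        \<le> ennreal (1 / h) * (ennreal (h\<^sup>2) * ?D)"
        by (rule mult_left_mono) simp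
      also have "\<dots> = ennreal h * ?D"
        using elim by (simp add: mult.assoc[symmetric] ennreal_mult[symmetric] power2_eq_square)
      finally show ?case .
    qed
  qed simp
qed

text \<open>The square of \<open>f - f'\<close> does not depend on the height, so its average over a
  layer is its integral \<open>I a b\<close>, whatever the width. Comparing both functions with
  \<open>F\<close> bounds it by quantities that tend to 0.\<close>

lemma trace_at_unique:
  assumes edge: "is_edge c e" and f: "trace_at c e F f" and f': "trace_at c e F f'"
    and F0[measurable]: "F0 \<in> borel_measurable borel" "\<And>p. p \<in> strip \<Longrightarrow> F0 p = F p"
  shows "AE x in lborel. f x = f' x"
proof -
  have [measurable]: "f \<in> borel_measurable borel" "f' \<in> borel_measurable borel"
    using f f' by (auto simp: trace_at_def)
  define L where "L h = {y. 0 < c * (y - e) \<and> c * (y - e) < h}" for h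
  define I where "I a b = (\<integral>\<^sup>+x. ennreal ((f x - f' x)\<^sup>2) * indicator {a..b} x \<partial>lborel)" for a b
  have zero: "I a b = 0" for a b
  proof -
    define \<phi> where "\<phi> f h = ennreal (1 / h) * (\<integral>\<^sup>+ p. ennreal ((F p - f (fst p))\<^sup>2) * indicator ({a..b} \<times> L h) p \<partial>lborel)" for f h
    have "(\<phi> f \<longlongrightarrow> 0) (at_right 0)" "(\<phi> f' \<longlongrightarrow> 0) (at_right 0)"
      using f f' by (auto simp: trace_at_def \<phi>_def[abs_def] L_def[abs_def])
    then have "((\<lambda>h. 2 * (\<phi> f h + \<phi> f' h)) \<longlongrightarrow> 2 * (0 + 0)) (at_right 0)"
      by (intro tendsto_mult_ennreal tendsto_add tendsto_const) auto
    then have lim: "((\<lambda>h. 2 * (\<phi> f h + \<phi> f' h)) \<longlongrightarrow> 0) (at_right 0)" by simp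
    have "I a b \<le> 0"
    proof (rule tendsto_lowerbound[OF lim])
      show "\<forall>\<^sub>F h in at_right 0. I a b \<le> 2 * (\<phi> f h + \<phi> f' h)"
        using eventually_at_right_less[of 0] eventually_at_right_real[OF pi_gt_zero]
      proof eventually_elim
        case (elim h)
        then have [measurable]: "L h \<in> sets borel" using edge_layer(3)[OF edge, of h] by (simp add: L_def)
        have Ls: "L h \<subseteq> {0<..<pi}" "emeasure lborel (L h) = ennreal h"
          using edge_layer(1,2)[OF edge, of h] elim by (auto simp: L_def)
        have ind: "indicator ({a..b} \<times> L h) p = indicator {a..b} (fst p) * (indicator (L h) (snd p) :: ennreal)" for p
          by (cases p) (auto simp: indicator_def)
        have FF: "(\<integral>\<^sup>+ p. ennreal ((F p - g (fst p))\<^sup>2) * indicator ({a..b} \<times> L h) p \<partial>lborel) =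
          (\<integral>\<^sup>+ p. ennreal ((F0 p - g (fst p))\<^sup>2) * (indicator {a..b} (fst p) * indicator (L h) (snd p)) \<partial>lborel)" for g
          using F0(2) Ls(1) by (intro nn_integral_cong) (force simp: indicator_def strip_eq)
        have "I a b * ennreal h = (\<integral>\<^sup>+x. ennreal ((f x - f' x)\<^sup>2) * indicator {a..b} x * ennreal h \<partial>lborel)"
          unfolding I_def by (rule nn_integral_multc[symmetric]) measurable
        also have "\<dots> = (\<integral>\<^sup>+x. \<integral>\<^sup>+y. ennreal ((f x - f' x)\<^sup>2) * indicator {a..b} x * indicator (L h) y \<partial>lborel \<partial>lborel)"
          using Ls(2) by (intro nn_integral_cong) (simp add: nn_integral_cmult)
        also have "\<dots> = (\<integral>\<^sup>+p. ennreal ((f (fst p) - f' (fst p))\<^sup>2) * indicator {a..b} (fst p) * indicator (L h) (snd p) \<partial>lborel)"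
          using plane_nn_integral(1)[of "\<lambda>p. ennreal ((f (fst p) - f' (fst p))\<^sup>2) * indicator {a..b} (fst p) * indicator (L h) (snd p)"]
          by simp
        also have "\<dots> \<le> (\<integral>\<^sup>+p. 2 * (ennreal ((F0 p - f (fst p))\<^sup>2) * (indicator {a..b} (fst p) * indicator (L h) (snd p)) +
            ennreal ((F0 p - f' (fst p))\<^sup>2) * (indicator {a..b} (fst p) * indicator (L h) (snd p))) \<partial>lborel)"
        proof (rule nn_integral_mono)
          fix p :: "real \<times> real"
          have "(f (fst p) - f' (fst p))\<^sup>2 \<le> 2 * ((F0 p - f (fst p))\<^sup>2 + (F0 p - f' (fst p))\<^sup>2)"
            using zero_le_power2[of "(F0 p - f (fst p)) + (F0 p - f' (fst p))"] by (simp add: power2_eq_square algebra_simps)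
          then have "ennreal ((f (fst p) - f' (fst p))\<^sup>2) \<le> ennreal (2 * ((F0 p - f (fst p))\<^sup>2 + (F0 p - f' (fst p))\<^sup>2))"
            by (rule ennreal_leI)
          also have "\<dots> = 2 * (ennreal ((F0 p - f (fst p))\<^sup>2) + ennreal ((F0 p - f' (fst p))\<^sup>2))"
            by (subst ennreal_mult) auto
          finally show "ennreal ((f (fst p) - f' (fst p))\<^sup>2) * indicator {a..b} (fst p) * indicator (L h) (snd p) \<le>
            2 * (ennreal ((F0 p - f (fst p))\<^sup>2) * (indicator {a..b} (fst p) * indicator (L h) (snd p)) +
            ennreal ((F0 p - f' (fst p))\<^sup>2) * (indicator {a..b} (fst p) * indicator (L h) (snd p)))"
            by (auto simp: indicator_def)
        qed
        also have "\<dots> = 2 * ((\<integral>\<^sup>+ p. ennreal ((F p - f (fst p))\<^sup>2) * indicator ({a..b} \<times> L h) p \<partial>lborel) +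
           (\<integral>\<^sup>+ p. ennreal ((F p - f' (fst p))\<^sup>2) * indicator ({a..b} \<times> L h) p \<partial>lborel))"
          unfolding FF by (subst nn_integral_cmult) (auto simp: nn_integral_add)
        finally have "ennreal (1 / h) * (I a b * ennreal h) \<le> ennreal (1 / h) * (2 * ((\<integral>\<^sup>+ p. ennreal ((F p - f (fst p))\<^sup>2) * indicator ({a..b} \<times> L h) p \<partial>lborel) +
           (\<integral>\<^sup>+ p. ennreal ((F p - f' (fst p))\<^sup>2) * indicator ({a..b} \<times> L h) p \<partial>lborel)))"
          by (rule mult_left_mono) simp
        also have "\<dots> = 2 * (\<phi> f h + \<phi> f' h)" by (simp add: \<phi>_def algebra_simps)
        also have "ennreal (1 / h) * (I a b * ennreal h) = I a b * (ennreal (1 / h) * ennreal h)" by (simp add: ac_simps)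
        also have "ennreal (1 / h) * ennreal h = 1" using elim by (simp add: ennreal_mult[symmetric])
        finally show ?case by simp
      qed
    qed (simp add: trivial_limit_at_right_real)
    then show ?thesis by simp
  qed
  have "AE x in lborel. \<forall>n::nat. ennreal ((f x - f' x)\<^sup>2) * indicator {- real n..real n} x = 0"
    unfolding AE_all_countable using zero by (auto simp: I_def nn_integral_0_iff_AE)
  then show ?thesis
  proof eventually_elim
    case (elim x)
    obtain n where "\<bar>x\<bar> \<le> real n" using real_arch_simple by blast
    then show ?case using elim[rule_format, of n] by (simp add: indicator_def abs_le_iff ennreal_eq_0_iff)
  qed
qed

lemma is_edge_cases:
  assumes "is_edge c e"
  shows "\<bar>c\<bar> = 1" "c \<noteq> 0" "c * c = 1" "0 < t \<Longrightarrow> t < 1 \<Longrightarrow> 0 < e + c * t \<and> e + c * t < pi"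
    "0 < y \<Longrightarrow> y < pi \<Longrightarrow> 0 < c * (y - e)"
  using assms pi_gt3 by (auto simp: is_edge_def)

lemma edge_square_integral:
  fixes g :: "real \<times> real \<Rightarrow> real"
  assumes edge: "is_edge c e" and [measurable]: "g \<in> borel_measurable borel"
  shows "(\<integral>\<^sup>+p. (ennreal \<bar>g (fst p, e + c * snd p)\<bar>)\<^sup>2 \<partial>lborel) = (\<integral>\<^sup>+p. ennreal ((g p)\<^sup>2) \<partial>lborel)"
proof -
  have "(\<integral>\<^sup>+p. (ennreal \<bar>g (fst p, e + c * snd p)\<bar>)\<^sup>2 \<partial>lborel) = (\<integral>\<^sup>+x. \<integral>\<^sup>+s. ennreal ((g (x, e + c * s))\<^sup>2) \<partial>lborel \<partial>lborel)"
    using plane_nn_integral(1)[of "\<lambda>p. (ennreal \<bar>g (fst p, e + c * snd p)\<bar>)\<^sup>2"] by (simp add: ennreal_power)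
  also have "\<dots> = (\<integral>\<^sup>+x. \<integral>\<^sup>+s. ennreal ((g (x, s))\<^sup>2) \<partial>lborel \<partial>lborel)"
    by (rule nn_integral_cong, rule nn_integral_affine_unit[where f="\<lambda>s. ennreal ((g (x, s))\<^sup>2)" for x])
      (use is_edge_cases[OF edge] in auto)
  also have "\<dots> = (\<integral>\<^sup>+p. ennreal ((g p)\<^sup>2) \<partial>lborel)"
    by (rule plane_nn_integral(1)) measurable
  finally show ?thesis .
qed

text \<open>Hardy's inequality on every vertical line, with the distance to the edge as variable,
  converts the bound by an integral of |\<open>g2\<close>| into the weighted integrability that
  \<open>trace_atI\<close> asks for.\<close>

lemma edge_trace:
  fixes F F0 g2 :: "real \<times> real \<Rightarrow> real"
  assumes edge: "is_edge c e" and [measurable]: "f \<in> borel_measurable borel" "F0 \<in> borel_measurable borel" "g2 \<in> borel_measurable borel"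
    and F0: "\<And>p. p \<in> strip \<Longrightarrow> F0 p = F p"
    and fin: "(\<integral>\<^sup>+p. ennreal ((g2 p)\<^sup>2) \<partial>lborel) < \<infinity>"
    and V: "AE p in lborel. p \<in> strip \<longrightarrow> ennreal \<bar>F0 p - f (fst p)\<bar> \<le>
       (\<integral>\<^sup>+s. ennreal \<bar>g2 (fst p, e + c * s)\<bar> * indicator {0<..<c * (snd p - e)} s \<partial>lborel)"
  shows "trace_at c e F f"
proof -
  define b where "b x t = (\<integral>\<^sup>+s. ennreal \<bar>g2 (x, e + c * s)\<bar> * indicator {0<..<t} s \<partial>lborel)" for x t
  have bm[measurable]: "case_prod b \<in> borel_measurable (borel \<Otimes>\<^sub>M borel)"
  proof -
    have "(\<lambda>p. \<integral>\<^sup>+s. ennreal \<bar>g2 (fst p, e + c * s)\<bar> * (if 0 < s \<and> s < snd p then 1 else 0) \<partial>lborel) \<in> borel_measurable (borel \<Otimes>\<^sub>M borel)"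
      by measurable
    moreover have "case_prod b = (\<lambda>p. \<integral>\<^sup>+s. ennreal \<bar>g2 (fst p, e + c * s)\<bar> * (if 0 < s \<and> s < snd p then 1 else 0) \<partial>lborel)"
      by (auto simp: b_def fun_eq_iff indicator_def intro!: nn_integral_cong)
    ultimately show ?thesis by simp
  qed
  define H where "H x t = (b x t)\<^sup>2 * ennreal (1 / t\<^sup>2) * indicator {0<..} t" for x t
  have [measurable]: "case_prod H \<in> borel_measurable (borel \<Otimes>\<^sub>M borel)" unfolding H_def by measurable
  have "(\<integral>\<^sup>+p. ennreal ((F0 p - f (fst p))\<^sup>2 / (c * (snd p - e))\<^sup>2) * indicator strip p \<partial>lborel) \<le>
    (\<integral>\<^sup>+p. H (fst p) (- c * e + c * snd p) \<partial>lborel)"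
  proof (rule nn_integral_mono_AE)
    show "AE p in lborel. ennreal ((F0 p - f (fst p))\<^sup>2 / (c * (snd p - e))\<^sup>2) * indicator strip p \<le> H (fst p) (- c * e + c * snd p)"
      using V
    proof eventually_elim
      case (elim p)
      show ?case
      proof (cases "p \<in> strip")
        case True
        have t: "- c * e + c * snd p = c * (snd p - e)" by (simp add: algebra_simps)
        have pos: "0 < c * (snd p - e)" using is_edge_cases(5)[OF edge, of "snd p"] True by (auto simp: strip_def)
        have "ennreal ((F0 p - f (fst p))\<^sup>2 / (c * (snd p - e))\<^sup>2) = ennreal ((F0 p - f (fst p))\<^sup>2 * (1 / (c * (snd p - e))\<^sup>2))" by simp
        also have "\<dots> = (ennreal \<bar>F0 p - f (fst p)\<bar>)\<^sup>2 * ennreal (1 / (c * (snd p - e))\<^sup>2)"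
          by (subst ennreal_mult) (auto simp: ennreal_power)
        also have "\<dots> \<le> (b (fst p) (c * (snd p - e)))\<^sup>2 * ennreal (1 / (c * (snd p - e))\<^sup>2)"
          using elim True by (intro mult_right_mono power_mono) (auto simp: b_def)
        finally show ?thesis unfolding t H_def using True pos by simp
      qed simp
    qed
  qed
  also have "\<dots> = (\<integral>\<^sup>+x. \<integral>\<^sup>+y. H x (- c * e + c * y) \<partial>lborel \<partial>lborel)"
    using plane_nn_integral(1)[of "\<lambda>p. H (fst p) (- c * e + c * snd p)"] by simp
  also have "\<dots> = (\<integral>\<^sup>+x. \<integral>\<^sup>+t. H x t \<partial>lborel \<partial>lborel)"
    by (rule nn_integral_cong, rule nn_integral_affine_unit) (use is_edge_cases[OF edge] in auto)
  also have "\<dots> \<le> (\<integral>\<^sup>+x. 4 * (\<integral>\<^sup>+s. (ennreal \<bar>g2 (x, e + c * s)\<bar>)\<^sup>2 \<partial>lborel) \<partial>lborel)"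
    unfolding H_def b_def by (intro nn_integral_mono hardy_inequality) measurable
  also have "\<dots> = 4 * (\<integral>\<^sup>+x. (\<integral>\<^sup>+s. (ennreal \<bar>g2 (x, e + c * s)\<bar>)\<^sup>2 \<partial>lborel) \<partial>lborel)"
    by (rule nn_integral_cmult) measurable
  also have "(\<integral>\<^sup>+x. (\<integral>\<^sup>+s. (ennreal \<bar>g2 (x, e + c * s)\<bar>)\<^sup>2 \<partial>lborel) \<partial>lborel) = (\<integral>\<^sup>+p. ennreal ((g2 p)\<^sup>2) \<partial>lborel)"
    using plane_nn_integral(1)[of "\<lambda>p. (ennreal \<bar>g2 (fst p, e + c * snd p)\<bar>)\<^sup>2"] edge_square_integral[OF edge, of g2] by simp
  also have "4 * \<dots> < \<infinity>" using fin by (simp add: ennreal_mult_less_top)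
  finally have D: "(\<integral>\<^sup>+p. ennreal ((F0 p - f (fst p))\<^sup>2 / (c * (snd p - e))\<^sup>2) * indicator strip p \<partial>lborel) < \<infinity>" .
  also have "(\<integral>\<^sup>+p. ennreal ((F0 p - f (fst p))\<^sup>2 / (c * (snd p - e))\<^sup>2) * indicator strip p \<partial>lborel) =
    (\<integral>\<^sup>+p. ennreal ((F p - f (fst p))\<^sup>2 / (c * (snd p - e))\<^sup>2) * indicator strip p \<partial>lborel)"
    by (intro nn_integral_cong) (auto simp: indicator_def F0)
  finally show ?thesis by (intro trace_atI[OF edge _ _ F0]) auto
qed

text \<open>The detour at displacement \<open>t\<close> runs along the line at height
  \<open>e + c * t\<close>, which lies in the strip because t < 1 < pi. Both vertical legs are
  controlled by \<open>V\<close>, the horizontal one by \<open>H\<close>.\<close>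

lemma edge_diff_quot_sq:
  fixes F0 g1 g2 :: "real \<times> real \<Rightarrow> real"
  assumes edge: "is_edge c e" and [measurable]: "f \<in> borel_measurable borel" "F0 \<in> borel_measurable borel"
      "g1 \<in> borel_measurable borel" "g2 \<in> borel_measurable borel"
    and V: "AE p in lborel. p \<in> strip \<longrightarrow> ennreal \<bar>F0 p - f (fst p)\<bar> \<le>
       (\<integral>\<^sup>+s. ennreal \<bar>g2 (fst p, e + c * s)\<bar> * indicator {0<..<c * (snd p - e)} s \<partial>lborel)"
    and H: "AE y in lborel. 0 < y \<and> y < pi \<longrightarrow> (\<forall>t>0. AE x in lborel. ennreal \<bar>F0 (x + t, y) - F0 (x, y)\<bar> \<le>
       (\<integral>\<^sup>+r. ennreal \<bar>g1 (r, y)\<bar> * indicator {x<..<x+t} r \<partial>lborel))"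
  shows "diff_quot_sq f \<le> 3 * ((\<integral>\<^sup>+p. ennreal ((g1 p)\<^sup>2) \<partial>lborel) + 8 * (\<integral>\<^sup>+p. ennreal ((g2 p)\<^sup>2) \<partial>lborel))"
proof -
  note ec = is_edge_cases[OF edge]
  define A B where "A p = ennreal \<bar>g1 (fst p, e + c * snd p)\<bar>" and "B p = ennreal \<bar>g2 (fst p, e + c * snd p)\<bar>" for p
  have [measurable]: "A \<in> borel_measurable borel" "B \<in> borel_measurable borel" unfolding A_def B_def by measurable
  have "diff_quot_sq f \<le> 3 * ((\<integral>\<^sup>+p. (A p)\<^sup>2 \<partial>lborel) + 8 * (\<integral>\<^sup>+p. (B p)\<^sup>2 \<partial>lborel))"
  proof (rule diff_quot_sq_le_gradient)
    \<comment> \<open>Exceptional heights form a null set, and so do the displacements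
      \<open>t\<close> that an affine map with nonzero slope sends into it.\<close>
    show "AE t in lborel. 0 < t \<and> t < 1 \<longrightarrow> (AE x in lborel. ennreal \<bar>f (x + t) - f x\<bar> \<le>
      (\<integral>\<^sup>+r. A (r, t) * indicator {x<..<x+t} r \<partial>lborel) +
      (\<integral>\<^sup>+s. B (x + t, s) * indicator {0<..<t} s \<partial>lborel) + (\<integral>\<^sup>+s. B (x, s) * indicator {0<..<t} s \<partial>lborel))"
      using AE_affine[OF plane_AE(2)[OF V] ec(2), of e] AE_affine[OF H ec(2), of e]
    proof eventually_elim
      case (elim t)
      show ?case
      proof
        assume t: "0 < t \<and> t < 1"
        then have y: "0 < e + c * t" "e + c * t < pi" using ec(4)[of t] by auto
        have cc: "c * (e + c * t - e) = t" using ec(3) by (simp add: mult.assoc[symmetric])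
        have v: "AE x in lborel. ennreal \<bar>F0 (x, e + c * t) - f x\<bar> \<le> (\<integral>\<^sup>+s. B (x, s) * indicator {0<..<t} s \<partial>lborel)"
          using elim(1) y unfolding fst_conv snd_conv cc by (simp add: strip_def B_def)
        have v': "AE x in lborel. ennreal \<bar>F0 (x + t, e + c * t) - f (x + t)\<bar> \<le> (\<integral>\<^sup>+s. B (x + t, s) * indicator {0<..<t} s \<partial>lborel)"
          using AE_affine[OF v, of 1 t] by (simp add: add.commute)
        have h: "AE x in lborel. ennreal \<bar>F0 (x + t, e + c * t) - F0 (x, e + c * t)\<bar> \<le> (\<integral>\<^sup>+r. A (r, t) * indicator {x<..<x+t} r \<partial>lborel)"
          using elim(2) y t by (simp add: A_def)
        show "AE x in lborel. ennreal \<bar>f (x + t) - f x\<bar> \<le>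
          (\<integral>\<^sup>+r. A (r, t) * indicator {x<..<x+t} r \<partial>lborel) +
          (\<integral>\<^sup>+s. B (x + t, s) * indicator {0<..<t} s \<partial>lborel) + (\<integral>\<^sup>+s. B (x, s) * indicator {0<..<t} s \<partial>lborel)"
          using v v' h
        proof eventually_elim
          case (elim x)
          let ?y = "e + c * t"
          have "ennreal \<bar>f (x + t) - f x\<bar> \<le> ennreal (\<bar>F0 (x + t, ?y) - F0 (x, ?y)\<bar> + \<bar>F0 (x + t, ?y) - f (x + t)\<bar> + \<bar>F0 (x, ?y) - f x\<bar>)"
            by (rule ennreal_leI) linarith
          also have "\<dots> = ennreal \<bar>F0 (x + t, ?y) - F0 (x, ?y)\<bar> + ennreal \<bar>F0 (x + t, ?y) - f (x + t)\<bar> + ennreal \<bar>F0 (x, ?y) - f x\<bar>"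
            by simp
          also have "\<dots> \<le> (\<integral>\<^sup>+r. A (r, t) * indicator {x<..<x+t} r \<partial>lborel) +
            (\<integral>\<^sup>+s. B (x + t, s) * indicator {0<..<t} s \<partial>lborel) + (\<integral>\<^sup>+s. B (x, s) * indicator {0<..<t} s \<partial>lborel)"
            using elim by (intro add_mono)
          finally show ?case .
        qed
      qed
    qed
  qed measurable
  then show ?thesis using edge_square_integral[OF edge, of g1] edge_square_integral[OF edge, of g2]
    by (simp add: A_def B_def)
qed

section \<open>Representation of a function with square integrable weak gradient\<close>

lemma strip_indicator_measurable:
  fixes F :: "real \<times> real \<Rightarrow> 'a::{real_normed_vector,second_countable_topology}"
  assumes "set_borel_measurable lborel strip F"
  shows "(\<lambda>p. indicator strip p *\<^sub>R F p) \<in> borel_measurable borel"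
  using assms by (simp add: set_borel_measurable_def)

text \<open>Collects what the trace estimates need. For horizontal lines only a bound on increments
  is recorded: the representations come from different windows, and their constants of integration
  disappear in differences.\<close>

lemma in_H1_representation:
  assumes H1: "in_H1 F G"
  obtains F0 g1 g2 :: "real \<times> real \<Rightarrow> real" and f0 f1 :: "real \<Rightarrow> real" where
    "F0 \<in> borel_measurable borel" "g1 \<in> borel_measurable borel" "g2 \<in> borel_measurable borel"
    "f0 \<in> borel_measurable borel" "f1 \<in> borel_measurable borel"
    "\<And>p. p \<in> strip \<Longrightarrow> F0 p = F p"
    "(\<integral>\<^sup>+p. ennreal ((g1 p)\<^sup>2) \<partial>lborel) + (\<integral>\<^sup>+p. ennreal ((g2 p)\<^sup>2) \<partial>lborel) = H1_norm_sq G"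
    "AE y in lborel. 0 < y \<and> y < pi \<longrightarrow> (\<forall>t>0. AE x in lborel. ennreal \<bar>F0 (x + t, y) - F0 (x, y)\<bar> \<le>
       (\<integral>\<^sup>+r. ennreal \<bar>g1 (r, y)\<bar> * indicator {x<..<x+t} r \<partial>lborel))"
    "AE p in lborel. p \<in> strip \<longrightarrow> ennreal \<bar>F0 p - f0 (fst p)\<bar> \<le>
       (\<integral>\<^sup>+s. ennreal \<bar>g2 (fst p, 0 + 1 * s)\<bar> * indicator {0<..<1 * (snd p - 0)} s \<partial>lborel)"
    "AE p in lborel. p \<in> strip \<longrightarrow> ennreal \<bar>F0 p - f1 (fst p)\<bar> \<le>
       (\<integral>\<^sup>+s. ennreal \<bar>g2 (fst p, pi + (- 1) * s)\<bar> * indicator {0<..<(- 1) * (snd p - pi)} s \<partial>lborel)"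
    "AE x in lborel. ennreal \<bar>f0 x - f1 x\<bar> \<le> (\<integral>\<^sup>+s. ennreal \<bar>g2 (x, s)\<bar> * indicator {0<..<pi} s \<partial>lborel)"
proof -
  have wg: "weak_gradient F G strip" and fin: "H1_norm_sq G < \<infinity>" using H1 by (auto simp: in_H1_def)
  \<comment> \<open>\<open>F\<close> and \<open>G\<close> are known to be measurable on the strip
    only; extension by zero makes them Borel on the plane.\<close>
  define F0 where "F0 p = indicator strip p *\<^sub>R F p" for p
  define G0 where "G0 p = indicator strip p *\<^sub>R G p" for p
  define g1 where "g1 p = fst (G0 p)" for p
  define g2 where "g2 p = snd (G0 p)" for p
  have F0m[measurable]: "F0 \<in> borel_measurable borel" and G0m[measurable]: "G0 \<in> borel_measurable borel"
    using wg strip_indicator_measurable[of F] strip_indicator_measurable[of G]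
    by (simp_all only: F0_def[abs_def] G0_def[abs_def] weak_gradient_def)
  have g1m[measurable]: "g1 \<in> borel_measurable borel" and g2m[measurable]: "g2 \<in> borel_measurable borel"
    unfolding g1_def g2_def by measurable
  have norm: "(\<integral>\<^sup>+p. ennreal ((g1 p)\<^sup>2) \<partial>lborel) + (\<integral>\<^sup>+p. ennreal ((g2 p)\<^sup>2) \<partial>lborel) = H1_norm_sq G"
  proof -
    have "(\<integral>\<^sup>+p. ennreal ((g1 p)\<^sup>2) \<partial>lborel) + (\<integral>\<^sup>+p. ennreal ((g2 p)\<^sup>2) \<partial>lborel) = (\<integral>\<^sup>+p. ennreal ((g1 p)\<^sup>2) + ennreal ((g2 p)\<^sup>2) \<partial>lborel)"
      by (rule nn_integral_add[symmetric]) measurable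
    also have "\<dots> = H1_norm_sq G"
      unfolding H1_norm_sq_def by (intro nn_integral_cong)
       (auto simp: g1_def g2_def G0_def indicator_def norm_prod_def ennreal_plus[symmetric] simp del: ennreal_plus)
    finally show ?thesis .
  qed
  then have g1fin: "(\<integral>\<^sup>+p. ennreal ((g1 p)\<^sup>2) \<partial>lborel) < \<infinity>" and g2fin: "(\<integral>\<^sup>+p. ennreal ((g2 p)\<^sup>2) \<partial>lborel) < \<infinity>"
    using fin by (metis ennreal_add_less_top infinity_ennreal_def)+
  have g1i: "integrable lborel (\<lambda>p. (g1 p)\<^sup>2)" and g2i: "integrable lborel (\<lambda>p. (g2 p)\<^sup>2)"
    using g1fin g2fin by (auto simp: integrable_iff_bounded)
  have loc: "set_integrable lborel (cbox u v) F0" if "cbox u v \<subseteq> strip" for u v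
  proof -
    have "set_integrable lborel (cbox u v) F"
      using wg that by (auto simp: weak_gradient_def locally_integrable_on_def)
    moreover have "indicator (cbox u v) p *\<^sub>R F p = indicator (cbox u v) p *\<^sub>R F0 p" for p
      using that by (auto simp: F0_def indicator_def)
    ultimately show ?thesis by (simp only: set_integrable_def)
  qed
  have weak: "(\<integral>p. F0 p * (\<alpha> (fst p) * \<beta>' (snd p)) \<partial>lborel) = - (\<integral>p. g2 p * (\<alpha> (fst p) * \<beta> (snd p)) \<partial>lborel)"
     "(\<integral>p. F0 p * (\<alpha>' (fst p) * \<beta> (snd p)) \<partial>lborel) = - (\<integral>p. g1 p * (\<alpha> (fst p) * \<beta> (snd p)) \<partial>lborel)"
    if "\<alpha> \<in> smooth1" "\<beta> \<in> smooth1" and D: "\<And>x. (\<alpha> has_real_derivative \<alpha>' x) (at x)" "\<And>x. (\<beta> has_real_derivative \<beta>' x) (at x)"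
      and sub: "cbox (c, a') (d, b') \<subseteq> strip" and z: "\<And>x. x \<notin> {c..d} \<Longrightarrow> \<alpha> x = 0" "\<And>x. x \<notin> {a'..b'} \<Longrightarrow> \<beta> x = 0"
    for \<alpha> \<alpha>' \<beta> \<beta>' c d a' b'
  proof -
    define \<phi> where "\<phi> p = \<alpha> (fst p) * \<beta> (snd p)" for p
    have \<phi>: "test_fun strip \<phi>" unfolding \<phi>_def[abs_def] by (rule test_fun_product[OF that(1,2) sub z])
    have *: "(LINT p:strip|lborel. F p * partial i \<phi> p) = - (LINT p:strip|lborel. (G p \<bullet> i) * \<phi> p)" if "i \<in> Basis" for i
      using wg \<phi> that unfolding weak_gradient_def by blast
    have "(LINT p:strip|lborel. F p * partial (0, 1) \<phi> p) = (\<integral>p. F0 p * (\<alpha> (fst p) * \<beta>' (snd p)) \<partial>lborel)"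
      unfolding set_lebesgue_integral_def \<phi>_def[abs_def] partial_product[OF D]
      by (intro Bochner_Integration.integral_cong) (auto simp: F0_def)
    moreover have "(LINT p:strip|lborel. (G p \<bullet> (0, 1)) * \<phi> p) = (\<integral>p. g2 p * (\<alpha> (fst p) * \<beta> (snd p)) \<partial>lborel)"
      unfolding set_lebesgue_integral_def
      by (intro Bochner_Integration.integral_cong) (auto simp: g2_def G0_def \<phi>_def inner_prod_def)
    ultimately show "(\<integral>p. F0 p * (\<alpha> (fst p) * \<beta>' (snd p)) \<partial>lborel) = - (\<integral>p. g2 p * (\<alpha> (fst p) * \<beta> (snd p)) \<partial>lborel)"
      using *[of "(0, 1)"] by (simp add: Basis_plane)
    have "(LINT p:strip|lborel. F p * partial (1, 0) \<phi> p) = (\<integral>p. F0 p * (\<alpha>' (fst p) * \<beta> (snd p)) \<partial>lborel)"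
      unfolding set_lebesgue_integral_def \<phi>_def[abs_def] partial_product[OF D]
      by (intro Bochner_Integration.integral_cong) (auto simp: F0_def)
    moreover have "(LINT p:strip|lborel. (G p \<bullet> (1, 0)) * \<phi> p) = (\<integral>p. g1 p * (\<alpha> (fst p) * \<beta> (snd p)) \<partial>lborel)"
      unfolding set_lebesgue_integral_def
      by (intro Bochner_Integration.integral_cong) (auto simp: g1_def G0_def \<phi>_def inner_prod_def)
    ultimately show "(\<integral>p. F0 p * (\<alpha>' (fst p) * \<beta> (snd p)) \<partial>lborel) = - (\<integral>p. g1 p * (\<alpha> (fst p) * \<beta> (snd p)) \<partial>lborel)"
      using *[of "(1, 0)"] by (simp add: Basis_plane)
  qed
  have g2z: "g2 p = 0" and g1z: "g1 p = 0" if "p \<notin> UNIV \<times> {0<..<pi}" for p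
    using that by (auto simp: g1_def g2_def G0_def strip_eq)
  have weakV: "(\<integral>p. F0 p * (\<alpha> (fst p) * \<beta>' (snd p)) \<partial>lborel) = - (\<integral>p. g2 p * (\<alpha> (fst p) * \<beta> (snd p)) \<partial>lborel)"
    if "\<alpha> \<in> smooth1" "\<beta> \<in> smooth1" "\<beta>' \<in> smooth1" "\<And>x. (\<beta> has_real_derivative \<beta>' x) (at x)" "c \<le> d" "a' \<le> b'"
      "cbox (c, a') (d, b') \<subseteq> UNIV \<times> {0<..<pi}" "\<And>x. x \<notin> {c..d} \<Longrightarrow> \<alpha> x = 0" "\<And>x. x \<notin> {a'..b'} \<Longrightarrow> \<beta> x = 0"
    for \<alpha> \<beta> \<beta>' c d a' b'
  proof -
    from smooth1_deriv[OF that(1)] obtain \<alpha>' where "\<And>x. (\<alpha> has_real_derivative \<alpha>' x) (at x)" by blast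
    from weak(1)[OF that(1,2) this that(4) that(7)[folded strip_eq] that(8,9)] show ?thesis by simp
  qed
  have V: "(AE x in lborel. integrable lborel (\<lambda>r. g2 (x, r))) \<and>
      (\<exists>h\<in>borel_measurable borel. AE p in lborel. p \<in> UNIV \<times> {0<..<pi} \<longrightarrow>
         F0 p = h (fst p) + (\<integral>r. (if r \<le> snd p then g2 (fst p, r) else 0) \<partial>lborel))"
    by (rule absolutely_continuous_on_lines[OF F0m g2m open_UNIV pi_gt_zero loc[unfolded strip_eq] g2z g2i weakV])
  obtain f0 where f0m[measurable]: "f0 \<in> borel_measurable borel" and
    f0: "AE p in lborel. p \<in> strip \<longrightarrow> F0 p = f0 (fst p) + (\<integral>r. (if r \<le> snd p then g2 (fst p, r) else 0) \<partial>lborel)"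
    using V unfolding strip_eq by blast
  have g2s: "AE x in lborel. integrable lborel (\<lambda>r. g2 (x, r))" using V by blast
  \<comment> \<open>The value at height pi of the representation that starts from
    \<open>f0\<close>.\<close>
  define f1 where "f1 x = f0 x + (\<integral>r. g2 (x, r) \<partial>lborel)" for x
  have f1m[measurable]: "f1 \<in> borel_measurable borel"
  proof -
    have "(\<lambda>x. f0 x + (\<integral>r. g2 (x, r) \<partial>lborel)) \<in> borel_measurable borel" by measurable
    then show ?thesis by (simp add: f1_def[abs_def])
  qed
  \<comment> \<open>\<open>g2\<close> vanishes off the strip, so the indefinite integral begins at
    height 0 and is complete at height pi.\<close>
  have low: "(\<integral>r. (if r \<le> 0 then g2 (x, r) else 0) \<partial>lborel) = 0" for x
    by (rule integral_eq_zero_AE) (auto intro!: AE_I2 g2z)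
  have high: "(\<integral>r. (if r \<le> pi then g2 (x, r) else 0) \<partial>lborel) = (\<integral>r. g2 (x, r) \<partial>lborel)" for x
    by (rule Bochner_Integration.integral_cong) (auto intro!: g2z)
  have V0: "AE p in lborel. p \<in> strip \<longrightarrow> ennreal \<bar>F0 p - f0 (fst p)\<bar> \<le>
       (\<integral>\<^sup>+s. ennreal \<bar>g2 (fst p, 0 + 1 * s)\<bar> * indicator {0<..<1 * (snd p - 0)} s \<partial>lborel)"
    using f0 AE_fst[OF g2s]
  proof eventually_elim
    case (elim p)
    show ?case
    proof
      assume p: "p \<in> strip"
      have "ennreal \<bar>(\<integral>r. (if r \<le> snd p then g2 (fst p, r) else 0) \<partial>lborel) - (\<integral>r. (if r \<le> 0 then g2 (fst p, r) else 0) \<partial>lborel)\<bar>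
        \<le> (\<integral>\<^sup>+r. ennreal \<bar>g2 (fst p, r)\<bar> * indicator {0<..<snd p} r \<partial>lborel)"
        by (rule indefinite_integral_diff_le[OF elim(2)]) (use p in \<open>auto simp: strip_def\<close>)
      then show "ennreal \<bar>F0 p - f0 (fst p)\<bar> \<le>
       (\<integral>\<^sup>+s. ennreal \<bar>g2 (fst p, 0 + 1 * s)\<bar> * indicator {0<..<1 * (snd p - 0)} s \<partial>lborel)"
        using elim(1) p low by simp
    qed
  qed
  have V1: "AE p in lborel. p \<in> strip \<longrightarrow> ennreal \<bar>F0 p - f1 (fst p)\<bar> \<le>
       (\<integral>\<^sup>+s. ennreal \<bar>g2 (fst p, pi + (- 1) * s)\<bar> * indicator {0<..<(- 1) * (snd p - pi)} s \<partial>lborel)"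
    using f0 AE_fst[OF g2s]
  proof eventually_elim
    case (elim p)
    show ?case
    proof
      assume p: "p \<in> strip"
      have "F0 p - f1 (fst p) = (\<integral>r. (if r \<le> snd p then g2 (fst p, r) else 0) \<partial>lborel) - (\<integral>r. (if r \<le> pi then g2 (fst p, r) else 0) \<partial>lborel)"
        using elim(1) p high by (simp add: f1_def)
      then have "ennreal \<bar>F0 p - f1 (fst p)\<bar> = ennreal \<bar>(\<integral>r. (if r \<le> pi then g2 (fst p, r) else 0) \<partial>lborel) - (\<integral>r. (if r \<le> snd p then g2 (fst p, r) else 0) \<partial>lborel)\<bar>"
        by (simp add: abs_minus_commute)
      also have "\<dots> \<le> (\<integral>\<^sup>+r. ennreal \<bar>g2 (fst p, r)\<bar> * indicator {snd p<..<pi} r \<partial>lborel)"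
        by (rule indefinite_integral_diff_le[OF elim(2)]) (use p in \<open>auto simp: strip_def\<close>)
      also have "\<dots> = (\<integral>\<^sup>+s. ennreal \<bar>g2 (fst p, pi + (- 1) * s)\<bar> * indicator {snd p<..<pi} (pi + (- 1) * s) \<partial>lborel)"
        by (rule nn_integral_affine_unit[symmetric]) auto
      also have "\<dots> = (\<integral>\<^sup>+s. ennreal \<bar>g2 (fst p, pi + (- 1) * s)\<bar> * indicator {0<..<(- 1) * (snd p - pi)} s \<partial>lborel)"
        by (intro nn_integral_cong) (auto simp: indicator_def)
      finally show "ennreal \<bar>F0 p - f1 (fst p)\<bar> \<le> (\<integral>\<^sup>+s. ennreal \<bar>g2 (fst p, pi + (- 1) * s)\<bar> * indicator {0<..<(- 1) * (snd p - pi)} s \<partial>lborel)" .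
    qed
  qed
  have diff: "AE x in lborel. ennreal \<bar>f0 x - f1 x\<bar> \<le> (\<integral>\<^sup>+s. ennreal \<bar>g2 (x, s)\<bar> * indicator {0<..<pi} s \<partial>lborel)"
    using g2s
  proof eventually_elim
    case (elim x)
    have "f0 x - f1 x = (\<integral>r. (if r \<le> 0 then g2 (x, r) else 0) \<partial>lborel) - (\<integral>r. (if r \<le> pi then g2 (x, r) else 0) \<partial>lborel)"
      using low high by (simp add: f1_def)
    then have "ennreal \<bar>f0 x - f1 x\<bar> = ennreal \<bar>(\<integral>r. (if r \<le> pi then g2 (x, r) else 0) \<partial>lborel) - (\<integral>r. (if r \<le> 0 then g2 (x, r) else 0) \<partial>lborel)\<bar>"
      by (simp add: abs_minus_commute)
    also have "\<dots> \<le> (\<integral>\<^sup>+s. ennreal \<bar>g2 (x, s)\<bar> * indicator {0<..<pi} s \<partial>lborel)"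
      by (rule indefinite_integral_diff_le[OF elim]) simp
    finally show ?case .
  qed
  \<comment> \<open>Coordinates are swapped, so that horizontal lines run in the second variable,
    and the line is cut to a bounded window as \<open>absolutely_continuous_on_lines\<close>
    requires. \<open>Suc n\<close> keeps the window nonempty for n = 0.\<close>
  define gn where "gn n p = (if - real (Suc n) < snd p \<and> snd p < real (Suc n) then g1 (snd p, fst p) else 0)" for n p
  have gnm[measurable]: "gn n \<in> borel_measurable borel" for n unfolding gn_def by measurable
  define F' where "F' p = F0 (snd p, fst p)" for p
  have F'm[measurable]: "F' \<in> borel_measurable borel" unfolding F'_def by measurable
  have Hn: "(AE y in lborel. integrable lborel (\<lambda>r. gn n (y, r))) \<and>
      (\<exists>k\<in>borel_measurable borel. AE p in lborel. p \<in> {0<..<pi} \<times> {- real (Suc n)<..<real (Suc n)} \<longrightarrow>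
         F' p = k (fst p) + (\<integral>r. (if r \<le> snd p then gn n (fst p, r) else 0) \<partial>lborel))" for n
  proof (rule absolutely_continuous_on_lines[OF F'm gnm])
    show "open {0<..<pi}" "- real (Suc n) < real (Suc n)" by auto
    show "set_integrable lborel (cbox u v) F'" if "cbox u v \<subseteq> {0<..<pi} \<times> {- real (Suc n)<..<real (Suc n)}" for u v
    proof -
      obtain c a d b where uv: "u = (c, a)" "v = (d, b)" by (cases u, cases v) auto
      have "cbox (a, c) (b, d) \<subseteq> strip"
        using that by (auto simp: uv strip_eq cbox_Pair_subset_iff) 
      from plane_integrable_swap[OF loc[OF this, unfolded set_integrable_def]]
      have "integrable lborel (\<lambda>p. indicator (cbox (a, c) (b, d)) (snd p, fst p) *\<^sub>R F0 (snd p, fst p))" .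
      moreover have "indicator (cbox (a, c) (b, d)) (snd p, fst p) = (indicator (cbox u v) p :: real)" for p
        by (cases p) (auto simp: uv cbox_Pair_eq indicator_def)
      ultimately show ?thesis by (simp only: set_integrable_def F'_def)
    qed
    show "gn n p = 0" if "p \<notin> {0<..<pi} \<times> {- real (Suc n)<..<real (Suc n)}" for p
      using that g1z[of "(snd p, fst p)"] by (cases p) (auto simp: gn_def)
    show "integrable lborel (\<lambda>p. (gn n p)\<^sup>2)"
      by (rule Bochner_Integration.integrable_bound[OF plane_integrable_swap[OF g1i]]) (auto simp: gn_def)
    show "(\<integral>p. F' p * (\<alpha> (fst p) * \<beta>' (snd p)) \<partial>lborel) = - (\<integral>p. gn n p * (\<alpha> (fst p) * \<beta> (snd p)) \<partial>lborel)"
      if "\<alpha> \<in> smooth1" "\<beta> \<in> smooth1" "\<beta>' \<in> smooth1" "\<And>x. (\<beta> has_real_derivative \<beta>' x) (at x)" "c \<le> d" "a' \<le> b'"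
        "cbox (c, a') (d, b') \<subseteq> {0<..<pi} \<times> {- real (Suc n)<..<real (Suc n)}" "\<And>x. x \<notin> {c..d} \<Longrightarrow> \<alpha> x = 0" "\<And>x. x \<notin> {a'..b'} \<Longrightarrow> \<beta> x = 0"
      for \<alpha> \<beta> \<beta>' c d a' b'
    proof -
      have [measurable]: "\<alpha> \<in> borel_measurable borel" "\<beta> \<in> borel_measurable borel" "\<beta>' \<in> borel_measurable borel"
        using that(1-3) by (auto intro: smooth1_borel)
      from smooth1_deriv[OF that(1)] obtain \<alpha>' where \<alpha>': "\<And>x. (\<alpha> has_real_derivative \<alpha>' x) (at x)" by blast
      have sub: "cbox (a', c) (b', d) \<subseteq> strip" 
        using that(5-7) by (auto simp: strip_eq cbox_Pair_subset_iff)
      have I: "{a'..b'} \<subseteq> {- real (Suc n)<..<real (Suc n)}" using that(5-7) by (auto simp: cbox_Pair_subset_iff)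
      have "(\<integral>p. F' p * (\<alpha> (fst p) * \<beta>' (snd p)) \<partial>lborel) = (\<integral>q. F0 q * (\<beta>' (fst q) * \<alpha> (snd q)) \<partial>lborel)"
        using plane_integral_swap[of "\<lambda>q. F0 q * (\<beta>' (fst q) * \<alpha> (snd q))"] by (simp add: F'_def mult.commute)
      also have "\<dots> = - (\<integral>q. g1 q * (\<beta> (fst q) * \<alpha> (snd q)) \<partial>lborel)"
        by (rule weak(2)[OF that(2,1,4) \<alpha>' sub that(9,8)])
      also have "(\<integral>q. g1 q * (\<beta> (fst q) * \<alpha> (snd q)) \<partial>lborel) = (\<integral>p. g1 (snd p, fst p) * (\<beta> (snd p) * \<alpha> (fst p)) \<partial>lborel)"
        using plane_integral_swap[of "\<lambda>q. g1 q * (\<beta> (fst q) * \<alpha> (snd q))"] by simp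
      also have "\<dots> = (\<integral>p. gn n p * (\<alpha> (fst p) * \<beta> (snd p)) \<partial>lborel)"
      proof (rule Bochner_Integration.integral_cong[OF refl])
        fix p :: "real \<times> real"
        show "g1 (snd p, fst p) * (\<beta> (snd p) * \<alpha> (fst p)) = gn n p * (\<alpha> (fst p) * \<beta> (snd p))"
        proof (cases "snd p \<in> {a'..b'}")
          case True
          with I have "- real (Suc n) < snd p \<and> snd p < real (Suc n)" by auto
          then show ?thesis by (simp add: gn_def)
        next
          case False
          from that(9)[OF this] show ?thesis by simp
        qed
      qed
      finally show ?thesis .
    qed
  qed
  have "\<forall>n. \<exists>k. AE p in lborel. p \<in> {0<..<pi} \<times> {- real (Suc n)<..<real (Suc n)} \<longrightarrow>
         F' p = k (fst p) + (\<integral>r. (if r \<le> snd p then gn n (fst p, r) else 0) \<partial>lborel)"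
    using Hn by blast
  from choice[OF this] obtain k where k: "\<forall>n. AE p in lborel. p \<in> {0<..<pi} \<times> {- real (Suc n)<..<real (Suc n)} \<longrightarrow>
         F' p = k n (fst p) + (\<integral>r. (if r \<le> snd p then gn n (fst p, r) else 0) \<partial>lborel)"
    by (rule exE)
  have gni: "AE y in lborel. \<forall>n. integrable lborel (\<lambda>r. gn n (y, r))"
    using Hn by (simp add: AE_all_countable)
  have kk: "AE y in lborel. \<forall>n. AE x in lborel. (y, x) \<in> {0<..<pi} \<times> {- real (Suc n)<..<real (Suc n)} \<longrightarrow>
         F' (y, x) = k n y + (\<integral>r. (if r \<le> x then gn n (y, r) else 0) \<partial>lborel)"
    unfolding AE_all_countable
  proof
    fix n
    show "AE y in lborel. AE x in lborel. (y, x) \<in> {0<..<pi} \<times> {- real (Suc n)<..<real (Suc n)} \<longrightarrow>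
         F' (y, x) = k n y + (\<integral>r. (if r \<le> x then gn n (y, r) else 0) \<partial>lborel)"
      using plane_AE(1)[OF k[THEN spec, of n]] by (simp only: fst_conv snd_conv)
  qed
  have H: "AE y in lborel. 0 < y \<and> y < pi \<longrightarrow> (\<forall>t>0. AE x in lborel. ennreal \<bar>F0 (x + t, y) - F0 (x, y)\<bar> \<le>
       (\<integral>\<^sup>+r. ennreal \<bar>g1 (r, y)\<bar> * indicator {x<..<x+t} r \<partial>lborel))"
    using gni kk
  proof eventually_elim
    case (elim y)
    show ?case
    proof (intro impI allI)
      fix t :: real assume y: "0 < y \<and> y < pi" and t: "0 < t"
      have a: "AE x in lborel. \<forall>n. - real (Suc n) < x \<and> x < real (Suc n) \<longrightarrow>
         F' (y, x) = k n y + (\<integral>r. (if r \<le> x then gn n (y, r) else 0) \<partial>lborel)"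
        unfolding AE_all_countable using elim(2) y by simp
      from AE_affine[OF this, of 1 t]
      have b: "AE x in lborel. \<forall>n. - real (Suc n) < x + t \<and> x + t < real (Suc n) \<longrightarrow>
         F' (y, x + t) = k n y + (\<integral>r. (if r \<le> x + t then gn n (y, r) else 0) \<partial>lborel)"
        by (simp add: add.commute)
      show "AE x in lborel. ennreal \<bar>F0 (x + t, y) - F0 (x, y)\<bar> \<le> (\<integral>\<^sup>+r. ennreal \<bar>g1 (r, y)\<bar> * indicator {x<..<x+t} r \<partial>lborel)"
        using a b
      proof eventually_elim
        case (elim x)
        \<comment> \<open>A window containing both \<open>x\<close> and \<open>x + t\<close>; the
          constant \<open>k n y\<close> then cancels in the difference.\<close>
        obtain n where n: "\<bar>x\<bar> + t \<le> real n" using real_arch_simple by blast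
        have "F0 (x + t, y) - F0 (x, y) = (\<integral>r. (if r \<le> x + t then gn n (y, r) else 0) \<partial>lborel) - (\<integral>r. (if r \<le> x then gn n (y, r) else 0) \<partial>lborel)"
        proof -
          have "- real (Suc n) < x \<and> x < real (Suc n)" "- real (Suc n) < x + t \<and> x + t < real (Suc n)"
            using n t by auto
          with elim(1)[THEN spec, of n] elim(2)[THEN spec, of n] show ?thesis by (simp only: simp_thms) (simp add: F'_def)
        qed
        also have "ennreal \<bar>\<dots>\<bar> \<le> (\<integral>\<^sup>+r. ennreal \<bar>gn n (y, r)\<bar> * indicator {x<..<x+t} r \<partial>lborel)"
          by (rule indefinite_integral_diff_le) (use \<open>\<forall>n. integrable lborel (\<lambda>r. gn n (y, r))\<close> t in auto)
        also have "\<dots> \<le> (\<integral>\<^sup>+r. ennreal \<bar>g1 (r, y)\<bar> * indicator {x<..<x+t} r \<partial>lborel)"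
          by (intro nn_integral_mono mult_right_mono ennreal_leI) (auto simp: gn_def)
        finally show ?case .
      qed
    qed
  qed
  show ?thesis
    by (rule that[OF F0m g1m g2m f0m f1m _ norm H V0 V1 diff]) (simp add: F0_def)
qed

text \<open>The representation provides one pair of traces \<open>h0\<close>, \<open>h1\<close>; any
  other pair agrees with it almost everywhere. For the difference, Cauchy-Schwarz over a height of
  pi suffices, and local square integrability of a trace follows from its finite seminorm.\<close>

lemma trace_theorem:
  assumes H1: "in_H1 F G"
  shows "(\<exists>f0 f1. is_trace0 F f0 \<and> is_trace1 F f1) \<and>
        (\<forall>f0 f1. is_trace0 F f0 \<and> is_trace1 F f1 \<longrightarrow>
           in_Ht f0 \<and> in_Ht f1 \<and> in_L2 (\<lambda>x. f0 x - f1 x) \<and>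
           Ht_norm_sq f0 + Ht_norm_sq f1 + L2_norm_sq (\<lambda>x. f0 x - f1 x) \<le> ennreal 100 * H1_norm_sq G)"
proof -
  obtain F0 g1 g2 h0 h1 where [measurable]: "F0 \<in> borel_measurable borel" "g1 \<in> borel_measurable borel" "g2 \<in> borel_measurable borel"
    "h0 \<in> borel_measurable borel" "h1 \<in> borel_measurable borel"
    and F0: "\<And>p. p \<in> strip \<Longrightarrow> F0 p = F p"
    and norm: "(\<integral>\<^sup>+p. ennreal ((g1 p)\<^sup>2) \<partial>lborel) + (\<integral>\<^sup>+p. ennreal ((g2 p)\<^sup>2) \<partial>lborel) = H1_norm_sq G"
    and H: "AE y in lborel. 0 < y \<and> y < pi \<longrightarrow> (\<forall>t>0. AE x in lborel. ennreal \<bar>F0 (x + t, y) - F0 (x, y)\<bar> \<le>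
       (\<integral>\<^sup>+r. ennreal \<bar>g1 (r, y)\<bar> * indicator {x<..<x+t} r \<partial>lborel))"
    and V0: "AE p in lborel. p \<in> strip \<longrightarrow> ennreal \<bar>F0 p - h0 (fst p)\<bar> \<le>
       (\<integral>\<^sup>+s. ennreal \<bar>g2 (fst p, 0 + 1 * s)\<bar> * indicator {0<..<1 * (snd p - 0)} s \<partial>lborel)"
    and V1: "AE p in lborel. p \<in> strip \<longrightarrow> ennreal \<bar>F0 p - h1 (fst p)\<bar> \<le>
       (\<integral>\<^sup>+s. ennreal \<bar>g2 (fst p, pi + (- 1) * s)\<bar> * indicator {0<..<(- 1) * (snd p - pi)} s \<partial>lborel)"
    and D: "AE x in lborel. ennreal \<bar>h0 x - h1 x\<bar> \<le> (\<integral>\<^sup>+s. ennreal \<bar>g2 (x, s)\<bar> * indicator {0<..<pi} s \<partial>lborel)"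
    by (rule in_H1_representation[OF H1]) blast
  define X1 where "X1 = (\<integral>\<^sup>+p. ennreal ((g1 p)\<^sup>2) \<partial>lborel)"
  define X2 where "X2 = (\<integral>\<^sup>+p. ennreal ((g2 p)\<^sup>2) \<partial>lborel)"
  have N: "X1 + X2 = H1_norm_sq G" using norm by (simp add: X1_def X2_def)
  then have fin: "X1 + X2 < \<infinity>" using H1 by (simp add: in_H1_def)
  then have fin2: "X2 < \<infinity>" by (metis ennreal_add_less_top infinity_ennreal_def)
  have e0: "is_edge 1 0" and e1: "is_edge (- 1) pi" by (auto simp: is_edge_def)
  have t0: "trace_at 1 0 F h0"
    by (rule edge_trace[OF e0 _ _ _ F0 fin2[unfolded X2_def] V0]) measurable
  have t1: "trace_at (- 1) pi F h1"
    by (rule edge_trace[OF e1 _ _ _ F0 fin2[unfolded X2_def] V1]) measurable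
  have bound: "in_Ht f \<and> Ht_norm_sq f \<le> 48 * (X1 + X2)"
    if edge: "is_edge c e" and t: "trace_at c e F h" and f: "trace_at c e F f"
      and V: "AE p in lborel. p \<in> strip \<longrightarrow> ennreal \<bar>F0 p - h (fst p)\<bar> \<le>
       (\<integral>\<^sup>+s. ennreal \<bar>g2 (fst p, e + c * s)\<bar> * indicator {0<..<c * (snd p - e)} s \<partial>lborel)" for c e f h
  proof -
    have [measurable]: "f \<in> borel_measurable borel" using f by (auto simp: trace_at_def)
    have fh: "AE x in lborel. f x = h x" by (rule trace_at_unique[OF edge f t _ F0]) measurable
    \<comment> \<open>Equality of \<open>f\<close> and \<open>h\<close> outside a null set of
      abscissas gives equality outside a null set of the plane, so the bound carries over to an
      arbitrary trace.\<close>
    have V': "AE p in lborel. p \<in> strip \<longrightarrow> ennreal \<bar>F0 p - f (fst p)\<bar> \<le>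
       (\<integral>\<^sup>+s. ennreal \<bar>g2 (fst p, e + c * s)\<bar> * indicator {0<..<c * (snd p - e)} s \<partial>lborel)"
      using V AE_fst[OF fh] by eventually_elim simp
    have "Ht_norm_sq f = 2 * diff_quot_sq f" by (rule Ht_norm_sq_eq_diff_quot_sq) measurable
    also have "\<dots> \<le> 2 * (3 * (X1 + 8 * X2))"
      unfolding X1_def X2_def by (intro mult_left_mono edge_diff_quot_sq[OF edge _ _ _ _ V' H]) auto
    \<comment> \<open>Weakened to a multiple of the full energy; 48 = 2 * 3 * 8.\<close>
    also have "\<dots> \<le> 2 * (3 * (8 * X1 + 8 * X2))"
    proof (intro mult_left_mono add_mono order_refl)
      show "X1 \<le> 8 * X1" using mult_right_mono[of 1 8 X1] by simp
    qed auto
    also have "\<dots> = 48 * (X1 + X2)" by (simp add: distrib_left mult.assoc[symmetric])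
    finally have *: "Ht_norm_sq f \<le> 48 * (X1 + X2)" .
    moreover have "48 * (X1 + X2) < \<infinity>" using fin by (simp add: ennreal_mult_less_top)
    ultimately have Hf: "Ht_norm_sq f < \<infinity>" by (rule le_less_trans)
    moreover have "(\<integral>\<^sup>+x. ennreal ((f x)\<^sup>2) * indicator {a..b} x \<partial>lborel) < \<infinity>" for a b
      by (rule Ht_finite_imp_L2_loc[OF _ Hf]) measurable
    ultimately show ?thesis using * by (simp add: in_Ht_def)
  qed
  show ?thesis
  proof (intro conjI allI impI)
    show "\<exists>f0 f1. is_trace0 F f0 \<and> is_trace1 F f1"
      using t0 t1 by (auto simp: is_trace0_iff is_trace1_iff)
    fix f0 f1 assume "is_trace0 F f0 \<and> is_trace1 F f1"
    then have f0: "trace_at 1 0 F f0" and f1: "trace_at (- 1) pi F f1" by (auto simp: is_trace0_iff is_trace1_iff)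
    note b0 = bound[OF e0 t0 f0 V0] and b1 = bound[OF e1 t1 f1 V1]
    show "in_Ht f0" "in_Ht f1" using b0 b1 by auto
    have [measurable]: "f0 \<in> borel_measurable borel" "f1 \<in> borel_measurable borel" using f0 f1 by (auto simp: trace_at_def)
    have "AE x in lborel. f0 x = h0 x" by (rule trace_at_unique[OF e0 f0 t0 _ F0]) measurable
    moreover have "AE x in lborel. f1 x = h1 x" by (rule trace_at_unique[OF e1 f1 t1 _ F0]) measurable
    ultimately have "AE x in lborel. ennreal ((f0 x - f1 x)\<^sup>2) \<le> ennreal pi * (\<integral>\<^sup>+s. (ennreal \<bar>g2 (x, s)\<bar>)\<^sup>2 \<partial>lborel)"
      using D
    proof eventually_elim
      case (elim x)
      have "ennreal ((f0 x - f1 x)\<^sup>2) = (ennreal \<bar>f0 x - f1 x\<bar>)\<^sup>2" by (simp add: ennreal_power)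
      also have "\<dots> \<le> (\<integral>\<^sup>+s. ennreal \<bar>g2 (x, s)\<bar> * indicator {0<..<pi} s \<partial>lborel)\<^sup>2"
        using elim by (intro power_mono) auto
      also have "\<dots> \<le> ennreal (pi - 0) * (\<integral>\<^sup>+s. (ennreal \<bar>g2 (x, s)\<bar>)\<^sup>2 * indicator {0<..<pi} s \<partial>lborel)"
        by (rule nn_integral_square_le_length) auto
      also have "\<dots> \<le> ennreal pi * (\<integral>\<^sup>+s. (ennreal \<bar>g2 (x, s)\<bar>)\<^sup>2 \<partial>lborel)"
        by (intro mult_mono nn_integral_mono) (auto simp: indicator_def)
      finally show ?case .
    qed
    then have "L2_norm_sq (\<lambda>x. f0 x - f1 x) \<le> (\<integral>\<^sup>+x. ennreal pi * (\<integral>\<^sup>+s. (ennreal \<bar>g2 (x, s)\<bar>)\<^sup>2 \<partial>lborel) \<partial>lborel)"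
      unfolding L2_norm_sq_def by (rule nn_integral_mono_AE)
    also have "\<dots> = ennreal pi * (\<integral>\<^sup>+x. (\<integral>\<^sup>+s. (ennreal \<bar>g2 (x, s)\<bar>)\<^sup>2 \<partial>lborel) \<partial>lborel)"
      by (rule nn_integral_cmult) measurable
    also have "(\<integral>\<^sup>+x. (\<integral>\<^sup>+s. (ennreal \<bar>g2 (x, s)\<bar>)\<^sup>2 \<partial>lborel) \<partial>lborel) = X2"
      unfolding X2_def using plane_nn_integral(1)[of "\<lambda>p. (ennreal \<bar>g2 p\<bar>)\<^sup>2"] by (simp add: ennreal_power)
    also have "ennreal pi * X2 \<le> 4 * (X1 + X2)"
    proof (intro mult_mono)
      have "ennreal pi \<le> ennreal 4" using pi_less_4 by (intro ennreal_leI) simp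
      then show "ennreal pi \<le> 4" by simp
    qed auto
    finally have L: "L2_norm_sq (\<lambda>x. f0 x - f1 x) \<le> 4 * (X1 + X2)" .
    moreover have "4 * (X1 + X2) < \<infinity>" using fin by (simp add: ennreal_mult_less_top)
    ultimately have "L2_norm_sq (\<lambda>x. f0 x - f1 x) < \<infinity>" by (rule le_less_trans)
    then show "in_L2 (\<lambda>x. f0 x - f1 x)" by (simp add: in_L2_def)
    \<comment> \<open>Twice 48 for the two seminorms, and 4 as an upper bound for pi in the estimate
      of the difference.\<close>
    have "Ht_norm_sq f0 + Ht_norm_sq f1 + L2_norm_sq (\<lambda>x. f0 x - f1 x) \<le> 48 * (X1 + X2) + 48 * (X1 + X2) + 4 * (X1 + X2)"
      using b0 b1 L by (intro add_mono) auto
    also have "\<dots> = (48 + 48 + 4) * (X1 + X2)" by (simp only: distrib_right)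
    also have "\<dots> = ennreal 100 * H1_norm_sq G" by (simp add: N)
    finally show "Ht_norm_sq f0 + Ht_norm_sq f1 + L2_norm_sq (\<lambda>x. f0 x - f1 x) \<le> ennreal 100 * H1_norm_sq G" .
  qed
qed

section \<open>Integral kernels and weak derivatives\<close>

lemma integrable_product_lborel:
  fixes f :: "'a::euclidean_space \<Rightarrow> real" and g :: "'b::euclidean_space \<Rightarrow> real"
  assumes f: "integrable lborel f" and g: "integrable lborel g"
  shows "integrable (lborel \<Otimes>\<^sub>M lborel) (\<lambda>p. f (fst p) * g (snd p))"
proof -
  have [measurable]: "f \<in> borel_measurable borel" "g \<in> borel_measurable borel" using assms by auto
  show ?thesis
    by (rule lborel_pair.Fubini_integrable)
      (use assms in \<open>auto simp: abs_mult integrable_abs\<close>)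
qed

lemma integral_deriv_eq_0:
  fixes v v' :: "real \<Rightarrow> real"
  assumes v: "\<And>x. (v has_real_derivative v' x) (at x)" and v': "integrable lborel v'"
    and z: "\<And>x. x \<notin> {a..b} \<Longrightarrow> v x = 0"
  shows "(\<integral>x. v' x \<partial>lborel) = 0"
proof -
  \<comment> \<open>Enlarged by 1 so that both endpoints lie outside \<open>{a..b}\<close>, where
    \<open>v\<close> vanishes, even if that interval is a point or empty.\<close>
  define A B where "A = min a b - 1" and "B = max a b + 1"
  have AB: "A \<le> B" "{a..b} \<subseteq> {A..B}" by (auto simp: A_def B_def)
  have v0: "v A = 0" "v B = 0" by (rule z, auto simp: A_def B_def)+
  have "(v' has_integral (v B - v A)) {A..B}"
    by (rule fundamental_theorem_of_calculus[OF AB(1)])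
      (rule has_vector_derivative_at_within, rule v[unfolded has_real_derivative_iff_has_vector_derivative])
  then have "((\<lambda>x. if x \<in> {A..B} then v' x else 0) has_integral 0) UNIV"
    using v0 by (simp only: has_integral_restrict_UNIV) simp
  moreover have "(\<lambda>x. if x \<in> {A..B} then v' x else 0) = v'"
  proof
    fix x
    have "v' x = 0" if "x \<notin> {A..B}"
    proof (rule deriv_supported[OF v])
      show "x \<notin> {a..b}" using that AB(2) by blast
    qed (rule z)
    then show "(if x \<in> {A..B} then v' x else 0) = v' x" by simp
  qed
  ultimately have "(v' has_integral 0) UNIV" by simp
  with has_integral_integral_lborel[OF v'] show ?thesis by (rule has_integral_unique)
qed

lemma bounded_compact_support_integrable:
  fixes f :: "'a::euclidean_space \<Rightarrow> real"
  assumes [measurable]: "f \<in> borel_measurable borel" and "compact K" and b: "\<And>x. \<bar>f x\<bar> \<le> B" and z: "\<And>x. x \<notin> K \<Longrightarrow> f x = 0"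
  shows "integrable lborel f"
proof (rule Bochner_Integration.integrable_bound)
  show "integrable lborel (\<lambda>x. B * indicator K x :: real)"
    using \<open>compact K\<close> by (intro integrable_mult_right integrable_real_indicator)
      (use emeasure_bounded_finite[OF compact_imp_bounded[OF \<open>compact K\<close>]] in \<open>auto simp: borel_compact\<close>)
  show "AE x in lborel. norm (f x) \<le> norm (B * indicator K x)"
    using b z by (intro AE_I2) (auto simp: indicator_def intro: order_trans[OF b abs_ge_self])
qed simp

lemma integral_partial_eq_0:
  fixes u u' :: "real \<times> real \<Rightarrow> real"
  assumes u: "\<And>p. ((\<lambda>t. u (p + t *\<^sub>R i)) has_real_derivative u' p) (at 0)" and i: "i \<in> Basis"
    and u': "integrable lborel u'" and K: "compact K" and z: "\<And>p. p \<notin> K \<Longrightarrow> u p = 0"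
  shows "(\<integral>p. u' p \<partial>lborel) = 0"
proof -
  have [measurable]: "u' \<in> borel_measurable borel" using u' by simp
  obtain w where w: "K \<subseteq> cbox (- w) w" using bounded_subset_cbox_symmetric[OF compact_imp_bounded[OF K]] by blast
  obtain c a where wca: "w = (c, a)" by (cases w) auto
  have zx: "u (x, y) = 0" if "x \<notin> {- c..c} \<or> y \<notin> {- a..a}" for x y
  proof -
    have "(x, y) \<notin> cbox (- w) w" using that by (auto simp: wca cbox_Pair_eq)
    with w have "(x, y) \<notin> K" by blast
    then show ?thesis by (rule z)
  qed
  from i consider "i = (1, 0)" | "i = (0, 1)" by (auto simp: Basis_plane)
  then show ?thesis
  proof cases
    case 2
    have d: "((\<lambda>y. u (x, y)) has_real_derivative u' (x, y)) (at y)" for x y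
      using u[of "(x, y)"] DERIV_shift[of "\<lambda>y. u (x, y)" "u' (x, y)" 0 y] by (simp add: 2 add.commute)
    have "(\<integral>x. \<integral>y. u' (x, y) \<partial>lborel \<partial>lborel) = (\<integral>x. 0 \<partial>(lborel :: real measure))"
    proof (rule integral_cong_AE)
      show "AE x in lborel. (\<integral>y. u' (x, y) \<partial>lborel) = 0"
        using plane_integral_fst(1)[OF u']
      proof eventually_elim
        case (elim x)
        show ?case by (rule integral_deriv_eq_0[OF d elim, where a="-a" and b=a]) (use zx in auto)
      qed
    qed measurable
    then show ?thesis using plane_integral_fst(3)[OF u'] by simp
  next
    case 1
    have d: "((\<lambda>x. u (x, y)) has_real_derivative u' (x, y)) (at x)" for x y
      using u[of "(x, y)"] DERIV_shift[of "\<lambda>x. u (x, y)" "u' (x, y)" 0 x] by (simp add: 1 add.commute)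
    have "(\<integral>y. \<integral>x. u' (x, y) \<partial>lborel \<partial>lborel) = (\<integral>x. 0 \<partial>(lborel :: real measure))"
    proof (rule integral_cong_AE)
      show "AE y in lborel. (\<integral>x. u' (x, y) \<partial>lborel) = 0"
        using plane_integral_fst(1)[OF plane_integrable_swap[OF u']]
      proof eventually_elim
        case (elim y)
        then show ?case by (intro integral_deriv_eq_0[OF d, where a="-c" and b=c]) (use zx in auto)
      qed
    qed measurable
    then show ?thesis
      using plane_integral_fst(3)[OF plane_integrable_swap[OF u']] plane_integral_swap[of u'] by simp
  qed
qed

text \<open>A single step in the closed family behind \<open>smooth_fun\<close> yields a continuous
  derivative. It vanishes off \<open>K\<close> because \<open>\<phi>\<close> vanishes on the whole
  open complement, so one compact set and one bound serve both functions.\<close>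

lemma test_fun_partial:
  assumes "test_fun U \<phi>" "i \<in> Basis"
  obtains \<phi>' K B where "\<And>p. ((\<lambda>t. \<phi> (p + t *\<^sub>R i)) has_real_derivative \<phi>' p) (at 0)"
    "\<And>p. partial i \<phi> p = \<phi>' p" "\<phi> \<in> borel_measurable borel" "\<phi>' \<in> borel_measurable borel" "compact K" "K \<subseteq> U"
    "\<And>p. p \<notin> K \<Longrightarrow> \<phi> p = 0" "\<And>p. p \<notin> K \<Longrightarrow> \<phi>' p = 0" "\<And>p. \<bar>\<phi> p\<bar> \<le> B" "\<And>p. \<bar>\<phi>' p\<bar> \<le> B"
proof -
  obtain K where K: "compact K" "K \<subseteq> U" "\<And>p. p \<notin> K \<Longrightarrow> \<phi> p = 0" using assms(1) by (auto simp: test_fun_def)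
  from assms(1) obtain \<Phi> where \<Phi>: "\<phi> \<in> \<Phi>" and \<Phi>': "\<forall>\<psi>\<in>\<Phi>. continuous_on UNIV \<psi> \<and>
      (\<forall>i\<in>Basis. \<exists>\<psi>'\<in>\<Phi>. \<forall>p. ((\<lambda>t. \<psi> (p + t *\<^sub>R i)) has_real_derivative \<psi>' p) (at 0))"
    unfolding test_fun_def smooth_fun_def by (elim conjE exE)
  from bspec[OF conjunct2[OF bspec[OF \<Phi>' \<Phi>]] assms(2)]
  obtain \<phi>' where \<phi>'1: "\<phi>' \<in> \<Phi>" and \<phi>'2: "\<forall>p. ((\<lambda>t. \<phi> (p + t *\<^sub>R i)) has_real_derivative \<phi>' p) (at 0)"
    by (elim bexE)
  note \<phi>' = \<phi>'1 \<phi>'2[THEN spec]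
  have c: "continuous_on UNIV \<phi>" "continuous_on UNIV \<phi>'"
    by (rule conjunct1[OF bspec[OF \<Phi>' \<Phi>]], rule conjunct1[OF bspec[OF \<Phi>' \<phi>'1]])
  have z': "\<phi>' p = 0" if p: "p \<notin> K" for p
  proof -
    have "open ((\<lambda>t. p + t *\<^sub>R i) -` (- K))"
      using K(1) by (intro open_vimage) (auto simp: compact_imp_closed intro!: continuous_intros)
    then have "((\<lambda>t. \<phi> (p + t *\<^sub>R i)) has_real_derivative 0) (at 0)"
      by (rule has_field_derivative_transform_within_open[OF DERIV_const[of 0]]) (use p K(3) in auto)
    with \<phi>'(2)[of p] show ?thesis by (rule DERIV_unique)
  qed
  have "bounded (\<phi> ` K)" "bounded (\<phi>' ` K)"
    by (intro compact_imp_bounded compact_continuous_image continuous_on_subset[OF c(1)] continuous_on_subset[OF c(2)] K(1) subset_UNIV)+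
  then have "\<exists>B1. \<forall>p\<in>K. \<bar>\<phi> p\<bar> \<le> B1" "\<exists>B2. \<forall>p\<in>K. \<bar>\<phi>' p\<bar> \<le> B2"
    by (auto simp: bounded_iff)
  then obtain B1 B2 where B: "\<And>p. p \<in> K \<Longrightarrow> \<bar>\<phi> p\<bar> \<le> B1" "\<And>p. p \<in> K \<Longrightarrow> \<bar>\<phi>' p\<bar> \<le> B2"
    by blast
  define B where "B = max 0 (max B1 B2)"
  have b: "\<bar>\<phi> p\<bar> \<le> B" "\<bar>\<phi>' p\<bar> \<le> B" for p
    using B[of p] K(3)[of p] z'[of p] by (cases "p \<in> K"; simp add: B_def le_max_iff_disj)+
  show ?thesis
    by (rule that[OF \<phi>'(2) _ _ _ K(1,2,3) z' b])
      (simp_all add: partial_def DERIV_imp_deriv[OF \<phi>'(2)] borel_measurable_continuous_onI c)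
qed

text \<open>\<open>f\<close> is only locally integrable, and no derivative is taken under the
  integral sign. Instead Fubini moves the integral over \<open>p\<close> inside: for each
  \<open>r\<close> the product \<open>k r p * \<phi> p\<close> has compact support in
  \<open>p\<close>, so its partial derivative integrates to zero, which is the weak identity for
  that \<open>r\<close>.\<close>

lemma kernel_weak_partial:
  fixes f :: "real \<Rightarrow> real" and k k' :: "real \<Rightarrow> real \<times> real \<Rightarrow> real"
  assumes [measurable]: "f \<in> borel_measurable borel"
    and floc: "\<And>R. integrable lborel (\<lambda>r. f r * indicator {- R..R} r)"
    and km[measurable]: "(\<lambda>q. k (fst q) (snd q)) \<in> borel_measurable borel" "(\<lambda>q. k' (fst q) (snd q)) \<in> borel_measurable borel"
    and kd: "\<And>r p. p \<in> U \<Longrightarrow> ((\<lambda>t. k r (p + t *\<^sub>R i)) has_real_derivative k' r p) (at 0)"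
    and kb: "\<And>K. compact K \<Longrightarrow> K \<subseteq> U \<Longrightarrow> \<exists>C R. \<forall>p\<in>K. \<forall>r. \<bar>k r p\<bar> \<le> C \<and> \<bar>k' r p\<bar> \<le> C \<and> (r \<notin> {- R..R} \<longrightarrow> k r p = 0 \<and> k' r p = 0)"
    and i: "i \<in> Basis"
  shows "compact K \<Longrightarrow> K \<subseteq> U \<Longrightarrow> set_integrable lborel K (\<lambda>p. \<integral>r. f r * k r p \<partial>lborel)"
    and "test_fun U \<phi> \<Longrightarrow> integrable lborel (\<lambda>p. indicator U p * ((\<integral>r. f r * k r p \<partial>lborel) * partial i \<phi> p))"
    and "test_fun U \<phi> \<Longrightarrow> integrable lborel (\<lambda>p. indicator U p * ((\<integral>r. f r * k' r p \<partial>lborel) * \<phi> p))"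
    and "test_fun U \<phi> \<Longrightarrow> (\<integral>p. indicator U p * ((\<integral>r. f r * k r p \<partial>lborel) * partial i \<phi> p) \<partial>lborel) =
      - (\<integral>p. indicator U p * ((\<integral>r. f r * k' r p \<partial>lborel) * \<phi> p) \<partial>lborel)"
proof -
  \<comment> \<open>The hypothesis \<open>kb\<close> confines \<open>r\<close> to
    \<open>{- R..R}\<close> while \<open>p\<close> stays in the support of the test function, so a
    product of an integrable function of \<open>r\<close> and one of \<open>p\<close>
    dominates.\<close>
  have main: "integrable (lborel \<Otimes>\<^sub>M lborel) (\<lambda>(r, p). (f r * h r p) * w p)"
    if K: "compact K" "K \<subseteq> U" and h: "h = k \<or> h = k'" and [measurable]: "w \<in> borel_measurable borel" and w: "\<And>p. \<bar>w p\<bar> \<le> B" "\<And>p. p \<notin> K \<Longrightarrow> w p = 0"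
    for K h w B
  proof -
    obtain C R where CR: "\<And>p r. p \<in> K \<Longrightarrow> \<bar>h r p\<bar> \<le> C" "\<And>p r. p \<in> K \<Longrightarrow> r \<notin> {- R..R} \<Longrightarrow> h r p = 0"
      using kb[OF K] h by metis
    have hm[measurable]: "(\<lambda>q. h (fst q) (snd q)) \<in> borel_measurable borel" using km h by auto
    have hm': "(\<lambda>q. h (fst q) (snd q)) \<in> borel_measurable (lborel \<Otimes>\<^sub>M lborel)"
      using hm by (simp add: lborel_prod)
    show ?thesis
    proof (rule Bochner_Integration.integrable_bound)
      have wi: "integrable lborel w" by (rule bounded_compact_support_integrable[OF _ K(1) w]) simp
      show "integrable (lborel \<Otimes>\<^sub>M lborel) (\<lambda>q. (f (fst q) * indicator {- R..R} (fst q)) * (C * w (snd q)))"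
        by (rule integrable_product_lborel[OF floc]) (use wi in simp)
      show "(\<lambda>(r, p). (f r * h r p) * w p) \<in> borel_measurable (lborel \<Otimes>\<^sub>M lborel)"
        unfolding case_prod_beta' using hm' by measurable
      show "AE q in lborel \<Otimes>\<^sub>M lborel. norm (case q of (r, p) \<Rightarrow> (f r * h r p) * w p) \<le>
          norm ((f (fst q) * indicator {- R..R} (fst q)) * (C * w (snd q)))"
      proof (rule AE_I2)
        fix q :: "real \<times> real \<times> real"
        obtain r p where q: "q = (r, p)" by (cases q)
        show "norm (case q of (r, p) \<Rightarrow> (f r * h r p) * w p) \<le> norm ((f (fst q) * indicator {- R..R} (fst q)) * (C * w (snd q)))"
        proof (cases "p \<in> K \<and> r \<in> {- R..R}")
          case True
          then have "\<bar>h r p\<bar> \<le> \<bar>C\<bar>" using CR(1)[of p r] by linarith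
          then have "\<bar>f r\<bar> * \<bar>h r p\<bar> * \<bar>w p\<bar> \<le> \<bar>f r\<bar> * \<bar>C\<bar> * \<bar>w p\<bar>" by (intro mult_right_mono mult_left_mono) auto
          then show ?thesis using True by (simp add: q abs_mult mult.assoc)
        next
          case False
          then have "h r p = 0 \<or> w p = 0" using CR(2)[of p r] w(2)[of p] by blast
          then show ?thesis by (auto simp: q)
        qed
      qed
    qed
  qed
  have out: "(\<integral>r. (f r * h r p) * w p \<partial>lborel) = (\<integral>r. f r * h r p \<partial>lborel) * w p" for h p and w :: "real \<times> real \<Rightarrow> real"
    by (rule integral_mult_left_zero)
  have int: "integrable lborel (\<lambda>p. (\<integral>r. f r * h r p \<partial>lborel) * w p)"
    if "compact K" "K \<subseteq> U" "h = k \<or> h = k'" "w \<in> borel_measurable borel" "\<And>p. \<bar>w p\<bar> \<le> B" "\<And>p. p \<notin> K \<Longrightarrow> w p = 0"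
    for K h w B
    using lborel_pair.integrable_snd[OF main[OF that]] by (simp add: out)
  show "set_integrable lborel K (\<lambda>p. \<integral>r. f r * k r p \<partial>lborel)" if "compact K" "K \<subseteq> U"
  proof -
    have "integrable lborel (\<lambda>p. (\<integral>r. f r * k r p \<partial>lborel) * indicator K p)"
      by (rule int[OF that, where B=1]) (use that in \<open>auto simp: borel_compact intro!: borel_measurable_indicator\<close>)
    then show ?thesis by (simp add: set_integrable_def mult.commute)
  qed
  assume \<phi>: "test_fun U \<phi>"
  obtain \<phi>' K B where \<phi>': "\<And>p. ((\<lambda>t. \<phi> (p + t *\<^sub>R i)) has_real_derivative \<phi>' p) (at 0)"
    "\<And>p. partial i \<phi> p = \<phi>' p" and m[measurable]: "\<phi> \<in> borel_measurable borel" "\<phi>' \<in> borel_measurable borel" and K: "compact K" "K \<subseteq> U"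
    and z: "\<And>p. p \<notin> K \<Longrightarrow> \<phi> p = 0" "\<And>p. p \<notin> K \<Longrightarrow> \<phi>' p = 0" and B: "\<And>p. \<bar>\<phi> p\<bar> \<le> B" "\<And>p. \<bar>\<phi>' p\<bar> \<le> B"
    by (rule test_fun_partial[OF \<phi> i]) blast
  have ind: "indicator U p * (x * \<phi>' p) = x * \<phi>' p" "indicator U p * (x * \<phi> p) = x * \<phi> p" for p x
    using z[of p] K(2) by (auto simp: indicator_def)
  show "integrable lborel (\<lambda>p. indicator U p * ((\<integral>r. f r * k r p \<partial>lborel) * partial i \<phi> p))"
    unfolding \<phi>'(2) ind by (rule int[OF K _ m(2) B(2) z(2)]) simp
  show "integrable lborel (\<lambda>p. indicator U p * ((\<integral>r. f r * k' r p \<partial>lborel) * \<phi> p))"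
    unfolding ind by (rule int[OF K _ m(1) B(1) z(1)]) simp
  have I1: "integrable (lborel \<Otimes>\<^sub>M lborel) (\<lambda>(r, p). (f r * k r p) * \<phi>' p)"
    by (rule main[OF K _ m(2) B(2) z(2)]) simp
  have I2: "integrable (lborel \<Otimes>\<^sub>M lborel) (\<lambda>(r, p). (f r * k' r p) * \<phi> p)"
    by (rule main[OF K _ m(1) B(1) z(1)]) simp
  \<comment> \<open>The kernel is differentiable in \<open>U\<close> only. At points off
    \<open>K\<close> the product is zero in a neighbourhood along \<open>i\<close>, so the product
    rule holds in the whole plane.\<close>
  have inner: "(\<integral>p. k r p * \<phi>' p + k' r p * \<phi> p \<partial>lborel) = 0" for r
  proof (rule integral_partial_eq_0[where u="\<lambda>p. k r p * \<phi> p" and i=i and K=K])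
    fix p
    show "((\<lambda>t. k r (p + t *\<^sub>R i) * \<phi> (p + t *\<^sub>R i)) has_real_derivative k r p * \<phi>' p + k' r p * \<phi> p) (at 0)"
    proof (cases "p \<in> K")
      case True
      then show ?thesis using DERIV_mult'[OF kd[of p r] \<phi>'(1)[of p]] K(2) by auto
    next
      case False
      have "open ((\<lambda>t. p + t *\<^sub>R i) -` (- K))"
        using K(1) by (intro open_vimage) (auto simp: compact_imp_closed intro!: continuous_intros)
      then have "((\<lambda>t. k r (p + t *\<^sub>R i) * \<phi> (p + t *\<^sub>R i)) has_real_derivative 0) (at 0)"
        by (rule has_field_derivative_transform_within_open[OF DERIV_const[of 0]]) (use False z in auto)
      then show ?thesis using False z by simp
    qed
  next
    obtain C where C: "\<And>p. p \<in> K \<Longrightarrow> \<bar>k r p\<bar> \<le> C \<and> \<bar>k' r p\<bar> \<le> C" using kb[OF K] by blast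
    have [measurable]: "(\<lambda>p. k r p) \<in> borel_measurable borel" "(\<lambda>p. k' r p) \<in> borel_measurable borel"
      using measurable_compose[OF _ km(1), of "\<lambda>p. (r, p)"] measurable_compose[OF _ km(2), of "\<lambda>p. (r, p)"] by auto
    show "integrable lborel (\<lambda>p. k r p * \<phi>' p + k' r p * \<phi> p)"
    proof (rule bounded_compact_support_integrable[OF _ K(1)])
      show "\<bar>k r p * \<phi>' p + k' r p * \<phi> p\<bar> \<le> \<bar>C\<bar> * B + \<bar>C\<bar> * B" for p
      proof (cases "p \<in> K")
        case True
        then have "\<bar>k r p\<bar> \<le> \<bar>C\<bar>" "\<bar>k' r p\<bar> \<le> \<bar>C\<bar>" using C[of p] by linarith+
        then have "\<bar>k r p * \<phi>' p\<bar> \<le> \<bar>C\<bar> * B" "\<bar>k' r p * \<phi> p\<bar> \<le> \<bar>C\<bar> * B"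
          unfolding abs_mult using B[of p] by (auto intro!: mult_mono)
        then show ?thesis by linarith
      next
        case False
        have "0 \<le> B" using B(1)[of p] by linarith
        then show ?thesis using False z by simp
      qed
    qed (use z in auto)
  qed (use i K z in auto)
  have "(\<integral>p. (\<integral>r. (f r * k r p) * \<phi>' p \<partial>lborel) \<partial>lborel) + (\<integral>p. (\<integral>r. (f r * k' r p) * \<phi> p \<partial>lborel) \<partial>lborel)
    = (\<integral>r. (\<integral>p. (f r * k r p) * \<phi>' p \<partial>lborel) \<partial>lborel) + (\<integral>r. (\<integral>p. (f r * k' r p) * \<phi> p \<partial>lborel) \<partial>lborel)"
    using lborel_pair.Fubini_integral[OF I1] lborel_pair.Fubini_integral[OF I2] by simp
  also have "\<dots> = (\<integral>r. (\<integral>p. (f r * k r p) * \<phi>' p \<partial>lborel) + (\<integral>p. (f r * k' r p) * \<phi> p \<partial>lborel) \<partial>lborel)"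
    using lborel_pair.integrable_fst[OF I1] lborel_pair.integrable_fst[OF I2] by simp
  also have "\<dots> = (\<integral>r. 0 \<partial>(lborel :: real measure))"
  proof (rule integral_cong_AE)
    have "AE r in lborel. integrable lborel (\<lambda>p. (f r * k r p) * \<phi>' p)" using lborel_pair.AE_integrable_fst[OF I1] by simp
    moreover have "AE r in lborel. integrable lborel (\<lambda>p. (f r * k' r p) * \<phi> p)" using lborel_pair.AE_integrable_fst[OF I2] by simp
    ultimately show "AE r in lborel. (\<integral>p. (f r * k r p) * \<phi>' p \<partial>lborel) + (\<integral>p. (f r * k' r p) * \<phi> p \<partial>lborel) = 0"
    proof eventually_elim
      case (elim r)
      have "(\<integral>p. (f r * k r p) * \<phi>' p \<partial>lborel) + (\<integral>p. (f r * k' r p) * \<phi> p \<partial>lborel) =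
         (\<integral>p. (f r * k r p) * \<phi>' p + (f r * k' r p) * \<phi> p \<partial>lborel)"
        by (rule Bochner_Integration.integral_add[OF elim, symmetric])
      also have "\<dots> = (\<integral>p. f r * (k r p * \<phi>' p + k' r p * \<phi> p) \<partial>lborel)"
        by (rule Bochner_Integration.integral_cong) (auto simp: algebra_simps)
      also have "\<dots> = 0" using inner[of r] by simp
      finally show ?case .
    qed
    show "(\<lambda>r. (\<integral>p. (f r * k r p) * \<phi>' p \<partial>lborel) + (\<integral>p. (f r * k' r p) * \<phi> p \<partial>lborel)) \<in> borel_measurable lborel"
      using lborel_pair.integrable_fst[OF I1] lborel_pair.integrable_fst[OF I2] by (intro borel_measurable_add) auto
  qed simp
  finally show "(\<integral>p. indicator U p * ((\<integral>r. f r * k r p \<partial>lborel) * partial i \<phi> p) \<partial>lborel) =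
      - (\<integral>p. indicator U p * ((\<integral>r. f r * k' r p \<partial>lborel) * \<phi> p) \<partial>lborel)"
    unfolding \<phi>'(2) ind out by simp
qed

section \<open>The extension operator\<close>

text \<open>Its square is continuously differentiable also at 0 and 1, and a single derivative of
  the averaging kernel is all that is taken. The factor 30 in \<open>rho\<close> is the reciprocal
  of the integral of the squared hump.\<close>

definition hump :: "real \<Rightarrow> real" where "hump s = max 0 (s * (1 - s))"

text \<open>
  The kernel \<open>tau\<close> is \<open>- d(s rho(s))/ds\<close>; it appears when \<open>rho((r - x) / l) / l\<close> is differentiated in \<open>l\<close>.
\<close>

definition rho :: "real \<Rightarrow> real" where "rho s = 30 * (hump s)\<^sup>2"
definition rho' :: "real \<Rightarrow> real" where "rho' s = 60 * hump s * (1 - 2 * s)"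
definition tau :: "real \<Rightarrow> real" where "tau s = - (rho s + s * rho' s)"

text \<open>The value 20 is a common bound for \<open>rho\<close> (at most 2), \<open>rho'\<close>
  (at most 15) and \<open>tau\<close> (at most 17), so that each estimate is proved once for all
  three.\<close>

definition is_kernel :: "(real \<Rightarrow> real) \<Rightarrow> bool" where
  "is_kernel \<kappa> \<longleftrightarrow> \<kappa> \<in> borel_measurable borel \<and> (\<forall>s. \<bar>\<kappa> s\<bar> \<le> 20) \<and> (\<forall>s. s \<notin> {0..1} \<longrightarrow> \<kappa> s = 0)"

lemma DERIV_max0_square: "((\<lambda>x::real. (max 0 x)\<^sup>2) has_real_derivative 2 * max 0 x) (at x)"
proof (cases x "0::real" rule: linorder_cases)
  case less
  have "((\<lambda>x. 0) has_real_derivative 0) (at x)" by simp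
  then have "((\<lambda>x::real. (max 0 x)\<^sup>2) has_real_derivative 0) (at x)"
    by (rule has_field_derivative_transform_within_open[where S="{..<0}"]) (use less in auto)
  then show ?thesis using less by simp
next
  case greater
  have "((\<lambda>x. x\<^sup>2) has_real_derivative 2 * x) (at x)" by (auto intro!: derivative_eq_intros)
  then have "((\<lambda>x::real. (max 0 x)\<^sup>2) has_real_derivative 2 * x) (at x)"
    by (rule has_field_derivative_transform_within_open[where S="{0<..}"]) (use greater in auto)
  then show ?thesis using greater by simp
next
  case equal
  have "((\<lambda>h::real. (max 0 h)\<^sup>2 / h) \<longlongrightarrow> 0) (at 0)"
  proof (rule Lim_null_comparison)
    show "((\<lambda>h::real. \<bar>h\<bar>) \<longlongrightarrow> 0) (at 0)" by (rule tendsto_rabs_zero) (rule tendsto_ident_at)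
    show "\<forall>\<^sub>F h in at 0. norm ((max 0 h)\<^sup>2 / h) \<le> \<bar>h\<bar>"
      by (rule always_eventually) (auto simp: max_def power2_eq_square)
  qed
  then show ?thesis using equal by (simp add: DERIV_def)
qed

lemma rho_deriv: "(rho has_real_derivative rho' s) (at s)"
proof -
  have "((\<lambda>s. s * (1 - s)) has_real_derivative (1 - 2 * s)) (at s)"
    by (auto intro!: derivative_eq_intros)
  from DERIV_cmult[OF DERIV_chain2[OF DERIV_max0_square this], of 30] show ?thesis
    by (simp add: rho_def[abs_def] rho'_def hump_def algebra_simps)
qed

lemma hump_bounds: "0 \<le> hump s" "hump s \<le> 1 / 4" "s \<notin> {0..1} \<Longrightarrow> hump s = 0" "s \<notin> {0<..<1} \<Longrightarrow> hump s = 0"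
proof -
  show "0 \<le> hump s" by (simp add: hump_def)
  have "s * (1 - s) \<le> 1 / 4" using zero_le_power2[of "s - 1 / 2"] by (simp add: power2_eq_square algebra_simps)
  then show "hump s \<le> 1 / 4" by (simp add: hump_def)
  show *: "s \<notin> {0<..<1} \<Longrightarrow> hump s = 0" by (auto simp: hump_def max_def zero_le_mult_iff)
  show "s \<notin> {0..1} \<Longrightarrow> hump s = 0" using * by auto
qed

lemma rho_bounds: "\<bar>rho s\<bar> \<le> 2" "\<bar>rho' s\<bar> \<le> 15" "\<bar>s * rho' s\<bar> \<le> 15"
proof -
  have "(hump s)\<^sup>2 \<le> (1/4)\<^sup>2" using hump_bounds by (intro power_mono) auto
  then show "\<bar>rho s\<bar> \<le> 2" by (simp add: rho_def power2_eq_square)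
  show r: "\<bar>rho' s\<bar> \<le> 15"
  proof (cases "s \<in> {0..1}")
    case True
    then have "hump s * \<bar>1 - 2 * s\<bar> \<le> 1 / 4 * 1" using hump_bounds by (intro mult_mono) auto
    then show ?thesis using hump_bounds(1)[of s] by (simp add: rho'_def abs_mult)
  qed (simp add: rho'_def hump_bounds)
  show "\<bar>s * rho' s\<bar> \<le> 15"
  proof (cases "s \<in> {0..1}")
    case True
    then have "\<bar>s\<bar> * \<bar>rho' s\<bar> \<le> 1 * 15" using r by (intro mult_mono) auto
    then show ?thesis by (simp add: abs_mult)
  qed (simp add: rho'_def hump_bounds)
qed

lemma rho_measurable [measurable]: "hump \<in> borel_measurable borel" "rho \<in> borel_measurable borel" "rho' \<in> borel_measurable borel" "tau \<in> borel_measurable borel"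
proof -
  show [measurable]: "hump \<in> borel_measurable borel" unfolding hump_def[abs_def] by measurable
  show [measurable]: "rho \<in> borel_measurable borel" unfolding rho_def[abs_def] by measurable
  show [measurable]: "rho' \<in> borel_measurable borel" unfolding rho'_def[abs_def] by measurable
  show "tau \<in> borel_measurable borel" unfolding tau_def[abs_def] by measurable
qed

lemma is_kernel_rho: "is_kernel rho" "is_kernel rho'" "is_kernel tau"
proof -
  have "is_kernel rho \<and> is_kernel rho'"
  proof -
    have "\<bar>rho s\<bar> \<le> 20" "\<bar>rho' s\<bar> \<le> 20" for s using rho_bounds(1,2)[of s] by linarith+
    moreover have "s \<notin> {0..1} \<Longrightarrow> rho s = 0" "s \<notin> {0..1} \<Longrightarrow> rho' s = 0" for s
      using hump_bounds(3) by (auto simp: rho_def rho'_def)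
    ultimately show ?thesis unfolding is_kernel_def by simp
  qed
  then show "is_kernel rho" "is_kernel rho'" by auto
  have "\<bar>tau s\<bar> \<le> 20" for s using rho_bounds(1,3)[of s] unfolding tau_def by linarith
  then show "is_kernel tau"
    unfolding is_kernel_def using hump_bounds(3) by (auto simp: tau_def rho_def rho'_def)
qed

lemma kernel_integrable: "is_kernel \<kappa> \<Longrightarrow> integrable lborel \<kappa>"
  by (rule bounded_compact_support_integrable[of _ "{0..1}" 20]) (auto simp: is_kernel_def)

text \<open>Mass one lets the averages of \<open>f\<close> return \<open>f\<close> at the edge. The
  other two means vanish because \<open>rho'\<close> and \<open>tau\<close> are derivatives of
  \<open>rho s\<close> and \<open>- (s * rho s)\<close>, both supported in the unit
  interval.\<close>

lemma rho_integral: "(\<integral>s. rho s \<partial>lborel) = 1" "(\<integral>s. rho' s \<partial>lborel) = 0" "(\<integral>s. tau s \<partial>lborel) = 0"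
proof -
  have "(\<integral>s. (30 * (s * (1 - s))\<^sup>2) * indicator {0..1} s \<partial>lborel) = (10 * 1^3 - 15 * 1^4 + 6 * 1^5) - (10 * 0^3 - 15 * 0^4 + 6 * 0^5 :: real)"
    by (rule integral_FTC_Icc_real[where F="\<lambda>s. 10 * s^3 - 15 * s^4 + 6 * s^5"])
      (auto intro!: derivative_eq_intros continuous_intros simp: algebra_simps power2_eq_square power3_eq_cube power4_eq_xxxx)
  moreover have "(30 * (s * (1 - s))\<^sup>2) * indicator {0..1} s = rho s" for s :: real
  proof (cases "s \<in> {0..1}")
    case True
    then have "0 \<le> s * (1 - s)" by simp
    then show ?thesis using True by (simp add: rho_def hump_def max_absorb2)
  qed (simp add: rho_def hump_bounds)
  ultimately show "(\<integral>s. rho s \<partial>lborel) = 1" by simp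
  show "(\<integral>s. rho' s \<partial>lborel) = 0"
    by (rule integral_deriv_eq_0[OF rho_deriv kernel_integrable[OF is_kernel_rho(2)], of 0 1])
      (simp add: rho_def hump_bounds)
  have "((\<lambda>s. - (s * rho s)) has_real_derivative tau s) (at s)" for s
    using DERIV_minus[OF DERIV_mult[OF DERIV_ident rho_deriv]] by (simp add: tau_def mult.commute)
  then show "(\<integral>s. tau s \<partial>lborel) = 0"
    by (rule integral_deriv_eq_0[OF _ kernel_integrable[OF is_kernel_rho(3)], of _ 0 1])
      (simp add: rho_def hump_bounds)
qed

section \<open>Averages of boundary functions and their difference quotients\<close>

definition avg :: "(real \<Rightarrow> real) \<Rightarrow> (real \<Rightarrow> real) \<Rightarrow> real \<Rightarrow> real \<Rightarrow> real" where
  "avg \<kappa> f x t = (\<integral>s. f (x + s * t) * \<kappa> s \<partial>lborel)"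

definition avg_quotient :: "(real \<Rightarrow> real) \<Rightarrow> (real \<Rightarrow> real) \<Rightarrow> real \<Rightarrow> real \<Rightarrow> real" where
  "avg_quotient \<kappa> f x t = (\<integral>s. (f (x + s * t) - f x) * \<kappa> s \<partial>lborel) / t"

definition locally_L1 :: "(real \<Rightarrow> real) \<Rightarrow> bool" where
  "locally_L1 f \<longleftrightarrow> f \<in> borel_measurable borel \<and> (\<forall>a b. integrable lborel (\<lambda>r. f r * indicator {a..b} r))"

lemma in_Ht_locally_L1:
  assumes "in_Ht f"
  shows "locally_L1 f"
  unfolding locally_L1_def
proof (intro conjI allI)
  show [measurable]: "f \<in> borel_measurable borel" using assms by (simp add: in_Ht_def)
  fix a b :: real
  have "(\<integral>\<^sup>+x. ennreal ((f x)\<^sup>2) * indicator {a..b} x \<partial>lborel) < \<infinity>" using assms by (simp add: in_Ht_def)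
  moreover have "ennreal (norm ((f x)\<^sup>2 * indicator {a..b} x)) = ennreal ((f x)\<^sup>2) * indicator {a..b} x" for x
    by (auto simp: indicator_def)
  ultimately have "integrable lborel (\<lambda>x. (f x)\<^sup>2 * indicator {a..b} x)" by (simp add: integrable_iff_bounded)
  moreover have "integrable lborel (indicator {a..b} :: real \<Rightarrow> real)"
    by (intro integrable_real_indicator) (auto simp: emeasure_lborel_Icc_eq)
  ultimately have "integrable lborel (\<lambda>x. (f x)\<^sup>2 * indicator {a..b} x + indicator {a..b} x)"
    by (rule Bochner_Integration.integrable_add)
  then show "integrable lborel (\<lambda>r. f r * indicator {a..b} r)"
  proof (rule Bochner_Integration.integrable_bound)
    have "\<bar>f x\<bar> \<le> (f x)\<^sup>2 + 1" for x
      using sum_squares_bound[of "\<bar>f x\<bar>" 1] by (simp add: power2_eq_square)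
    then show "AE x in lborel. norm (f x * indicator {a..b} x) \<le> norm ((f x)\<^sup>2 * indicator {a..b} x + indicator {a..b} x)"
      by (intro AE_I2) (auto simp: indicator_def)
  qed simp
qed

lemma kernel_mult_integrable:
  assumes f: "locally_L1 f" and \<kappa>: "is_kernel \<kappa>" and t: "0 < t"
  shows "integrable lborel (\<lambda>s. f (x + s * t) * \<kappa> s)"
proof (rule Bochner_Integration.integrable_bound)
  have [measurable]: "f \<in> borel_measurable borel" "\<kappa> \<in> borel_measurable borel"
    using f \<kappa> by (auto simp: locally_L1_def is_kernel_def)
  have "integrable lborel (\<lambda>s. f (x + t * s) * indicator {x..x+t} (x + t * s))"
    using f t by (intro lborel_integrable_real_affine[where f="\<lambda>r. f r * indicator {x..x+t} r"]) (auto simp: locally_L1_def)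
  then show "integrable lborel (\<lambda>s. 20 * (f (x + t * s) * indicator {x..x+t} (x + t * s)))" by simp
  show "(\<lambda>s. f (x + s * t) * \<kappa> s) \<in> borel_measurable lborel" by measurable
  show "AE s in lborel. norm (f (x + s * t) * \<kappa> s) \<le> norm (20 * (f (x + t * s) * indicator {x..x+t} (x + t * s)))"
  proof (rule AE_I2)
    fix s
    show "norm (f (x + s * t) * \<kappa> s) \<le> norm (20 * (f (x + t * s) * indicator {x..x+t} (x + t * s)))"
    proof (cases "s \<in> {0..1}")
      case True
      then have "x + t * s \<in> {x..x+t}" using t by auto
      moreover have "\<bar>f (x + s * t)\<bar> * \<bar>\<kappa> s\<bar> \<le> \<bar>f (x + s * t)\<bar> * 20"
        using \<kappa> by (intro mult_left_mono) (auto simp: is_kernel_def)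
      ultimately show ?thesis by (simp add: abs_mult mult.commute)
    next
      case False
      then show ?thesis using \<kappa> by (simp add: is_kernel_def)
    qed
  qed
qed

text \<open>Separates the value at \<open>x\<close>, weighted by the mass of the kernel, from the
  increments. For a kernel of mean zero the average is thus of order \<open>t\<close>, and a factor
  1 / t in front of it is harmless.\<close>

lemma avg_eq:
  assumes f: "locally_L1 f" and \<kappa>: "is_kernel \<kappa>" and t: "0 < t"
  shows "avg \<kappa> f x t = f x * (\<integral>s. \<kappa> s \<partial>lborel) + t * avg_quotient \<kappa> f x t"
proof -
  have "t * avg_quotient \<kappa> f x t = (\<integral>s. f (x + s * t) * \<kappa> s - f x * \<kappa> s \<partial>lborel)"
    using t by (simp add: avg_quotient_def left_diff_distrib)
  also have "\<dots> = avg \<kappa> f x t - f x * (\<integral>s. \<kappa> s \<partial>lborel)"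
    unfolding avg_def using kernel_mult_integrable[OF assms] kernel_integrable[OF \<kappa>] by simp
  finally show ?thesis by simp
qed

text \<open>The kernel is bounded by 20 on the unit interval, whose length is 1; Cauchy-Schwarz
  gives 400 = 20 * 20.\<close>

lemma avg_quotient_square_le:
  assumes f: "locally_L1 f" and \<kappa>: "is_kernel \<kappa>" and t: "0 < t"
  shows "ennreal ((avg_quotient \<kappa> f x t)\<^sup>2) \<le> 400 * (\<integral>\<^sup>+s. ennreal ((f (x + s * t) - f x)\<^sup>2 / t\<^sup>2) * indicator {0<..<1} s \<partial>lborel)"
proof -
  have [measurable]: "f \<in> borel_measurable borel" "\<kappa> \<in> borel_measurable borel"
    using f \<kappa> by (auto simp: locally_L1_def is_kernel_def)
  have i: "integrable lborel (\<lambda>s. (f (x + s * t) - f x) * \<kappa> s)"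
    using kernel_mult_integrable[OF assms] kernel_integrable[OF \<kappa>] by (simp add: left_diff_distrib)
  define u where "u s = ennreal (\<bar>f (x + s * t) - f x\<bar> / t)" for s
  have [measurable]: "u \<in> borel_measurable borel" unfolding u_def by measurable
  have "ennreal \<bar>avg_quotient \<kappa> f x t\<bar> = ennreal (norm (\<integral>s. (f (x + s * t) - f x) * \<kappa> s / t \<partial>lborel))"
    by (simp add: avg_quotient_def)
  also have "\<dots> \<le> (\<integral>\<^sup>+s. ennreal (norm ((f (x + s * t) - f x) * \<kappa> s / t)) \<partial>lborel)"
    using i by (intro integral_norm_bound_ennreal) simp
  also have "\<dots> \<le> (\<integral>\<^sup>+s. 20 * (u s * indicator {0<..<1} s) \<partial>lborel)"
  proof (rule nn_integral_mono_AE)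
    show "AE s in lborel. ennreal (norm ((f (x + s * t) - f x) * \<kappa> s / t)) \<le> 20 * (u s * indicator {0<..<1} s)"
      using AE_lborel_singleton[of 0] AE_lborel_singleton[of 1]
    proof eventually_elim
      case (elim s)
      show ?case
      proof (cases "s \<in> {0..1}")
        case True
        have "norm ((f (x + s * t) - f x) * \<kappa> s / t) = \<bar>\<kappa> s\<bar> * (\<bar>f (x + s * t) - f x\<bar> / t)"
          using t by (simp add: abs_mult)
        also have "\<dots> \<le> 20 * (\<bar>f (x + s * t) - f x\<bar> / t)"
          using \<kappa> t by (intro mult_right_mono) (auto simp: is_kernel_def)
        finally have "ennreal (norm ((f (x + s * t) - f x) * \<kappa> s / t)) \<le> ennreal (20 * (\<bar>f (x + s * t) - f x\<bar> / t))"
          by (rule ennreal_leI)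
        also have "\<dots> = 20 * u s" unfolding u_def using t by (subst ennreal_mult) auto
        finally show ?thesis using True elim by simp
      next
        case False
        then show ?thesis using \<kappa> by (simp add: is_kernel_def)
      qed
    qed
  qed
  also have "\<dots> = 20 * (\<integral>\<^sup>+s. u s * indicator {0<..<1} s \<partial>lborel)" by (rule nn_integral_cmult) measurable
  finally have "(ennreal \<bar>avg_quotient \<kappa> f x t\<bar>)\<^sup>2 \<le> (20 * (\<integral>\<^sup>+s. u s * indicator {0<..<1} s \<partial>lborel))\<^sup>2"
    by (rule power_mono) simp
  also have "\<dots> = 400 * (\<integral>\<^sup>+s. u s * indicator {0<..<1} s \<partial>lborel)\<^sup>2" by (simp add: power_mult_distrib)
  also have "\<dots> \<le> 400 * (ennreal (1 - 0) * (\<integral>\<^sup>+s. (u s)\<^sup>2 * indicator {0<..<1} s \<partial>lborel))"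
    by (intro mult_left_mono nn_integral_square_le_length) auto
  also have "\<dots> = 400 * (\<integral>\<^sup>+s. ennreal ((f (x + s * t) - f x)\<^sup>2 / t\<^sup>2) * indicator {0<..<1} s \<partial>lborel)"
    using t by (simp add: u_def ennreal_power power_divide)
  finally show ?thesis by (simp add: ennreal_power)
qed

text \<open>The width of the average equals the distance to the edge divided by pi. Taking it as
  integration variable has Jacobian pi \<le> 4, whence 1600 = 400 * 4, and leaves the averaged
  quotients already compared with the seminorm.\<close>

lemma avg_quotient_L2:
  assumes edge: "is_edge c e" and f: "locally_L1 f" and \<kappa>: "is_kernel \<kappa>"
  shows "(\<integral>\<^sup>+p. ennreal ((avg_quotient \<kappa> f (fst p) (c * (snd p - e) / pi))\<^sup>2) * indicator strip p \<partial>lborel) \<le> 1600 * diff_quot_sq f"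
proof -
  have [measurable]: "f \<in> borel_measurable borel" using f by (auto simp: locally_L1_def)
  define \<Phi> where "\<Phi> x t = (\<integral>\<^sup>+s. ennreal ((f (x + s * t) - f x)\<^sup>2 / t\<^sup>2) * indicator {0<..<1} s \<partial>lborel)" for x t
  have \<Phi>m[measurable]: "case_prod \<Phi> \<in> borel_measurable (borel \<Otimes>\<^sub>M borel)"
  proof -
    have "(\<lambda>p. \<integral>\<^sup>+s. ennreal ((f (fst p + s * snd p) - f (fst p))\<^sup>2 / (snd p)\<^sup>2) * indicator {0<..<1} s \<partial>lborel) \<in> borel_measurable (borel \<Otimes>\<^sub>M borel)"
      by measurable
    then show ?thesis by (simp add: \<Phi>_def case_prod_beta')
  qed
  define T where "T y = c * (y - e) / pi" for y
  have [measurable]: "T \<in> borel_measurable borel" unfolding T_def by measurable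
  have "(\<integral>\<^sup>+p. ennreal ((avg_quotient \<kappa> f (fst p) (c * (snd p - e) / pi))\<^sup>2) * indicator strip p \<partial>lborel) \<le>
    (\<integral>\<^sup>+p. 400 * (\<Phi> (fst p) (T (snd p)) * indicator {0<..<1} (T (snd p))) \<partial>lborel)"
  proof (rule nn_integral_mono)
    fix p :: "real \<times> real"
    show "ennreal ((avg_quotient \<kappa> f (fst p) (c * (snd p - e) / pi))\<^sup>2) * indicator strip p \<le> 400 * (\<Phi> (fst p) (T (snd p)) * indicator {0<..<1} (T (snd p)))"
    proof (cases "p \<in> strip")
      case True
      then have "0 < T (snd p) \<and> T (snd p) < 1"
        using edge by (auto simp: T_def strip_def is_edge_def)
      then show ?thesis using avg_quotient_square_le[OF f \<kappa>, of "T (snd p)" "fst p"] True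
        by (simp add: \<Phi>_def T_def)
    qed simp
  qed
  also have "\<dots> = 400 * (\<integral>\<^sup>+p. \<Phi> (fst p) (T (snd p)) * indicator {0<..<1} (T (snd p)) \<partial>lborel)"
    by (rule nn_integral_cmult) measurable
  also have "(\<integral>\<^sup>+p. \<Phi> (fst p) (T (snd p)) * indicator {0<..<1} (T (snd p)) \<partial>lborel) =
     (\<integral>\<^sup>+x. \<integral>\<^sup>+y. \<Phi> x (T y) * indicator {0<..<1} (T y) \<partial>lborel \<partial>lborel)"
    using plane_nn_integral(1)[of "\<lambda>p. \<Phi> (fst p) (T (snd p)) * indicator {0<..<1} (T (snd p))"] by simp
  also have "\<dots> = (\<integral>\<^sup>+x. ennreal pi * (\<integral>\<^sup>+t. \<Phi> x t * indicator {0<..<1} t \<partial>lborel) \<partial>lborel)"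
  proof (rule nn_integral_cong)
    fix x
    have c: "\<bar>c * pi\<bar> = pi" "c * pi \<noteq> 0" using is_edge_cases[OF edge] by (auto simp: abs_mult)
    have TT: "T (e + (c * pi) * t) = t" for t
      using is_edge_cases(3)[OF edge] by (simp add: T_def mult.assoc[symmetric])
    have "(\<integral>\<^sup>+y. \<Phi> x (T y) * indicator {0<..<1} (T y) \<partial>lborel) = ennreal \<bar>c * pi\<bar> *
       (\<integral>\<^sup>+t. \<Phi> x (T (e + (c * pi) * t)) * indicator {0<..<1} (T (e + (c * pi) * t)) \<partial>lborel)"
      using c(2) by (intro nn_integral_real_affine) auto
    then show "(\<integral>\<^sup>+y. \<Phi> x (T y) * indicator {0<..<1} (T y) \<partial>lborel) = ennreal pi * (\<integral>\<^sup>+t. \<Phi> x t * indicator {0<..<1} t \<partial>lborel)"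
      by (simp only: TT c)
  qed
  also have "\<dots> = ennreal pi * (\<integral>\<^sup>+x. (\<integral>\<^sup>+t. \<Phi> x t * indicator {0<..<1} t \<partial>lborel) \<partial>lborel)"
    by (rule nn_integral_cmult) measurable
  also have "(\<integral>\<^sup>+x. (\<integral>\<^sup>+t. \<Phi> x t * indicator {0<..<1} t \<partial>lborel) \<partial>lborel) = (\<integral>\<^sup>+t. (\<integral>\<^sup>+x. \<Phi> x t * indicator {0<..<1} t \<partial>lborel) \<partial>lborel)"
    by (rule lborel_pair.Fubini'[symmetric]) measurable
  also have "\<dots> = (\<integral>\<^sup>+t. (\<integral>\<^sup>+x. \<Phi> x t \<partial>lborel) * indicator {0<..<1} t \<partial>lborel)"
    by (intro nn_integral_cong nn_integral_multc) measurable
  also have "400 * (ennreal pi * \<dots>) \<le> 400 * (4 * diff_quot_sq f)"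
  proof (intro mult_left_mono mult_mono)
    show "(\<integral>\<^sup>+t. (\<integral>\<^sup>+x. \<Phi> x t \<partial>lborel) * indicator {0<..<1} t \<partial>lborel) \<le> diff_quot_sq f"
      unfolding \<Phi>_def by (rule averaged_difference_quotients_le_diff_quot_sq) measurable
    have "ennreal pi \<le> ennreal 4" using pi_less_4 by (intro ennreal_leI) simp
    then show "ennreal pi \<le> 4" by simp
  qed auto
  finally show ?thesis by (simp add: mult.assoc[symmetric])
qed

text \<open>
  At distance \<open>d\<close> from the edge the averages have width \<open>d / pi < 1\<close>, so that only increments of
  length at most \<open>1\<close> are involved, as in the seminorm.
\<close>

definition edge_ratio :: "real \<Rightarrow> real \<Rightarrow> real \<Rightarrow> real" where "edge_ratio c e y = c * (y - e) / pi"

lemma edge_ratio_bounds: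
  assumes "is_edge c e" "p \<in> strip"
  shows "0 < edge_ratio c e (snd p)" "edge_ratio c e (snd p) < 1"
  using assms by (auto simp: edge_ratio_def is_edge_def strip_def)

lemma edge_ratio_measurable [measurable]: "edge_ratio c e \<in> borel_measurable borel"
  unfolding edge_ratio_def[abs_def] by measurable

text \<open>The contribution of a single edge: the weight is 1 on that edge and 0 on the opposite
  one.\<close>

definition edge_ext :: "real \<Rightarrow> real \<Rightarrow> (real \<Rightarrow> real) \<Rightarrow> real \<times> real \<Rightarrow> real" where
  "edge_ext c e f p = (1 - edge_ratio c e (snd p)) * avg rho f (fst p) (edge_ratio c e (snd p))"

text \<open>The derivative in x falls on the kernel; the minus sign is that of x in
  \<open>(r - x) / l\<close>.\<close>

definition edge_ext_x :: "real \<Rightarrow> real \<Rightarrow> (real \<Rightarrow> real) \<Rightarrow> real \<times> real \<Rightarrow> real" where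
  "edge_ext_x c e f p = - ((1 - edge_ratio c e (snd p)) / edge_ratio c e (snd p) * avg rho' f (fst p) (edge_ratio c e (snd p)))"

text \<open>The factor \<open>c / pi\<close> is the derivative of the ratio. In the bracket,
  \<open>tau\<close> comes from varying the width of the average and the last term from varying the
  weight.\<close>

definition edge_ext_y :: "real \<Rightarrow> real \<Rightarrow> (real \<Rightarrow> real) \<Rightarrow> real \<times> real \<Rightarrow> real" where
  "edge_ext_y c e f p = c / pi * ((1 - edge_ratio c e (snd p)) / edge_ratio c e (snd p) * avg tau f (fst p) (edge_ratio c e (snd p))
     - avg rho f (fst p) (edge_ratio c e (snd p)))"

text \<open>The extension as an integral of \<open>f r\<close> against a kernel, after the
  substitution r = x + s l. In this form \<open>f\<close> no longer depends on the point, and all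
  differentiation concerns the kernel.\<close>

definition edge_ker :: "real \<Rightarrow> real \<Rightarrow> real \<Rightarrow> real \<times> real \<Rightarrow> real" where
  "edge_ker c e r p = (1 - edge_ratio c e (snd p)) * (1 / edge_ratio c e (snd p) * rho ((r - fst p) / edge_ratio c e (snd p)))"

definition edge_ker_x :: "real \<Rightarrow> real \<Rightarrow> real \<Rightarrow> real \<times> real \<Rightarrow> real" where
  "edge_ker_x c e r p = - ((1 - edge_ratio c e (snd p)) / edge_ratio c e (snd p)) * (1 / edge_ratio c e (snd p) * rho' ((r - fst p) / edge_ratio c e (snd p)))"

definition edge_ker_y :: "real \<Rightarrow> real \<Rightarrow> real \<Rightarrow> real \<times> real \<Rightarrow> real" where
  "edge_ker_y c e r p = c / pi * ((1 - edge_ratio c e (snd p)) / edge_ratio c e (snd p) * (1 / edge_ratio c e (snd p) * tau ((r - fst p) / edge_ratio c e (snd p)))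
     - 1 / edge_ratio c e (snd p) * rho ((r - fst p) / edge_ratio c e (snd p)))"

lemma avg_measurable:
  assumes [measurable]: "f \<in> borel_measurable borel" and "is_kernel \<kappa>"
  shows "(\<lambda>p. avg \<kappa> f (fst p) (edge_ratio c e (snd p))) \<in> borel_measurable borel"
    and "(\<lambda>p. avg_quotient \<kappa> f (fst p) (edge_ratio c e (snd p))) \<in> borel_measurable borel"
proof -
  have [measurable]: "\<kappa> \<in> borel_measurable borel" using assms by (simp add: is_kernel_def)
  show "(\<lambda>p. avg \<kappa> f (fst p) (edge_ratio c e (snd p))) \<in> borel_measurable borel"
    unfolding avg_def by measurable
  show "(\<lambda>p. avg_quotient \<kappa> f (fst p) (edge_ratio c e (snd p))) \<in> borel_measurable borel"
    unfolding avg_quotient_def by measurable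
qed

lemma edge_ext_measurable:
  assumes [measurable]: "f \<in> borel_measurable borel"
  shows "edge_ext c e f \<in> borel_measurable borel" "edge_ext_x c e f \<in> borel_measurable borel" "edge_ext_y c e f \<in> borel_measurable borel"
proof -
  note [measurable] = avg_measurable(1)[OF assms is_kernel_rho(1)] avg_measurable(1)[OF assms is_kernel_rho(2)]
    avg_measurable(1)[OF assms is_kernel_rho(3)]
  show "edge_ext c e f \<in> borel_measurable borel" unfolding edge_ext_def[abs_def] by measurable
  show "edge_ext_x c e f \<in> borel_measurable borel" unfolding edge_ext_x_def[abs_def] by measurable
  show "edge_ext_y c e f \<in> borel_measurable borel" unfolding edge_ext_y_def[abs_def] by measurable
qed

lemma avg_kernel:
  assumes f: "locally_L1 f" and \<kappa>: "is_kernel \<kappa>" and t: "0 < t"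
  shows "integrable lborel (\<lambda>r. f r * (1 / t * \<kappa> ((r - x) / t)))"
    and "(\<integral>r. f r * (1 / t * \<kappa> ((r - x) / t)) \<partial>lborel) = avg \<kappa> f x t"
proof -
  have e: "f (x + t * s) * (1 / t * \<kappa> ((x + t * s - x) / t)) = 1 / t * (f (x + s * t) * \<kappa> s)" for s
    using t by (simp add: mult.commute)
  have "integrable lborel (\<lambda>s. f (x + t * s) * (1 / t * \<kappa> ((x + t * s - x) / t)))"
    unfolding e using kernel_mult_integrable[OF assms] by simp
  then show "integrable lborel (\<lambda>r. f r * (1 / t * \<kappa> ((r - x) / t)))"
    using t lborel_integrable_real_affine_iff[of t "\<lambda>r. f r * (1 / t * \<kappa> ((r - x) / t))" x] by simp
  have "(\<integral>r. f r * (1 / t * \<kappa> ((r - x) / t)) \<partial>lborel) = \<bar>t\<bar> *\<^sub>R (\<integral>s. f (x + t * s) * (1 / t * \<kappa> ((x + t * s - x) / t)) \<partial>lborel)"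
    using t by (intro lborel_integral_real_affine) auto
  also have "\<dots> = avg \<kappa> f x t" unfolding e using t by (simp add: avg_def)
  finally show "(\<integral>r. f r * (1 / t * \<kappa> ((r - x) / t)) \<partial>lborel) = avg \<kappa> f x t" .
qed

lemma edge_ker_integral:
  assumes edge: "is_edge c e" and f: "locally_L1 f" and p: "p \<in> strip"
  shows "(\<integral>r. f r * edge_ker c e r p \<partial>lborel) = edge_ext c e f p"
    and "(\<integral>r. f r * edge_ker_x c e r p \<partial>lborel) = edge_ext_x c e f p"
    and "(\<integral>r. f r * edge_ker_y c e r p \<partial>lborel) = edge_ext_y c e f p"
proof -
  define l where "l = edge_ratio c e (snd p)"
  have l: "0 < l" using edge_ratio_bounds[OF edge p] by (simp add: l_def)
  note a = avg_kernel[OF f _ l, of _ "fst p"]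
  have "(\<integral>r. f r * edge_ker c e r p \<partial>lborel) = (\<integral>r. (1 - l) * (f r * (1 / l * rho ((r - fst p) / l))) \<partial>lborel)"
    by (rule Bochner_Integration.integral_cong) (auto simp: edge_ker_def l_def)
  also have "\<dots> = (1 - l) * avg rho f (fst p) l"
    unfolding a(2)[OF is_kernel_rho(1), symmetric] by (rule integral_mult_right_zero)
  finally show "(\<integral>r. f r * edge_ker c e r p \<partial>lborel) = edge_ext c e f p" by (simp add: edge_ext_def l_def)
  have "(\<integral>r. f r * edge_ker_x c e r p \<partial>lborel) = (\<integral>r. - ((1 - l) / l) * (f r * (1 / l * rho' ((r - fst p) / l))) \<partial>lborel)"
    by (rule Bochner_Integration.integral_cong) (auto simp: edge_ker_x_def l_def)
  also have "\<dots> = - ((1 - l) / l) * avg rho' f (fst p) l"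
    unfolding a(2)[OF is_kernel_rho(2), symmetric] by (rule integral_mult_right_zero)
  finally show "(\<integral>r. f r * edge_ker_x c e r p \<partial>lborel) = edge_ext_x c e f p" by (simp add: edge_ext_x_def l_def)
  have "(\<integral>r. f r * edge_ker_y c e r p \<partial>lborel) = (\<integral>r. c / pi * ((1 - l) / l * (f r * (1 / l * tau ((r - fst p) / l))) -
      f r * (1 / l * rho ((r - fst p) / l))) \<partial>lborel)"
  proof (rule Bochner_Integration.integral_cong[OF refl])
    fix r
    have "f r * (C * (A * B - D)) = C * (A * (f r * B) - f r * D)" for A B C D by (simp add: algebra_simps)
    then show "f r * edge_ker_y c e r p = c / pi * ((1 - l) / l * (f r * (1 / l * tau ((r - fst p) / l))) -
      f r * (1 / l * rho ((r - fst p) / l)))"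
      unfolding edge_ker_y_def l_def[symmetric] by blast
  qed
  also have "\<dots> = c / pi * (\<integral>r. (1 - l) / l * (f r * (1 / l * tau ((r - fst p) / l))) -
      f r * (1 / l * rho ((r - fst p) / l)) \<partial>lborel)"
    by (rule integral_mult_right_zero)
  also have "(\<integral>r. (1 - l) / l * (f r * (1 / l * tau ((r - fst p) / l))) -
      f r * (1 / l * rho ((r - fst p) / l)) \<partial>lborel) = (\<integral>r. (1 - l) / l * (f r * (1 / l * tau ((r - fst p) / l))) \<partial>lborel) -
      (\<integral>r. f r * (1 / l * rho ((r - fst p) / l)) \<partial>lborel)"
    by (rule Bochner_Integration.integral_diff[OF integrable_mult_right[OF a(1)[OF is_kernel_rho(3)]] a(1)[OF is_kernel_rho(1)]])
  also have "(\<integral>r. (1 - l) / l * (f r * (1 / l * tau ((r - fst p) / l))) \<partial>lborel) = (1 - l) / l * avg tau f (fst p) l"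
    unfolding a(2)[OF is_kernel_rho(3), symmetric] by (rule integral_mult_right_zero)
  finally show "(\<integral>r. f r * edge_ker_y c e r p \<partial>lborel) = edge_ext_y c e f p"
    unfolding a(2)[OF is_kernel_rho(1)] by (simp add: edge_ext_y_def l_def)
qed

lemma edge_ker_deriv:
  assumes edge: "is_edge c e" and p: "p \<in> strip"
  shows "((\<lambda>t. edge_ker c e r (p + t *\<^sub>R (1, 0))) has_real_derivative edge_ker_x c e r p) (at 0)"
    and "((\<lambda>t. edge_ker c e r (p + t *\<^sub>R (0, 1))) has_real_derivative edge_ker_y c e r p) (at 0)"
proof -
  define l where "l = edge_ratio c e (snd p)"
  have l: "0 < l" using edge_ratio_bounds[OF edge p] by (simp add: l_def)
  define \<sigma> where "\<sigma> = (r - fst p) / l"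
  have d1: "((\<lambda>t. (r - (fst p + t)) / l) has_real_derivative - (1 / l)) (at 0)"
    using l by (auto intro!: derivative_eq_intros simp: field_simps)
  have "((\<lambda>t. rho ((r - (fst p + t)) / l)) has_real_derivative rho' ((r - (fst p + 0)) / l) * - (1 / l)) (at 0)"
    by (rule DERIV_chain2[OF rho_deriv d1])
  then have "((\<lambda>t. (1 - l) * (1 / l * rho ((r - (fst p + t)) / l))) has_real_derivative
      (1 - l) * (1 / l * (rho' ((r - (fst p + 0)) / l) * - (1 / l)))) (at 0)"
    by (intro DERIV_cmult)
  then show "((\<lambda>t. edge_ker c e r (p + t *\<^sub>R (1, 0))) has_real_derivative edge_ker_x c e r p) (at 0)"
    by (simp add: edge_ker_def edge_ker_x_def l_def[symmetric])
  define L where "L t = edge_ratio c e (snd p + t)" for t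
  have L0: "L 0 = l" by (simp add: L_def l_def)
  have dL: "(L has_real_derivative c / pi) (at 0)"
    unfolding L_def edge_ratio_def by (auto intro!: derivative_eq_intros)
  have d2: "((\<lambda>t. (r - fst p) / L t) has_real_derivative - (\<sigma> * (c / pi) / l)) (at 0)"
    using l by (auto intro!: derivative_eq_intros dL simp: L0 \<sigma>_def power2_eq_square)
  have d3: "((\<lambda>t. rho ((r - fst p) / L t)) has_real_derivative rho' \<sigma> * - (\<sigma> * (c / pi) / l)) (at 0)"
    using DERIV_chain2[OF rho_deriv d2] by (simp add: L0 \<sigma>_def)
  have d4: "((\<lambda>t. (1 - L t) * (1 / L t)) has_real_derivative - (c / pi) / l\<^sup>2) (at 0)"
    using l by (auto intro!: derivative_eq_intros dL simp: L0 power2_eq_square field_simps)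
  have "((\<lambda>t. ((1 - L t) * (1 / L t)) * rho ((r - fst p) / L t)) has_real_derivative
     (- (c / pi) / l\<^sup>2) * rho \<sigma> + (rho' \<sigma> * - (\<sigma> * (c / pi) / l)) * ((1 - l) * (1 / l))) (at 0)"
    using DERIV_mult[OF d4 d3] by (simp add: L0 \<sigma>_def)
  \<comment> \<open>Since 1 = (1 - l) + l, the first term splits into a part with factor (1 - l)
    over l squared, which joins the term with \<open>rho'\<close> to form \<open>tau\<close>, and a
    part with factor 1 / l, which is the derivative of the weight.\<close>
  moreover have "(- (c / pi) / l\<^sup>2) * rho \<sigma> + (rho' \<sigma> * - (\<sigma> * (c / pi) / l)) * ((1 - l) * (1 / l)) = edge_ker_y c e r p"
    using l unfolding edge_ker_y_def l_def[symmetric] \<sigma>_def[symmetric] tau_def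
    by (simp add: field_simps power2_eq_square)
  moreover have "(\<lambda>t. ((1 - L t) * (1 / L t)) * rho ((r - fst p) / L t)) = (\<lambda>t. edge_ker c e r (p + t *\<^sub>R (0, 1)))"
    by (simp add: edge_ker_def L_def fun_eq_iff)
  ultimately show "((\<lambda>t. edge_ker c e r (p + t *\<^sub>R (0, 1))) has_real_derivative edge_ker_y c e r p) (at 0)" by simp
qed

text \<open>On a compact subset of the strip the ratio attains a positive minimum, and at most two
  powers of its reciprocal occur in the kernels. As a function of \<open>r\<close> each kernel lives
  on an interval of length below 1 starting at \<open>fst p\<close>.\<close>

lemma edge_ker_bounded:
  assumes edge: "is_edge c e" and K: "compact K" "K \<subseteq> strip"
  shows "\<exists>C R. \<forall>p\<in>K. \<forall>r. (\<bar>edge_ker c e r p\<bar> \<le> C \<and> \<bar>edge_ker_x c e r p\<bar> \<le> C \<and> \<bar>edge_ker_y c e r p\<bar> \<le> C) \<and>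
     (r \<notin> {- R..R} \<longrightarrow> edge_ker c e r p = 0 \<and> edge_ker_x c e r p = 0 \<and> edge_ker_y c e r p = 0)"
proof (cases "K = {}")
  case False
  have "continuous_on K (\<lambda>p. edge_ratio c e (snd p))" unfolding edge_ratio_def by (intro continuous_intros) auto
  from continuous_attains_inf[OF K(1) False this] obtain q where q: "q \<in> K" "\<And>p. p \<in> K \<Longrightarrow> edge_ratio c e (snd q) \<le> edge_ratio c e (snd p)" by blast
  define m where "m = 1 / edge_ratio c e (snd q)"
  have q01: "0 < edge_ratio c e (snd q)" "edge_ratio c e (snd q) < 1" using edge_ratio_bounds[OF edge, of q] q K by auto
  then have m1: "1 \<le> m" by (simp add: m_def)
  have "\<exists>X. \<forall>p\<in>K. norm p \<le> X" using compact_imp_bounded[OF K(1)] by (simp add: bounded_iff)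
  then obtain X where X: "\<And>p. p \<in> K \<Longrightarrow> norm p \<le> X" by blast
  show ?thesis
  \<comment> \<open>\<open>m\<close> bounds the reciprocal of the ratio, and 40 = 20 + 20 accounts
    for the two terms of \<open>edge_ker_y\<close>; a margin of 1 beyond the abscissas of
    \<open>K\<close> covers the supports.\<close>
  proof (rule exI[of _ "40 * (m * m)"], rule exI[of _ "X + 1"], intro ballI allI)
    fix p r assume p: "p \<in> K"
    define l where "l = edge_ratio c e (snd p)"
    have l: "0 < l" "l < 1" using edge_ratio_bounds[OF edge, of p] p K by (auto simp: l_def)
    have lm: "1 / l \<le> m" using q(2)[OF p] q01 l by (simp add: m_def l_def frac_le)
    define \<sigma> where "\<sigma> = (r - fst p) / l"
    have b: "\<bar>rho \<sigma>\<bar> \<le> 20" "\<bar>rho' \<sigma>\<bar> \<le> 20" "\<bar>tau \<sigma>\<bar> \<le> 20"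
      using is_kernel_rho by (auto simp: is_kernel_def)
    have B: "\<bar>1 / l * z\<bar> \<le> m * 20" if "\<bar>z\<bar> \<le> 20" for z
      unfolding abs_mult using lm l m1 that by (intro mult_mono) auto
    have l1: "\<bar>1 - l\<bar> \<le> 1" using l by auto
    have l2: "\<bar>(1 - l) / l\<bar> \<le> m"
    proof -
      have "\<bar>(1 - l) / l\<bar> \<le> 1 / l" using l by (simp add: abs_divide divide_right_mono)
      then show ?thesis using lm by linarith
    qed
    have mm: "m \<le> m * m" using m1 by simp
    have "\<bar>edge_ker c e r p\<bar> \<le> 1 * (m * 20)"
      unfolding edge_ker_def l_def[symmetric] \<sigma>_def[symmetric] abs_mult[of "1 - l"]
      using l1 B[OF b(1)] by (intro mult_mono) auto
    then have 1: "\<bar>edge_ker c e r p\<bar> \<le> 40 * (m * m)" using mm m1 by linarith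
    have "\<bar>edge_ker_x c e r p\<bar> \<le> m * (m * 20)"
      unfolding edge_ker_x_def l_def[symmetric] \<sigma>_def[symmetric] abs_mult[of "- ((1 - l) / l)"] abs_minus_cancel
      using l2 B[OF b(2)] m1 by (intro mult_mono) auto
    then have 2: "\<bar>edge_ker_x c e r p\<bar> \<le> 40 * (m * m)" using m1 mm by (simp add: algebra_simps)
    have "\<bar>(1 - l) / l * (1 / l * tau \<sigma>)\<bar> \<le> m * (m * 20)"
      unfolding abs_mult[of "(1 - l) / l"] using l2 B[OF b(3)] m1 by (intro mult_mono) auto
    then have "\<bar>(1 - l) / l * (1 / l * tau \<sigma>) - 1 / l * rho \<sigma>\<bar> \<le> m * (m * 20) + m * 20"
      using B[OF b(1)] by linarith
    also have "\<dots> \<le> 40 * (m * m)" using mm by (simp add: algebra_simps)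
    finally have *: "\<bar>(1 - l) / l * (1 / l * tau \<sigma>) - 1 / l * rho \<sigma>\<bar> \<le> 40 * (m * m)" .
    have cpi: "\<bar>c / pi\<bar> \<le> 1" using is_edge_cases(1)[OF edge] pi_gt3 by (simp add: abs_divide)
    have "\<bar>edge_ker_y c e r p\<bar> \<le> 1 * (40 * (m * m))"
      unfolding edge_ker_y_def l_def[symmetric] \<sigma>_def[symmetric] abs_mult[of "c / pi"]
      using cpi * by (intro mult_mono) auto
    then have 3: "\<bar>edge_ker_y c e r p\<bar> \<le> 40 * (m * m)" by simp
    have 4: "edge_ker c e r p = 0 \<and> edge_ker_x c e r p = 0 \<and> edge_ker_y c e r p = 0" if r: "r \<notin> {- (X + 1)..X + 1}"
    proof -
      have "\<bar>fst p\<bar> \<le> X" using norm_fst_le[of "fst p" "snd p"] X[OF p] by simp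
      then have "r < fst p \<or> fst p + 1 < r" using r by auto
      then have "\<sigma> < 0 \<or> 1 < \<sigma>" using l by (auto simp: \<sigma>_def divide_less_0_iff less_divide_eq)
      then have "\<sigma> \<notin> {0..1}" by auto
      then have "rho \<sigma> = 0" "rho' \<sigma> = 0" "tau \<sigma> = 0" using is_kernel_rho by (auto simp: is_kernel_def)
      then show ?thesis unfolding edge_ker_def edge_ker_x_def edge_ker_y_def l_def[symmetric] \<sigma>_def[symmetric] by simp
    qed
    show "(\<bar>edge_ker c e r p\<bar> \<le> 40 * (m * m) \<and> \<bar>edge_ker_x c e r p\<bar> \<le> 40 * (m * m) \<and> \<bar>edge_ker_y c e r p\<bar> \<le> 40 * (m * m)) \<and>
     (r \<notin> {- (X + 1)..X + 1} \<longrightarrow> edge_ker c e r p = 0 \<and> edge_ker_x c e r p = 0 \<and> edge_ker_y c e r p = 0)"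
      using 1 2 3 4 by blast
  qed
qed simp

text \<open>The disjunction in the hypothesis lets one proof treat both coordinate directions.
  Integrability is listed separately because the contributions of the two edges are added
  later.\<close>

lemma edge_ext_weak_partial:
  assumes edge: "is_edge c e" and f: "locally_L1 f"
    and i: "i = (1, 0) \<and> k' = edge_ker_x c e \<and> g = edge_ext_x c e f \<or> i = (0, 1) \<and> k' = edge_ker_y c e \<and> g = edge_ext_y c e f"
  shows "compact K \<Longrightarrow> K \<subseteq> strip \<Longrightarrow> set_integrable lborel K (edge_ext c e f)"
    and "test_fun strip \<phi> \<Longrightarrow> integrable lborel (\<lambda>p. indicator strip p * (edge_ext c e f p * partial i \<phi> p))"
    and "test_fun strip \<phi> \<Longrightarrow> integrable lborel (\<lambda>p. indicator strip p * (g p * \<phi> p))"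
    and "test_fun strip \<phi> \<Longrightarrow> (\<integral>p. indicator strip p * (edge_ext c e f p * partial i \<phi> p) \<partial>lborel) =
      - (\<integral>p. indicator strip p * (g p * \<phi> p) \<partial>lborel)"
proof -
  have [measurable]: "f \<in> borel_measurable borel" using f by (simp add: locally_L1_def)
  have km: "(\<lambda>q. edge_ker c e (fst q) (snd q)) \<in> borel_measurable borel" "(\<lambda>q. k' (fst q) (snd q)) \<in> borel_measurable borel"
  proof -
    have *: "(\<lambda>q. edge_ker c e (fst q) (snd q)) \<in> borel_measurable (borel \<Otimes>\<^sub>M borel)" unfolding edge_ker_def by measurable
    have "(\<lambda>q. edge_ker_x c e (fst q) (snd q)) \<in> borel_measurable (borel \<Otimes>\<^sub>M borel)" unfolding edge_ker_x_def by measurable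
    moreover have "(\<lambda>q. edge_ker_y c e (fst q) (snd q)) \<in> borel_measurable (borel \<Otimes>\<^sub>M borel)" unfolding edge_ker_y_def by measurable
    ultimately have "(\<lambda>q. k' (fst q) (snd q)) \<in> borel_measurable (borel \<Otimes>\<^sub>M borel)" using i by auto
    with * show "(\<lambda>q. edge_ker c e (fst q) (snd q)) \<in> borel_measurable borel" "(\<lambda>q. k' (fst q) (snd q)) \<in> borel_measurable borel"
      by (simp_all add: borel_prod)
  qed
  have floc: "integrable lborel (\<lambda>r. f r * indicator {- R..R} r)" for R using f by (simp add: locally_L1_def)
  have kd: "((\<lambda>t. edge_ker c e r (p + t *\<^sub>R i)) has_real_derivative k' r p) (at 0)" if "p \<in> strip" for r p
    using edge_ker_deriv[OF edge that, of r] i by auto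
  have kb: "\<exists>C R. \<forall>p\<in>K. \<forall>r. \<bar>edge_ker c e r p\<bar> \<le> C \<and> \<bar>k' r p\<bar> \<le> C \<and> (r \<notin> {- R..R} \<longrightarrow> edge_ker c e r p = 0 \<and> k' r p = 0)"
    if K: "compact K" "K \<subseteq> strip" for K
  proof -
    obtain C R where CR: "\<forall>p\<in>K. \<forall>r. (\<bar>edge_ker c e r p\<bar> \<le> C \<and> \<bar>edge_ker_x c e r p\<bar> \<le> C \<and> \<bar>edge_ker_y c e r p\<bar> \<le> C) \<and>
     (r \<notin> {- R..R} \<longrightarrow> edge_ker c e r p = 0 \<and> edge_ker_x c e r p = 0 \<and> edge_ker_y c e r p = 0)"
      using edge_ker_bounded[OF edge K] by (elim exE)
    then show ?thesis using i by (intro exI[of _ C] exI[of _ R]) auto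
  qed
  have iB: "i \<in> Basis" using i by (auto simp: Basis_plane)
  note W = kernel_weak_partial[OF _ floc km kd kb iB]
  have e: "indicator strip p * ((\<integral>r. f r * edge_ker c e r p \<partial>lborel) * x) = indicator strip p * (edge_ext c e f p * x)"
     "indicator strip p * ((\<integral>r. f r * k' r p \<partial>lborel) * x) = indicator strip p * (g p * x)" for p x
    using edge_ker_integral[OF edge f, of p] i by (auto simp: indicator_def)
  show "set_integrable lborel K (edge_ext c e f)" if K: "compact K" "K \<subseteq> strip"
  proof -
    have "set_integrable lborel K (\<lambda>p. \<integral>r. f r * edge_ker c e r p \<partial>lborel)" by (rule W(1)) (use K in auto)
    moreover have "indicator K p *\<^sub>R (\<integral>r. f r * edge_ker c e r p \<partial>lborel) = indicator K p *\<^sub>R edge_ext c e f p" for p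
      using edge_ker_integral(1)[OF edge f, of p] K by (auto simp: indicator_def)
    ultimately show ?thesis by (simp only: set_integrable_def)
  qed
  assume \<phi>: "test_fun strip \<phi>"
  have "integrable lborel (\<lambda>p. indicator strip p * ((\<integral>r. f r * edge_ker c e r p \<partial>lborel) * partial i \<phi> p))"
    by (rule W(2)) (use \<phi> in auto)
  then show "integrable lborel (\<lambda>p. indicator strip p * (edge_ext c e f p * partial i \<phi> p))" by (simp only: e)
  have "integrable lborel (\<lambda>p. indicator strip p * ((\<integral>r. f r * k' r p \<partial>lborel) * \<phi> p))"
    by (rule W(3)) (use \<phi> in auto)
  then show "integrable lborel (\<lambda>p. indicator strip p * (g p * \<phi> p))" by (simp only: e)
  have "(\<integral>p. indicator strip p * ((\<integral>r. f r * edge_ker c e r p \<partial>lborel) * partial i \<phi> p) \<partial>lborel) =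
      - (\<integral>p. indicator strip p * ((\<integral>r. f r * k' r p \<partial>lborel) * \<phi> p) \<partial>lborel)"
    by (rule W(4)) (use \<phi> in auto)
  then show "(\<integral>p. indicator strip p * (edge_ext c e f p * partial i \<phi> p) \<partial>lborel) =
      - (\<integral>p. indicator strip p * (g p * \<phi> p) \<partial>lborel)" by (simp only: e)
qed

section \<open>Combining the contributions of the two edges\<close>

lemma square_sum5: "(a + b + c + d + e)\<^sup>2 \<le> 5 * (a\<^sup>2 + b\<^sup>2 + c\<^sup>2 + d\<^sup>2 + e\<^sup>2)" for a b c d e :: real
proof -
  have *: "2 * x * y \<le> x\<^sup>2 + y\<^sup>2" for x y :: real by (rule sum_squares_bound)
  show ?thesis
    using *[of a b] *[of a c] *[of a d] *[of a e] *[of b c] *[of b d] *[of b e] *[of c d] *[of c e] *[of d e]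
    by (simp add: power2_eq_square algebra_simps)
qed

lemma mult_square_le: "0 \<le> l \<Longrightarrow> l \<le> 1 \<Longrightarrow> (l * x)\<^sup>2 \<le> x\<^sup>2" for l x :: real
  by (simp add: power_mult_distrib mult_left_le_one_le power_le_one)

text \<open>The means of \<open>rho'\<close> and \<open>tau\<close> vanish, which cancels the
  singular factor 1 / l. A bare value of \<open>f\<close> remains only in the y-derivative, with the
  sign of \<open>- c\<close>: opposite for the two edges, so the sum over both contains only the
  difference of the boundary functions.\<close>

lemma edge_ext_in_terms_of_quotients:
  assumes edge: "is_edge c e" and f: "locally_L1 f" and p: "p \<in> strip"
  defines "l \<equiv> edge_ratio c e (snd p)"
  shows "edge_ext c e f p = (1 - l) * (f (fst p) + l * avg_quotient rho f (fst p) l)"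
    and "edge_ext_x c e f p = - ((1 - l) * avg_quotient rho' f (fst p) l)"
    and "edge_ext_y c e f p = c / pi * ((1 - l) * avg_quotient tau f (fst p) l - f (fst p) - l * avg_quotient rho f (fst p) l)"
proof -
  have l: "0 < l" using edge_ratio_bounds[OF edge p] by (simp add: l_def)
  note a = avg_eq[OF f _ l, of _ "fst p"]
  show "edge_ext c e f p = (1 - l) * (f (fst p) + l * avg_quotient rho f (fst p) l)"
    by (simp add: edge_ext_def l_def[symmetric] a[OF is_kernel_rho(1)] rho_integral)
  show "edge_ext_x c e f p = - ((1 - l) * avg_quotient rho' f (fst p) l)"
    using l by (simp add: edge_ext_x_def l_def[symmetric] a[OF is_kernel_rho(2)] rho_integral)
  show "edge_ext_y c e f p = c / pi * ((1 - l) * avg_quotient tau f (fst p) l - f (fst p) - l * avg_quotient rho f (fst p) l)"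
    using l by (simp add: edge_ext_y_def l_def[symmetric] a[OF is_kernel_rho(1)] a[OF is_kernel_rho(3)] rho_integral)
qed

text \<open>A single majorant \<open>Q\<close> controls the squared gradient and both weighted
  deviations from the boundary functions. One integral bound for it therefore yields the energy
  estimate and, through \<open>trace_atI\<close>, both traces.\<close>

lemma extension_theorem:
  assumes Ht: "in_Ht f0" "in_Ht f1" and L2: "in_L2 (\<lambda>x. f0 x - f1 x)"
  shows "\<exists>F G. in_H1 F G \<and> is_trace0 F f0 \<and> is_trace1 F f1 \<and>
     H1_norm_sq G \<le> ennreal 24000 * (Ht_norm_sq f0 + Ht_norm_sq f1 + L2_norm_sq (\<lambda>x. f0 x - f1 x))"
proof -
  have f: "locally_L1 f0" "locally_L1 f1" using Ht by (auto intro: in_Ht_locally_L1)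
  have fm[measurable]: "f0 \<in> borel_measurable borel" "f1 \<in> borel_measurable borel" using Ht by (auto simp: in_Ht_def)
  have E: "is_edge 1 0" "is_edge (- 1) pi" by (auto simp: is_edge_def)
  define F where "F p = edge_ext 1 0 f0 p + edge_ext (- 1) pi f1 p" for p
  define G where "G p = (edge_ext_x 1 0 f0 p + edge_ext_x (- 1) pi f1 p, edge_ext_y 1 0 f0 p + edge_ext_y (- 1) pi f1 p)" for p
  note em[measurable] = edge_ext_measurable[OF fm(1)] edge_ext_measurable[OF fm(2)]
  have Fm[measurable]: "F \<in> borel_measurable borel" and Gm[measurable]: "G \<in> borel_measurable borel"
    unfolding F_def[abs_def] G_def[abs_def] by measurable
  have weak: "weak_gradient F G strip"
    unfolding weak_gradient_def
  proof (intro conjI allI impI)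
    show "set_borel_measurable lborel strip F" "set_borel_measurable lborel strip G"
      unfolding set_borel_measurable_def by measurable
    show "locally_integrable_on F strip"
      unfolding locally_integrable_on_def
    proof (intro allI impI)
      fix K assume K: "compact K \<and> K \<subseteq> strip"
      have "set_integrable lborel K (edge_ext 1 0 f0)" "set_integrable lborel K (edge_ext (- 1) pi f1)"
        using edge_ext_weak_partial(1)[OF E(1) f(1), of "(1, 0)" "edge_ker_x 1 0" "edge_ext_x 1 0 f0" K]
          edge_ext_weak_partial(1)[OF E(2) f(2), of "(1, 0)" "edge_ker_x (- 1) pi" "edge_ext_x (- 1) pi f1" K] K by auto
      then show "set_integrable lborel K F" unfolding F_def[abs_def] by (rule set_integral_add(1))
    qed
    fix \<phi> and i :: "real \<times> real"
    assume "test_fun strip \<phi> \<and> i \<in> Basis"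
    then have \<phi>: "test_fun strip \<phi>" and i: "i = (1, 0) \<or> i = (0, 1)" by (auto simp: Basis_plane)
    define g0 where "g0 = (if i = (1, 0) then edge_ext_x 1 0 f0 else edge_ext_y 1 0 f0)"
    define g1 where "g1 = (if i = (1, 0) then edge_ext_x (- 1) pi f1 else edge_ext_y (- 1) pi f1)"
    have c0: "i = (1, 0) \<and> (if i = (1, 0) then edge_ker_x 1 0 else edge_ker_y 1 0) = edge_ker_x 1 0 \<and> g0 = edge_ext_x 1 0 f0 \<or>
        i = (0, 1) \<and> (if i = (1, 0) then edge_ker_x 1 0 else edge_ker_y 1 0) = edge_ker_y 1 0 \<and> g0 = edge_ext_y 1 0 f0"
      using i by (auto simp: g0_def)
    have c1: "i = (1, 0) \<and> (if i = (1, 0) then edge_ker_x (- 1) pi else edge_ker_y (- 1) pi) = edge_ker_x (- 1) pi \<and> g1 = edge_ext_x (- 1) pi f1 \<or>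
        i = (0, 1) \<and> (if i = (1, 0) then edge_ker_x (- 1) pi else edge_ker_y (- 1) pi) = edge_ker_y (- 1) pi \<and> g1 = edge_ext_y (- 1) pi f1"
      using i by (auto simp: g1_def)
    have Gi: "G p \<bullet> i = g0 p + g1 p" for p
      using i by (auto simp: G_def g0_def g1_def inner_prod_def)
    note W0 = edge_ext_weak_partial[OF E(1) f(1) c0] and W1 = edge_ext_weak_partial[OF E(2) f(2) c1]
    have "(LINT p:strip|lborel. F p * partial i \<phi> p) = (\<integral>p. indicator strip p * (edge_ext 1 0 f0 p * partial i \<phi> p) +
        indicator strip p * (edge_ext (- 1) pi f1 p * partial i \<phi> p) \<partial>lborel)"
      unfolding set_lebesgue_integral_def by (rule Bochner_Integration.integral_cong) (auto simp: F_def algebra_simps)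
    also have "\<dots> = - (\<integral>p. indicator strip p * (g0 p * \<phi> p) \<partial>lborel) + - (\<integral>p. indicator strip p * (g1 p * \<phi> p) \<partial>lborel)"
      by (simp only: Bochner_Integration.integral_add[OF W0(2)[OF \<phi>] W1(2)[OF \<phi>]] W0(4)[OF \<phi>] W1(4)[OF \<phi>])
    also have "\<dots> = - (\<integral>p. indicator strip p * (g0 p * \<phi> p) + indicator strip p * (g1 p * \<phi> p) \<partial>lborel)"
      by (simp only: Bochner_Integration.integral_add[OF W0(3)[OF \<phi>] W1(3)[OF \<phi>]] minus_add_distrib)
    also have "(\<integral>p. indicator strip p * (g0 p * \<phi> p) + indicator strip p * (g1 p * \<phi> p) \<partial>lborel) =
       (LINT p:strip|lborel. (G p \<bullet> i) * \<phi> p)"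
      unfolding set_lebesgue_integral_def Gi by (rule Bochner_Integration.integral_cong) (auto simp: algebra_simps)
    finally show "(LINT p:strip|lborel. F p * partial i \<phi> p) = - (LINT p:strip|lborel. (G p \<bullet> i) * \<phi> p)" .
  qed
  define A where "A j \<kappa> p = (if j then avg_quotient \<kappa> f1 (fst p) (edge_ratio (- 1) pi (snd p)) else avg_quotient \<kappa> f0 (fst p) (edge_ratio 1 0 (snd p)))"
    for j :: bool and \<kappa> and p :: "real \<times> real"
  have Am[measurable]: "A j rho \<in> borel_measurable borel" "A j rho' \<in> borel_measurable borel" "A j tau \<in> borel_measurable borel" for j
    unfolding A_def using avg_measurable(2)[OF fm(1)] avg_measurable(2)[OF fm(2)] is_kernel_rho by (cases j; simp)+
  define D where "D p = f1 (fst p) - f0 (fst p)" for p :: "real \<times> real"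
  have [measurable]: "D \<in> borel_measurable borel" unfolding D_def by measurable
  \<comment> \<open>Contains the difference of the boundary functions and the quotients for all
    three kernels at both edges; the factor 5 is the number of terms squared together in the
    y-derivative.\<close>
  define Q where "Q p = 5 * ((D p)\<^sup>2 + ((A False rho p)\<^sup>2 + (A True rho p)\<^sup>2) + ((A False rho' p)\<^sup>2 + (A True rho' p)\<^sup>2) + ((A False tau p)\<^sup>2 + (A True tau p)\<^sup>2))" for p
  have ratio01: "edge_ratio (- 1) pi y = 1 - edge_ratio 1 0 y" for y by (simp add: edge_ratio_def field_simps)
  have GQ: "(norm (G p))\<^sup>2 \<le> Q p" and F0Q: "(F p - f0 (fst p))\<^sup>2 / (1 * (snd p - 0))\<^sup>2 \<le> Q p"
    and F1Q: "(F p - f1 (fst p))\<^sup>2 / (- 1 * (snd p - pi))\<^sup>2 \<le> Q p" if p: "p \<in> strip" for p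
  proof -
    define l where "l = edge_ratio 1 0 (snd p)"
    have l: "0 < l" "l < 1" using edge_ratio_bounds[OF E(1) p] by (auto simp: l_def)
    define r0 r1 a0 a1 t0 t1 where rat: "r0 = A False rho p" "r1 = A True rho p" "a0 = A False rho' p" "a1 = A True rho' p" "t0 = A False tau p" "t1 = A True tau p"
    have Q: "Q p = 5 * ((D p)\<^sup>2 + (r0\<^sup>2 + r1\<^sup>2) + (a0\<^sup>2 + a1\<^sup>2) + (t0\<^sup>2 + t1\<^sup>2))" by (simp add: Q_def rat)
    note e0 = edge_ext_in_terms_of_quotients[OF E(1) f(1) p] and e1 = edge_ext_in_terms_of_quotients[OF E(2) f(2) p]
    have Fp: "F p = (1 - l) * (f0 (fst p) + l * r0) + l * (f1 (fst p) + (1 - l) * r1)"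
      unfolding F_def e0(1) e1(1) by (simp add: rat A_def ratio01 l_def)
    have Gx: "fst (G p) = - ((1 - l) * a0) - l * a1"
      unfolding G_def fst_conv e0(2) e1(2) by (simp add: rat A_def ratio01 l_def)
    have Gy: "snd (G p) = 1 / pi * (D p + (1 - l) * r1 + - (l * r0) + (1 - l) * t0 + - (l * t1))"
      unfolding G_def snd_conv e0(3) e1(3) by (simp add: rat A_def ratio01 l_def D_def field_simps)
    have sq: "(l * x)\<^sup>2 \<le> x\<^sup>2" "((1 - l) * x)\<^sup>2 \<le> x\<^sup>2" for x using l by (auto intro: mult_square_le)
    have pi1: "0 \<le> 1 / pi" "1 / pi \<le> 1" using pi_gt3 by auto
    have "(fst (G p))\<^sup>2 \<le> 2 * ((1 - l) * a0)\<^sup>2 + 2 * (l * a1)\<^sup>2"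
      unfolding Gx using zero_le_power2[of "(1 - l) * a0 - l * a1"] by (simp add: power2_eq_square algebra_simps)
    also have "\<dots> \<le> 5 * a0\<^sup>2 + 5 * a1\<^sup>2"
      using sq by (intro add_mono mult_mono) auto
    also have "\<dots> = 5 * (a0\<^sup>2 + a1\<^sup>2)" by simp
    finally have x: "(fst (G p))\<^sup>2 \<le> 5 * (a0\<^sup>2 + a1\<^sup>2)" .
    have "(snd (G p))\<^sup>2 \<le> (D p + (1 - l) * r1 + - (l * r0) + (1 - l) * t0 + - (l * t1))\<^sup>2"
      unfolding Gy by (rule mult_square_le[OF pi1])
    also have "\<dots> \<le> 5 * ((D p)\<^sup>2 + ((1 - l) * r1)\<^sup>2 + (- (l * r0))\<^sup>2 + ((1 - l) * t0)\<^sup>2 + (- (l * t1))\<^sup>2)"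
      by (rule square_sum5)
    also have "\<dots> \<le> 5 * ((D p)\<^sup>2 + r1\<^sup>2 + r0\<^sup>2 + t0\<^sup>2 + t1\<^sup>2)"
      unfolding power2_minus using sq by (intro mult_left_mono add_mono) auto
    finally have y: "(snd (G p))\<^sup>2 \<le> 5 * ((D p)\<^sup>2 + r1\<^sup>2 + r0\<^sup>2 + t0\<^sup>2 + t1\<^sup>2)" .
    have "(norm (G p))\<^sup>2 = (fst (G p))\<^sup>2 + (snd (G p))\<^sup>2" by (simp add: norm_prod_def)
    also have "\<dots> \<le> 5 * (a0\<^sup>2 + a1\<^sup>2) + 5 * ((D p)\<^sup>2 + r1\<^sup>2 + r0\<^sup>2 + t0\<^sup>2 + t1\<^sup>2)"
      by (rule add_mono[OF x y])
    also have "\<dots> = Q p" unfolding Q by (simp add: algebra_simps)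
    finally show "(norm (G p))\<^sup>2 \<le> Q p" .
    \<comment> \<open>The common shape of both deviations after division by the distance to the
      edge.\<close>
    have three: "((1 / pi) * (d + a + b))\<^sup>2 \<le> Q p" if "d\<^sup>2 \<le> (D p)\<^sup>2" "a\<^sup>2 \<le> r0\<^sup>2" "b\<^sup>2 \<le> r1\<^sup>2" for d a b
    proof -
      have "((1 / pi) * (d + a + b))\<^sup>2 \<le> (d + a + b + 0 + 0)\<^sup>2" using mult_square_le[OF pi1] by simp
      also have "\<dots> \<le> 5 * (d\<^sup>2 + a\<^sup>2 + b\<^sup>2 + 0\<^sup>2 + 0\<^sup>2)" by (rule square_sum5)
      also have "\<dots> = 5 * (d\<^sup>2 + a\<^sup>2 + b\<^sup>2)" by simp
      also have "\<dots> \<le> Q p"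
      proof -
        have "d\<^sup>2 + a\<^sup>2 + b\<^sup>2 \<le> (D p)\<^sup>2 + (r0\<^sup>2 + r1\<^sup>2) + (a0\<^sup>2 + a1\<^sup>2) + (t0\<^sup>2 + t1\<^sup>2)"
          using that zero_le_power2[of a0] zero_le_power2[of a1] zero_le_power2[of t0] zero_le_power2[of t1] by linarith
        then show ?thesis unfolding Q by (rule mult_left_mono) simp
      qed
      finally show ?thesis .
    qed
    have yl: "snd p = pi * l" by (simp add: l_def edge_ratio_def)
    \<comment> \<open>Every term carries \<open>l\<close>: the weight of the other edge is
      \<open>l\<close>, and the own average misses \<open>f0\<close> by \<open>l\<close> times a
      quotient. This cancels the distance \<open>pi * l\<close>.\<close>
    have "F p - f0 (fst p) = l * (D p + (1 - l) * r0 + (1 - l) * r1)" unfolding Fp D_def by (simp add: algebra_simps)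
    then have "(F p - f0 (fst p))\<^sup>2 / (1 * (snd p - 0))\<^sup>2 = ((1 / pi) * (D p + (1 - l) * r0 + (1 - l) * r1))\<^sup>2"
      unfolding yl using l by (simp add: power_mult_distrib power_divide)
    also have "\<dots> \<le> Q p" by (rule three) (use sq in auto)
    finally show "(F p - f0 (fst p))\<^sup>2 / (1 * (snd p - 0))\<^sup>2 \<le> Q p" .
    \<comment> \<open>The mirror image, with \<open>1 - l\<close> as the ratio belonging to the
      upper edge.\<close>
    have "F p - f1 (fst p) = (1 - l) * (- D p + l * r0 + l * r1)" unfolding Fp D_def by (simp add: algebra_simps)
    moreover have "- 1 * (snd p - pi) = pi * (1 - l)" unfolding yl by (simp add: algebra_simps)
    ultimately have "(F p - f1 (fst p))\<^sup>2 / (- 1 * (snd p - pi))\<^sup>2 = ((1 / pi) * (- D p + l * r0 + l * r1))\<^sup>2"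
      using l by (simp add: power_mult_distrib power_divide)
    also have "\<dots> \<le> Q p" by (rule three) (use sq in auto)
    finally show "(F p - f1 (fst p))\<^sup>2 / (- 1 * (snd p - pi))\<^sup>2 \<le> Q p" .
  qed
  define I where "I h = (\<integral>\<^sup>+p. ennreal ((h p)\<^sup>2) * indicator strip p \<partial>lborel)" for h :: "real \<times> real \<Rightarrow> real"
  define N where "N = Ht_norm_sq f0 + Ht_norm_sq f1 + L2_norm_sq (\<lambda>x. f0 x - f1 x)"
  have W: "diff_quot_sq f0 \<le> Ht_norm_sq f0" "diff_quot_sq f1 \<le> Ht_norm_sq f1"
    using mult_right_mono[of 1 2 "diff_quot_sq f0"] mult_right_mono[of 1 2 "diff_quot_sq f1"] by (simp_all add: Ht_norm_sq_eq_diff_quot_sq)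
  have IA: "I (A False \<kappa>) + I (A True \<kappa>) \<le> 1600 * (Ht_norm_sq f0 + Ht_norm_sq f1)" if "is_kernel \<kappa>" for \<kappa>
  proof -
    have "I (A False \<kappa>) \<le> 1600 * diff_quot_sq f0" "I (A True \<kappa>) \<le> 1600 * diff_quot_sq f1"
      unfolding I_def A_def edge_ratio_def if_True if_False
      by (rule avg_quotient_L2[OF E(1) f(1) that], rule avg_quotient_L2[OF E(2) f(2) that])
    moreover have "1600 * diff_quot_sq f0 \<le> 1600 * Ht_norm_sq f0" "1600 * diff_quot_sq f1 \<le> 1600 * Ht_norm_sq f1"
      using W by (auto intro: mult_left_mono)
    ultimately have "I (A False \<kappa>) + I (A True \<kappa>) \<le> 1600 * Ht_norm_sq f0 + 1600 * Ht_norm_sq f1"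
      by (meson add_mono order_trans)
    then show ?thesis by (simp only: distrib_left)
  qed
  have ID: "I D \<le> 4 * L2_norm_sq (\<lambda>x. f0 x - f1 x)"
  proof -
    have "I D = (\<integral>\<^sup>+x. \<integral>\<^sup>+y. ennreal ((f0 x - f1 x)\<^sup>2) * indicator {0<..<pi} y \<partial>lborel \<partial>lborel)"
      unfolding I_def using plane_nn_integral(1)[of "\<lambda>p. ennreal ((D p)\<^sup>2) * indicator strip p"]
      by (simp add: D_def strip_eq indicator_times power2_commute)
    also have "\<dots> = (\<integral>\<^sup>+x. ennreal ((f0 x - f1 x)\<^sup>2) * ennreal pi \<partial>lborel)"
      by (intro nn_integral_cong) (simp add: nn_integral_cmult)
    also have "\<dots> = L2_norm_sq (\<lambda>x. f0 x - f1 x) * ennreal pi"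
      unfolding L2_norm_sq_def by (rule nn_integral_multc) measurable
    also have "\<dots> \<le> L2_norm_sq (\<lambda>x. f0 x - f1 x) * ennreal 4"
      using pi_less_4 by (intro mult_left_mono ennreal_leI) auto
    finally show ?thesis by (simp add: mult.commute)
  qed
  have IQ: "(\<integral>\<^sup>+p. ennreal (Q p) * indicator strip p \<partial>lborel) \<le> ennreal 24000 * N"
  proof -
    have "(\<integral>\<^sup>+p. ennreal (Q p) * indicator strip p \<partial>lborel) = (\<integral>\<^sup>+p. 5 * (ennreal ((D p)\<^sup>2) * indicator strip p +
       (ennreal ((A False rho p)\<^sup>2) * indicator strip p + ennreal ((A True rho p)\<^sup>2) * indicator strip p) +
       (ennreal ((A False rho' p)\<^sup>2) * indicator strip p + ennreal ((A True rho' p)\<^sup>2) * indicator strip p) +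
       (ennreal ((A False tau p)\<^sup>2) * indicator strip p + ennreal ((A True tau p)\<^sup>2) * indicator strip p)) \<partial>lborel)"
    proof (rule nn_integral_cong)
      fix p
      have "ennreal (Q p) = 5 * (ennreal ((D p)\<^sup>2) + (ennreal ((A False rho p)\<^sup>2) + ennreal ((A True rho p)\<^sup>2)) +
         (ennreal ((A False rho' p)\<^sup>2) + ennreal ((A True rho' p)\<^sup>2)) + (ennreal ((A False tau p)\<^sup>2) + ennreal ((A True tau p)\<^sup>2)))"
        unfolding Q_def by (subst ennreal_mult) auto
      then show "ennreal (Q p) * indicator strip p = 5 * (ennreal ((D p)\<^sup>2) * indicator strip p +
       (ennreal ((A False rho p)\<^sup>2) * indicator strip p + ennreal ((A True rho p)\<^sup>2) * indicator strip p) +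
       (ennreal ((A False rho' p)\<^sup>2) * indicator strip p + ennreal ((A True rho' p)\<^sup>2) * indicator strip p) +
       (ennreal ((A False tau p)\<^sup>2) * indicator strip p + ennreal ((A True tau p)\<^sup>2) * indicator strip p))"
        by (simp add: indicator_def)
    qed
    also have "\<dots> = 5 * (I D + (I (A False rho) + I (A True rho)) + (I (A False rho') + I (A True rho')) + (I (A False tau) + I (A True tau)))"
      unfolding I_def by (simp add: nn_integral_cmult nn_integral_add)
    also have "\<dots> \<le> 5 * (4 * L2_norm_sq (\<lambda>x. f0 x - f1 x) + 1600 * (Ht_norm_sq f0 + Ht_norm_sq f1) +
       1600 * (Ht_norm_sq f0 + Ht_norm_sq f1) + 1600 * (Ht_norm_sq f0 + Ht_norm_sq f1))"
      by (intro mult_left_mono add_mono ID IA is_kernel_rho) simp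
    \<comment> \<open>The coefficient of the difference is raised to 3 * 1600, the total for the
      three kernels, to factor out the norm of the data; 24000 = 5 * 4800.\<close>
    also have "\<dots> \<le> 5 * (4800 * L2_norm_sq (\<lambda>x. f0 x - f1 x) + 1600 * (Ht_norm_sq f0 + Ht_norm_sq f1) +
       1600 * (Ht_norm_sq f0 + Ht_norm_sq f1) + 1600 * (Ht_norm_sq f0 + Ht_norm_sq f1))"
      by (intro mult_left_mono add_mono order_refl mult_right_mono) auto
    also have "\<dots> = 5 * (4800 * L2_norm_sq (\<lambda>x. f0 x - f1 x) + (1600 + 1600 + 1600) * (Ht_norm_sq f0 + Ht_norm_sq f1))"
      by (simp only: distrib_right add.assoc)
    also have "\<dots> = 24000 * N"
      by (simp add: N_def distrib_left mult.assoc[symmetric] add.commute add.left_commute)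
    finally show ?thesis by simp
  qed
  have "N < \<infinity>" using Ht L2 by (auto simp: N_def in_Ht_def in_L2_def)
  then have Nfin: "ennreal 24000 * N < \<infinity>" by (simp add: ennreal_mult_less_top)
  have mono: "(\<integral>\<^sup>+p. ennreal (q p) * indicator strip p \<partial>lborel) \<le> ennreal 24000 * N" if "\<And>p. p \<in> strip \<Longrightarrow> q p \<le> Q p" for q
  proof (rule order_trans[OF _ IQ])
    show "(\<integral>\<^sup>+p. ennreal (q p) * indicator strip p \<partial>lborel) \<le> (\<integral>\<^sup>+p. ennreal (Q p) * indicator strip p \<partial>lborel)"
      using that by (intro nn_integral_mono) (auto simp: indicator_def intro: ennreal_leI)
  qed
  have H: "H1_norm_sq G \<le> ennreal 24000 * N"
    unfolding H1_norm_sq_def by (rule mono[OF GQ])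
  have "in_H1 F G" unfolding in_H1_def using weak le_less_trans[OF H Nfin] by simp
  moreover have "is_trace0 F f0"
    unfolding is_trace0_iff by (rule trace_atI[OF E(1) fm(1) Fm refl le_less_trans[OF mono[OF F0Q] Nfin]])
  moreover have "is_trace1 F f1"
    unfolding is_trace1_iff by (rule trace_atI[OF E(2) fm(2) Fm refl le_less_trans[OF mono[OF F1Q] Nfin]])
  ultimately show ?thesis using H unfolding N_def by blast
qed

theorem theorem3p3:
  "\<exists>c::real. c > 0 \<and>
     (\<forall>F G. in_H1 F G \<longrightarrow>
        (\<exists>f0 f1. is_trace0 F f0 \<and> is_trace1 F f1) \<and>
        (\<forall>f0 f1. is_trace0 F f0 \<and> is_trace1 F f1 \<longrightarrow>
           in_Ht f0 \<and> in_Ht f1 \<and> in_L2 (\<lambda>x. f0 x - f1 x) \<and>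
           Ht_norm_sq f0 + Ht_norm_sq f1 + L2_norm_sq (\<lambda>x. f0 x - f1 x)
             \<le> ennreal c * H1_norm_sq G)) \<and>
     (\<forall>f0 f1. in_Ht f0 \<and> in_Ht f1 \<and> in_L2 (\<lambda>x. f0 x - f1 x) \<longrightarrow>
        (\<exists>F G. in_H1 F G \<and> is_trace0 F f0 \<and> is_trace1 F f1 \<and>
           H1_norm_sq G \<le> ennreal c * (Ht_norm_sq f0 + Ht_norm_sq f1 + L2_norm_sq (\<lambda>x. f0 x - f1 x))))"
proof (intro exI[of _ "24000::real"] conjI allI impI)
  fix F G assume H1: "in_H1 F G"
  note T = trace_theorem[OF H1]
  show "\<exists>f0 f1. is_trace0 F f0 \<and> is_trace1 F f1" using T by (rule conjunct1)
  fix f0 f1 assume tr: "is_trace0 F f0 \<and> is_trace1 F f1"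
  have T': "in_Ht f0 \<and> in_Ht f1 \<and> in_L2 (\<lambda>x. f0 x - f1 x) \<and>
     Ht_norm_sq f0 + Ht_norm_sq f1 + L2_norm_sq (\<lambda>x. f0 x - f1 x) \<le> ennreal 100 * H1_norm_sq G"
    using T tr by blast
  then show "in_Ht f0" "in_Ht f1" "in_L2 (\<lambda>x. f0 x - f1 x)" by auto
  \<comment> \<open>A single constant has to serve both directions, so the smaller one is enlarged
    to that of the extension.\<close>
  have "ennreal 100 * H1_norm_sq G \<le> ennreal 24000 * H1_norm_sq G"
    by (intro mult_right_mono ennreal_leI) auto
  with T' show "Ht_norm_sq f0 + Ht_norm_sq f1 + L2_norm_sq (\<lambda>x. f0 x - f1 x) \<le> ennreal 24000 * H1_norm_sq G"
    by (meson order_trans)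
next
  fix f0 f1 assume "in_Ht f0 \<and> in_Ht f1 \<and> in_L2 (\<lambda>x. f0 x - f1 x)"
  then show "\<exists>F G. in_H1 F G \<and> is_trace0 F f0 \<and> is_trace1 F f1 \<and>
     H1_norm_sq G \<le> ennreal 24000 * (Ht_norm_sq f0 + Ht_norm_sq f1 + L2_norm_sq (\<lambda>x. f0 x - f1 x))"
    by (intro extension_theorem) auto
qed simp

end
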